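(* Let $\Psi: \mathrm{Conv}(U,\mathbb{R})\rightarrow\mathcal{M}(U)$ be a continuous, dually epi-translation invariant valuation. If $\Psi$ is dually simple and locally determined, then there exists a unique continuous function $\psi\in C(U)$ such that for every $f\in\mathrm{Conv}(U,\mathbb{R})$, \begin{align*} \Psi(f)[B]=\int_B \psi(x)d\mathrm{MA}(f)[x]\quad\text{for all relatively compact Borel sets}~B\subset U. \end{align*}
   Context: $U\subset\mathbb{R}^n$ is an open convex set, $\mathrm{Conv}(U,\mathbb{R})$ is the space of all finite-valued convex functions $f:U\to\mathbb{R}$ with the topology of uniform convergence on compact subsets, and $\mathcal{M}(U)=(C_c(U))'$ is the space of complex Radon measures on $U$ with the weak*-topology. $\mathrm{MA}(f)$ denotes the real Monge-Amp\`ere measure of $f$ (the continuous extension of $\det(D^2f(x))\,d\mathrm{vol}_n(x)$ from $C^2$ convex functions). $\Psi$ is a valuation if $\Psi(f)+\Psi(h)=\Psi(f\vee h)+\Psi(f\wedge h)$ whenever $f\vee h, f\wedge h\in\mathrm{Conv}(U,\mathbb{R})$. It is dually epi-translation invariant if $\Psi(f+l)=\Psi(f)$ for all affine $l:\mathbb{R}^n\to\mathbb{R}$; locally determined if $f\equiv h$ on an open $V\subset U$ implies $\Psi(f)[B\cap V]=\Psi(h)[B\cap V]$ for all relatively compact Borel $B\subset U$; dually simple if $\Psi(\pi_E^*f|_U)=0$ for all $f\in\mathrm{Conv}(E,\mathbb{R})$ and all proper subspaces $E\subset\mathbb{R}^n$, where $\pi_E$ is the orthogonal projection onto $E$. *)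

theory Defs
  imports "HOL-Analysis.Analysis"
begin

text \<open>Ambient space: \<open>real^'n\<close> (the Euclidean space R^n, n = CARD('n)).
  Elements of Conv(U,R) are represented by functions that are convex on U and
  vanish outside U (so that two representatives agree iff they agree on U).\<close>

definition Conv :: "(real^'n) set \<Rightarrow> (real^'n \<Rightarrow> real) set" where
  "Conv U = {f. convex_on U f \<and> (\<forall>x. x \<notin> U \<longrightarrow> f x = 0)}"

definition restr :: "(real^'n) set \<Rightarrow> (real^'n \<Rightarrow> real) \<Rightarrow> (real^'n \<Rightarrow> real)" where
  "restr U g = (\<lambda>x. if x \<in> U then g x else 0)"

definition relcpt_borel :: "(real^'n) set \<Rightarrow> (real^'n) set \<Rightarrow> bool" where
  "relcpt_borel U B \<longleftrightarrow> B \<in> sets borel \<and> B \<subseteq> U \<and> compact (closure B) \<and> closure B \<subseteq> U"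

definition Cc :: "(real^'n) set \<Rightarrow> (real^'n \<Rightarrow> complex) \<Rightarrow> bool" where
  "Cc U \<phi> \<longleftrightarrow> continuous_on U \<phi> \<and> (\<exists>K. compact K \<and> K \<subseteq> U \<and> (\<forall>x. x \<notin> K \<longrightarrow> \<phi> x = 0))"

definition lfm :: "(real^'n) set \<Rightarrow> (real^'n) measure \<Rightarrow> bool" where
  "lfm U M \<longleftrightarrow> sets M = sets borel \<and> emeasure M (- U) = 0 \<and>
     (\<forall>K. compact K \<and> K \<subseteq> U \<longrightarrow> emeasure M K < \<infinity>)"

text \<open>A complex Radon measure on U is represented by its values on relatively compact
  Borel subsets of U (and 0 elsewhere); it is (re)presented as
  (M1 - M2) + i (M3 - M4) with positive Radon measures Mj on U.\<close>
definition cradon_rep :: "(real^'n) set \<Rightarrow> ((real^'n) set \<Rightarrow> complex) \<Rightarrow>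
    (real^'n) measure \<Rightarrow> (real^'n) measure \<Rightarrow> (real^'n) measure \<Rightarrow> (real^'n) measure \<Rightarrow> bool" where
  "cradon_rep U m M1 M2 M3 M4 \<longleftrightarrow> lfm U M1 \<and> lfm U M2 \<and> lfm U M3 \<and> lfm U M4 \<and>
     (\<forall>B. m B = (if relcpt_borel U B
                  then complex_of_real (measure M1 B - measure M2 B)
                       + \<i> * complex_of_real (measure M3 B - measure M4 B)
                  else 0))"

definition cradon :: "(real^'n) set \<Rightarrow> ((real^'n) set \<Rightarrow> complex) \<Rightarrow> bool" where
  "cradon U m \<longleftrightarrow> (\<exists>M1 M2 M3 M4. cradon_rep U m M1 M2 M3 M4)"

definition cr_int :: "(real^'n) set \<Rightarrow> ((real^'n) set \<Rightarrow> complex) \<Rightarrow> (real^'n \<Rightarrow> complex) \<Rightarrow> complex" where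
  "cr_int U m \<phi> = (SOME v. \<exists>M1 M2 M3 M4. cradon_rep U m M1 M2 M3 M4 \<and>
      v = (integral\<^sup>L M1 \<phi> - integral\<^sup>L M2 \<phi>) + \<i> * (integral\<^sup>L M3 \<phi> - integral\<^sup>L M4 \<phi>))"

definition conv_lim :: "(real^'n) set \<Rightarrow> ('b \<Rightarrow> (real^'n \<Rightarrow> real)) \<Rightarrow> (real^'n \<Rightarrow> real) \<Rightarrow> 'b filter \<Rightarrow> bool" where
  "conv_lim U G f F \<longleftrightarrow> (\<forall>K. compact K \<and> K \<subseteq> U \<longrightarrow>
      (\<forall>e>0. eventually (\<lambda>i. \<forall>x\<in>K. \<bar>G i x - f x\<bar> < e) F))"

definition wstar_lim :: "(real^'n) set \<Rightarrow> ('b \<Rightarrow> ((real^'n) set \<Rightarrow> complex)) \<Rightarrow> ((real^'n) set \<Rightarrow> complex) \<Rightarrow> 'b filter \<Rightarrow> bool" where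
  "wstar_lim U G m F \<longleftrightarrow> (\<forall>\<phi>. Cc U \<phi> \<longrightarrow> ((\<lambda>i. cr_int U (G i) \<phi>) \<longlongrightarrow> cr_int U m \<phi>) F)"

definition cont_val :: "(real^'n) set \<Rightarrow> ((real^'n \<Rightarrow> real) \<Rightarrow> ((real^'n) set \<Rightarrow> complex)) \<Rightarrow> bool" where
  "cont_val U \<Psi> \<longleftrightarrow> (\<forall>f\<in>Conv U. \<forall>F. eventually (\<lambda>g. g \<in> Conv U) F \<longrightarrow> conv_lim U id f F \<longrightarrow>
      wstar_lim U \<Psi> (\<Psi> f) F)"

definition C2_hess :: "(real^'n) set \<Rightarrow> (real^'n \<Rightarrow> real) \<Rightarrow> (real^'n \<Rightarrow> real^'n^'n) \<Rightarrow> bool" where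
  "C2_hess U g H \<longleftrightarrow> convex_on U g \<and> continuous_on U H \<and>
     (\<exists>Dg. (\<forall>x\<in>U. (g has_derivative (\<lambda>h. Dg x \<bullet> h)) (at x)) \<and>
           (\<forall>x\<in>U. (Dg has_derivative (\<lambda>h. H x *v h)) (at x)))"

definition hess_measure :: "(real^'n) set \<Rightarrow> (real^'n \<Rightarrow> real^'n^'n) \<Rightarrow> (real^'n) measure" where
  "hess_measure U H = density lborel (\<lambda>x. ennreal (indicator U x * det (H x)))"

text \<open>Real Monge-Ampere measure: the continuous extension of det(D^2 f) dvol from C^2
  convex functions, i.e. the weak* limit of the measures of any C^2 convex approximants.\<close>
definition MA :: "(real^'n) set \<Rightarrow> (real^'n \<Rightarrow> real) \<Rightarrow> (real^'n) measure" where
  "MA U f = (SOME \<mu>. lfm U \<mu> \<and>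
     (\<forall>fs Hs. (\<forall>k::nat. C2_hess U (fs k) (Hs k)) \<longrightarrow> conv_lim U fs f sequentially \<longrightarrow>
        (\<forall>\<phi>. Cc U \<phi> \<longrightarrow>
           (\<lambda>k. integral\<^sup>L (hess_measure U (Hs k)) \<phi>) \<longlonglongrightarrow> integral\<^sup>L \<mu> \<phi>)))"

definition is_valuation :: "(real^'n) set \<Rightarrow> ((real^'n \<Rightarrow> real) \<Rightarrow> ((real^'n) set \<Rightarrow> complex)) \<Rightarrow> bool" where
  "is_valuation U \<Psi> \<longleftrightarrow> (\<forall>f\<in>Conv U. \<forall>h\<in>Conv U. sup f h \<in> Conv U \<longrightarrow> inf f h \<in> Conv U \<longrightarrow>
      (\<lambda>B. \<Psi> f B + \<Psi> h B) = (\<lambda>B. \<Psi> (sup f h) B + \<Psi> (inf f h) B))"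

definition dually_epi_translation_invariant :: "(real^'n) set \<Rightarrow> ((real^'n \<Rightarrow> real) \<Rightarrow> ((real^'n) set \<Rightarrow> complex)) \<Rightarrow> bool" where
  "dually_epi_translation_invariant U \<Psi> \<longleftrightarrow> (\<forall>f\<in>Conv U. \<forall>c::real^'n. \<forall>b::real.
      \<Psi> (restr U (\<lambda>x. f x + (c \<bullet> x + b))) = \<Psi> f)"

definition locally_determined :: "(real^'n) set \<Rightarrow> ((real^'n \<Rightarrow> real) \<Rightarrow> ((real^'n) set \<Rightarrow> complex)) \<Rightarrow> bool" where
  "locally_determined U \<Psi> \<longleftrightarrow> (\<forall>f\<in>Conv U. \<forall>h\<in>Conv U. \<forall>V. open V \<and> V \<subseteq> U \<and> (\<forall>x\<in>V. f x = h x) \<longrightarrow>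
      (\<forall>B. relcpt_borel U B \<longrightarrow> \<Psi> f (B \<inter> V) = \<Psi> h (B \<inter> V)))"

definition orth_proj :: "(real^'n) set \<Rightarrow> real^'n \<Rightarrow> real^'n" where
  "orth_proj E x = (THE y. y \<in> E \<and> (\<forall>z\<in>E. (x - y) \<bullet> z = 0))"

definition dually_simple :: "(real^'n) set \<Rightarrow> ((real^'n \<Rightarrow> real) \<Rightarrow> ((real^'n) set \<Rightarrow> complex)) \<Rightarrow> bool" where
  "dually_simple U \<Psi> \<longleftrightarrow> (\<forall>E f. subspace E \<and> E \<noteq> UNIV \<and> convex_on E f \<longrightarrow>
      \<Psi> (restr U (\<lambda>x. f (orth_proj E x))) = (\<lambda>B. 0))"

end

theory Submission
  imports Defs "HOL-Probability.Giry_Monad"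
begin

text \<open>On a maximum \<open>f\<close> of finitely many affine functions, locality and dual simplicity force \<open>\<Psi> f\<close> to be
  carried by the vertices of \<open>f\<close>, and the atom at a vertex \<open>v\<close> depends only on \<open>v\<close> and on the polytope
  \<open>\<partial>f(v)\<close>. For fixed \<open>v\<close> it is a translation invariant function of the polytope that is additive under
  hyperplane cuts. Such functions need not be multiples of the volume (for instance, integrals of odd
  functions against the surface area measure are not), but here the atom of a polytope inside a small box is
  at most a constant times the volume of the box: otherwise one could place many translates of that
  polytope, as subdifferentials at the points of a fine lattice, into one function close to \<open>0\<close>, so
  that the total variations would contradict the uniform boundedness principle. Boundary layers of grids
  then become negligible and the atom equals \<open>\<psi>(v)\<close> times the volume of \<open>\<partial>f(v)\<close>. The general case
  follows by approximation, where the Monge-Ampere measure is handled as the image of Lebesgue measure under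
  the almost everywhere defined map sending a slope \<open>p\<close> to the maximizer of \<open>p \<bullet> x - f x\<close>.\<close>

section \<open>Complex Radon measures\<close>

text \<open>Everything turns on the exponent in the bound for atoms. About \<open>1/r^n\<close>
  disjoint translates of a polytope of size \<open>r\<close> fit into a fixed region of slopes, and
  as many lattice points can carry them, however dense the lattice; a bound on the total mass
  therefore leaves order \<open>r^n\<close> for each atom. The exceptional functionals have order
  \<open>r^(n-1)\<close>, and about \<open>r^(1-n)\<close> boxes of size \<open>r\<close> meet the
  boundary of a polytope, so a weaker exponent would leave a boundary term of constant order. The
  same bound excludes wild solutions of the Cauchy equation for the dependence on the sides of a
  box. Two encodings shape the measure theory. A complex Radon measure is known by its values on
  relatively compact Borel sets only, and the four positive measures presenting it are not unique.
  \<open>MA\<close> is chosen by \<open>SOME\<close> from a condition on smooth approximants, which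
  says nothing about a function without them. Hence values on sets and integrals of test functions
  have to be shown to determine each other, and smooth approximants have to be constructed, before
  either object can be computed.\<close>

lemma relcpt_borelI_compact:
  assumes "compact K" "K \<subseteq> U" shows "relcpt_borel U K"
  using assms by (auto simp: relcpt_borel_def compact_imp_closed closure_closed borel_compact)

lemma relcpt_borel_subset:
  assumes "relcpt_borel U B" "A \<in> sets borel" "A \<subseteq> B" shows "relcpt_borel U A"
proof -
  have "closure A \<subseteq> closure B" using assms closure_mono by blast
  moreover have "compact (closure A)"
    using assms calculation unfolding relcpt_borel_def
    by (metis closed_closure compact_Int_closed inf.absorb_iff2)
  ultimately show ?thesis using assms unfolding relcpt_borel_def by blast
qed

lemma lfm_sets [measurable_cong]: "lfm U M \<Longrightarrow> sets M = sets borel"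
  by (simp add: lfm_def)

lemma lfm_space: "lfm U M \<Longrightarrow> space M = UNIV"
  using sets_eq_imp_space_eq[of M borel] by (simp add: lfm_def)

lemma lfm_compact: "lfm U M \<Longrightarrow> compact K \<Longrightarrow> K \<subseteq> U \<Longrightarrow> emeasure M K < \<infinity>"
  by (simp add: lfm_def)

lemma lfm_set_integrable:
  fixes c :: "real^'n \<Rightarrow> complex"
  assumes M: "lfm U M" and K: "compact K" "K \<subseteq> U" and c: "continuous_on U c"
    and A: "A \<in> sets borel" "A \<subseteq> K"
  shows "set_integrable M A c"
proof -
  have [measurable_cong]: "sets M = sets borel" using M by (rule lfm_sets)
  have cK: "continuous_on K c" using c K continuous_on_subset by blast
  have mK: "(\<lambda>x. indicator K x *\<^sub>R c x) \<in> borel_measurable borel"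
    using borel_measurable_continuous_on_indicator[OF _ cK] K(1) borel_compact by blast
  have eq: "(\<lambda>x. indicator A x *\<^sub>R c x) = (\<lambda>x. indicator A x *\<^sub>R (indicator K x *\<^sub>R c x))"
    using A(2) by (auto simp: indicator_def fun_eq_iff)
  have mA: "(\<lambda>x. indicator A x *\<^sub>R c x) \<in> borel_measurable borel"
    unfolding eq using mK A(1) by measurable
  have "bounded (c ` K)" using cK K(1) compact_continuous_image compact_imp_bounded by blast
  then obtain B where B: "\<And>x. x \<in> K \<Longrightarrow> norm (c x) \<le> B" by (auto simp: bounded_iff)
  have "integrable M (\<lambda>x. B * indicator K x)"
    using lfm_compact[OF M K] K(1) by (intro integrable_mult_right) (auto simp: borel_compact M[THEN lfm_sets] M[THEN lfm_space] less_top)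
  then show ?thesis unfolding set_integrable_def
  proof (rule Bochner_Integration.integrable_bound)
    show "(\<lambda>x. indicator A x *\<^sub>R c x) \<in> borel_measurable M"
      using mA by (simp cong: measurable_cong_sets add: lfm_sets[OF M])
    show "AE x in M. norm (indicator A x *\<^sub>R c x) \<le> norm (B * indicator K x)"
    proof (rule AE_I2)
      fix x show "norm (indicator A x *\<^sub>R c x) \<le> norm (B * indicator K x)"
        using A(2) B[of x] by (auto simp: indicator_def)
    qed
  qed
qed

lemma Cc_mult_integrable:
  fixes c :: "real^'n \<Rightarrow> complex"
  assumes M: "lfm U M" and "Cc U \<phi>" "continuous_on U c"
  shows "integrable M (\<lambda>x. \<phi> x * c x)"
proof -
  obtain K where K: "compact K" "K \<subseteq> U" "\<And>x. x \<notin> K \<Longrightarrow> \<phi> x = 0" and \<phi>: "continuous_on U \<phi>"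
    using assms(2) by (auto simp: Cc_def)
  have "set_integrable M K (\<lambda>x. \<phi> x * c x)"
    using lfm_set_integrable[OF M K(1,2), of "\<lambda>x. \<phi> x * c x" K] \<phi> assms(3) K(1) borel_compact
    by (auto intro: continuous_intros)
  then show ?thesis unfolding set_integrable_def
    by (rule back_subst[of "integrable M"]) (use K(3) in \<open>auto simp: indicator_def fun_eq_iff\<close>)
qed

lemma Cc_integrable:
  assumes "lfm U M" and "Cc U \<phi>"
  shows "integrable M \<phi>"
  using Cc_mult_integrable[OF assms, of "\<lambda>_. 1"] by simp

lemma Cc_mult: "Cc U \<phi> \<Longrightarrow> continuous_on U c \<Longrightarrow> Cc U (\<lambda>x. \<phi> x * c x)"
  by (auto simp: Cc_def intro!: continuous_intros)

lemma compact_neighbourhood: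
  fixes K :: "'a::euclidean_space set"
  assumes "compact K" "open U" "K \<subseteq> U" "K \<noteq> {}"
  obtains e where "e > 0" "compact {x. infdist x K \<le> e}" "{x. infdist x K \<le> e} \<subseteq> U"
proof -
  obtain e where e: "e > 0" "(\<Union>x\<in>K. cball x e) \<subseteq> U"
    using compact_subset_open_imp_cball_epsilon_subset[OF assms(1,2,3)] by metis
  have "{x. infdist x K \<le> e} \<subseteq> (\<Union>x\<in>K. cball x e)"
  proof
    fix x assume "x \<in> {x. infdist x K \<le> e}"
    moreover obtain y where "y \<in> K" "infdist x K = dist x y"
      using infdist_attains_inf[of K x] assms compact_imp_closed by metis
    ultimately show "x \<in> (\<Union>x\<in>K. cball x e)" by (auto simp: dist_commute)
  qed
  then show ?thesis using that[of e] e compact_infdist_le[OF assms(4,1) e(1)] by auto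
qed

lemma Cc_bump:
  fixes K :: "(real^'n) set"
  assumes "compact K" "open U" "K \<subseteq> U"
  obtains \<phi> :: "nat \<Rightarrow> real^'n \<Rightarrow> real" and L where
    "\<And>j. Cc U (\<lambda>x. of_real (\<phi> j x))" "compact L" "L \<subseteq> U" "\<And>j x. 0 \<le> \<phi> j x" "\<And>j x. \<phi> j x \<le> indicator L x"
    "\<And>x. (\<lambda>j. \<phi> j x) \<longlonglongrightarrow> indicator K x" "\<And>j x. x \<in> K \<Longrightarrow> \<phi> j x = 1"
    "\<And>j. continuous_on UNIV (\<phi> j)"
proof (cases "K = {}")
  case True
  show ?thesis
    by (rule that[of "\<lambda>j x. 0" "{}"]) (auto simp: Cc_def True intro!: exI[of _ "{}"])
next
  case False
  obtain e where e: "e > 0" "compact {x. infdist x K \<le> e}" "{x. infdist x K \<le> e} \<subseteq> U"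
    using compact_neighbourhood[OF assms False] by metis
  define L where "L = {x. infdist x K \<le> e}"
  \<comment> \<open>The slope is at least \<open>1/e\<close>, which confines every
    \<open>\<phi> j\<close> to \<open>L\<close>; its growth with \<open>j\<close> squeezes the
    support down to \<open>K\<close>.\<close>
  define \<phi> where "\<phi> j x = max 0 (1 - (1/e + real j) * infdist x K)" for j x
  have zero: "\<phi> j x = 0" if "x \<notin> L" for j x
  proof -
    have "infdist x K \<ge> e" using that by (auto simp: L_def)
    then have "(1/e + real j) * infdist x K \<ge> (1/e) * e"
      using e(1) by (intro mult_mono) auto
    then show ?thesis using e(1) by (auto simp: \<phi>_def)
  qed
  have cont: "continuous_on UNIV (\<phi> j)" for j
    unfolding \<phi>_def by (intro continuous_intros)
  show ?thesis
  proof (rule that[of \<phi> L])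
    show "Cc U (\<lambda>x. complex_of_real (\<phi> j x))" for j
      unfolding Cc_def using e(2,3) zero continuous_on_subset[OF cont]
      by (auto intro!: continuous_intros exI[of _ L] simp: L_def)
    show "compact L" "L \<subseteq> U" using e by (auto simp: L_def)
    show "0 \<le> \<phi> j x" for j x by (auto simp: \<phi>_def)
    have "\<phi> j x \<le> 1" for j x using e(1) infdist_nonneg[of x K] by (auto simp: \<phi>_def)
    then show "\<phi> j x \<le> indicator L x" for j x using zero by (auto simp: indicator_def)
    show "\<And>j x. x \<in> K \<Longrightarrow> \<phi> j x = 1" by (auto simp: \<phi>_def)
    show "continuous_on UNIV (\<phi> j)" for j by (rule cont)
    show "(\<lambda>j. \<phi> j x) \<longlonglongrightarrow> indicator K x" for x
    proof (cases "x \<in> K")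
      case True then show ?thesis by (auto simp: \<phi>_def)
    next
      case nK: False
      then have d: "infdist x K > 0"
        using in_closed_iff_infdist_zero[of K x] compact_imp_closed[OF assms(1)] False infdist_nonneg[of x K] by fastforce
      obtain N :: nat where N: "real N > 1 / infdist x K" using reals_Archimedean2 by blast
      have "\<phi> j x = 0" if "j \<ge> N" for j
      proof -
        have "(1/e + real j) * infdist x K \<ge> (1 / infdist x K) * infdist x K"
          using that N d e(1) by (intro mult_right_mono) (auto intro: add_increasing)
        then show ?thesis using d by (auto simp: \<phi>_def)
      qed
      then have "eventually (\<lambda>j. \<phi> j x = 0) sequentially" by (auto simp: eventually_sequentially)
      then show ?thesis using nK by (simp add: tendsto_eventually)
    qed
  qed
qed

text \<open>Bump functions settle compact sets by dominated convergence, and a Dynkin induction over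
  the closed sets does the rest. Finitely many measures with continuous weights are treated at once,
  so that one statement covers the equality of two Radon measures as well as the equality of a
  four-part complex measure with a density times a Monge-Ampere measure.\<close>

proposition vanish_on_relcpt_if_vanish_on_Cc:
  fixes M :: "'i \<Rightarrow> (real^'n) measure" and c :: "'i \<Rightarrow> real^'n \<Rightarrow> complex"
  assumes U: "open U" and I: "finite I" and M: "\<And>i. i \<in> I \<Longrightarrow> lfm U (M i)"
    and c: "\<And>i. i \<in> I \<Longrightarrow> continuous_on U (c i)"
    and van: "\<And>\<phi>. Cc U \<phi> \<Longrightarrow> (\<Sum>i\<in>I. \<integral>x. \<phi> x * c i x \<partial>M i) = 0"
    and B: "relcpt_borel U B"
  shows "(\<Sum>i\<in>I. set_lebesgue_integral (M i) B (c i)) = 0"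
proof -
  have cpt: "(\<Sum>i\<in>I. set_lebesgue_integral (M i) K (c i)) = 0" if K: "compact K" "K \<subseteq> U" for K
  proof -
    obtain \<phi> :: "nat \<Rightarrow> real^'n \<Rightarrow> real" and L where \<phi>:
      "\<And>j. Cc U (\<lambda>x. of_real (\<phi> j x))" "compact L" "L \<subseteq> U" "\<And>j x. 0 \<le> \<phi> j x" "\<And>j x. \<phi> j x \<le> indicator L x"
      "\<And>x. (\<lambda>j. \<phi> j x) \<longlonglongrightarrow> indicator K x"
      "\<And>j x. x \<in> K \<Longrightarrow> \<phi> j x = 1" "\<And>j. continuous_on UNIV (\<phi> j)"
      by (rule Cc_bump[OF K(1) U K(2)]) (erule that, assumption+)
    have "(\<lambda>j. \<Sum>i\<in>I. \<integral>x. of_real (\<phi> j x) * c i x \<partial>M i) \<longlonglongrightarrow> (\<Sum>i\<in>I. set_lebesgue_integral (M i) K (c i))"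
    proof (rule tendsto_sum)
      fix i assume i: "i \<in> I"
      show "(\<lambda>j. \<integral>x. of_real (\<phi> j x) * c i x \<partial>M i) \<longlonglongrightarrow> set_lebesgue_integral (M i) K (c i)"
        unfolding set_lebesgue_integral_def
      proof (rule integral_dominated_convergence[where w = "\<lambda>x. norm (indicator L x *\<^sub>R c i x)"])
        show "(\<lambda>x. indicat_real K x *\<^sub>R c i x) \<in> borel_measurable (M i)"
          using lfm_set_integrable[OF M[OF i] K c[OF i] borel_compact[OF K(1)] order_refl]
          unfolding set_integrable_def by (rule borel_measurable_integrable)
        show "(\<lambda>x. of_real (\<phi> j x) * c i x) \<in> borel_measurable (M i)" for j
          using Cc_mult_integrable[OF M[OF i] \<phi>(1) c[OF i]] by (rule borel_measurable_integrable)
        show "integrable (M i) (\<lambda>x. norm (indicat_real L x *\<^sub>R c i x))"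
          using lfm_set_integrable[OF M[OF i] \<phi>(2,3) c[OF i] borel_compact[OF \<phi>(2)] order_refl]
          unfolding set_integrable_def by (rule integrable_norm)
        have "(\<lambda>j. of_real (\<phi> j x) * c i x) \<longlonglongrightarrow> of_real (indicator K x) * c i x" for x
          by (intro tendsto_intros \<phi>(6))
        then show "AE x in M i. (\<lambda>j. of_real (\<phi> j x) * c i x) \<longlonglongrightarrow> indicat_real K x *\<^sub>R c i x"
          by (simp add: scaleR_conv_of_real)
        show "AE x in M i. norm (of_real (\<phi> j x) * c i x) \<le> norm (indicat_real L x *\<^sub>R c i x)" for j
          using \<phi>(4,5) by (auto intro!: AE_I2 mult_right_mono simp: norm_mult abs_of_nonneg)
      qed
    qed
    then show ?thesis using van[OF \<phi>(1)] by (simp add: LIMSEQ_const_iff)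
  qed
  \<comment> \<open>The measures may be infinite on \<open>U\<close>, so complements in the
    induction are taken inside the compact closure of \<open>B\<close>.\<close>
  define K0 where "K0 = closure B"
  have K0: "compact K0" "K0 \<subseteq> U" and BK: "B \<subseteq> K0" "B \<in> sets borel"
    using B closure_subset by (auto simp: relcpt_borel_def K0_def)
  have int: "set_integrable (M i) (A \<inter> K0) (c i)" if "i \<in> I" "A \<in> sets borel" for i A
    using lfm_set_integrable[OF M[OF that(1)] K0 c[OF that(1)], of "A \<inter> K0"] that K0 borel_compact by auto
  have "(\<Sum>i\<in>I. set_lebesgue_integral (M i) (A \<inter> K0) (c i)) = 0" if "A \<in> sigma_sets UNIV {S. closed S}" for A
  proof -
    have "Int_stable {S :: (real^'n) set. closed S}" "{S :: (real^'n) set. closed S} \<subseteq> Pow UNIV"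
      by (auto simp: Int_stable_def)
    from this that show ?thesis
  proof (induction A rule: sigma_sets_induct_disjoint)
    case (basic A)
    then show ?case using K0 closed_Int_compact[of A K0] by (intro cpt) auto
  next
    case empty
    then show ?case by (simp add: set_lebesgue_integral_def)
  next
    case (compl A)
    then have A: "A \<in> sets borel" by (simp add: borel_eq_closed)
    have "set_lebesgue_integral (M i) ((UNIV - A) \<inter> K0) (c i) =
       set_lebesgue_integral (M i) K0 (c i) - set_lebesgue_integral (M i) (A \<inter> K0) (c i)" if "i \<in> I" for i
    proof -
      have "set_lebesgue_integral (M i) K0 (c i) - set_lebesgue_integral (M i) (A \<inter> K0) (c i)
         = (\<integral>x. indicator K0 x *\<^sub>R c i x - indicator (A \<inter> K0) x *\<^sub>R c i x \<partial>M i)"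
        unfolding set_lebesgue_integral_def
        using int[OF that, of UNIV] int[OF that A] by (intro Bochner_Integration.integral_diff[symmetric]) (auto simp: set_integrable_def)
      also have "\<dots> = set_lebesgue_integral (M i) ((UNIV - A) \<inter> K0) (c i)"
        unfolding set_lebesgue_integral_def by (intro Bochner_Integration.integral_cong) (auto simp: indicator_def)
      finally show ?thesis by simp
    qed
    then show ?case using cpt[OF K0] compl.IH by (simp add: sum_subtractf)
  next
    case (union A)
    then have A: "\<And>k. A k \<in> sets borel" by (auto simp: borel_eq_closed)
    define S where "S N = (\<Union>k<N. A k \<inter> K0)" for N :: nat
    have S_eq: "(\<Union>(range A)) \<inter> K0 = (\<Union>N. S N)" by (auto simp: S_def)
    have "(\<lambda>N. \<Sum>i\<in>I. set_lebesgue_integral (M i) (S N) (c i)) \<longlonglongrightarrow> (\<Sum>i\<in>I. set_lebesgue_integral (M i) (\<Union>(range A) \<inter> K0) (c i))"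
    proof (rule tendsto_sum)
      fix i assume i: "i \<in> I"
      show "(\<lambda>N. set_lebesgue_integral (M i) (S N) (c i)) \<longlonglongrightarrow> set_lebesgue_integral (M i) (\<Union>(range A) \<inter> K0) (c i)"
        unfolding S_eq
      proof (rule set_integral_cont_up)
        show "S N \<in> sets (M i)" for N
          using A K0 borel_compact[of K0] lfm_sets[OF M[OF i]] by (auto simp: S_def)
        show "incseq S" unfolding incseq_def S_def by fastforce
        show "set_integrable (M i) (\<Union>N. S N) (c i)"
          unfolding S_eq[symmetric] using A by (intro int[OF i]) auto
      qed
    qed
    moreover have "(\<Sum>i\<in>I. set_lebesgue_integral (M i) (S N) (c i)) = 0" for N
    proof -
      have "set_lebesgue_integral (M i) (S N) (c i) = (\<Sum>k<N. set_lebesgue_integral (M i) (A k \<inter> K0) (c i))" if "i \<in> I" for i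
        unfolding S_def
      proof (rule set_integral_finite_Union)
        show "finite {..<N}" by simp
        show "disjoint_family_on (\<lambda>k. A k \<inter> K0) {..<N}" using union.hyps(1) unfolding disjoint_family_on_def by blast
        show "set_integrable (M i) (A k \<inter> K0) (c i)" if "k \<in> {..<N}" for k using int[OF \<open>i \<in> I\<close> A] .
        show "A k \<inter> K0 \<in> sets (M i)" if "k \<in> {..<N}" for k
          using A K0 borel_compact[of K0] lfm_sets[OF M[OF \<open>i \<in> I\<close>]] by auto
      qed
      then have "(\<Sum>i\<in>I. set_lebesgue_integral (M i) (S N) (c i)) = (\<Sum>i\<in>I. \<Sum>k<N. set_lebesgue_integral (M i) (A k \<inter> K0) (c i))"
        by simp
      also have "\<dots> = (\<Sum>k<N. \<Sum>i\<in>I. set_lebesgue_integral (M i) (A k \<inter> K0) (c i))" by (rule sum.swap)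
      also have "\<dots> = 0" using union.IH by simp
      finally show ?thesis .
    qed
    ultimately show ?case by (simp add: LIMSEQ_const_iff)
  qed
  qed
  then have "(\<Sum>i\<in>I. set_lebesgue_integral (M i) (B \<inter> K0) (c i)) = 0"
    using BK by (simp add: borel_eq_closed)
  then show ?thesis using BK by (simp add: Int_absorb2)
qed

text \<open>Induction from indicators to bounded nonnegative Borel functions, applied to the
  positive and negative parts of the real and imaginary parts of \<open>\<phi>\<close>.\<close>

proposition vanish_on_Cc_if_vanish_on_relcpt:
  fixes M :: "'i \<Rightarrow> (real^'n) measure" and c :: "'i \<Rightarrow> complex"
  assumes I: "finite I" and M: "\<And>i. i \<in> I \<Longrightarrow> lfm U (M i)"
    and van: "\<And>B. relcpt_borel U B \<Longrightarrow> (\<Sum>i\<in>I. c i * measure (M i) B) = 0"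
    and \<phi>: "Cc U \<phi>"
  shows "(\<Sum>i\<in>I. c i * (\<integral>x. \<phi> x \<partial>M i)) = 0"
proof -
  obtain K where K: "compact K" "K \<subseteq> U" "\<And>x. x \<notin> K \<Longrightarrow> \<phi> x = 0" and cont: "continuous_on U \<phi>"
    using \<phi> by (auto simp: Cc_def)
  have Kb[measurable]: "K \<in> sets borel" using K(1) borel_compact by blast
  have intK: "integrable (M i) (\<lambda>x. indicator K x * u x)" 
    if i: "i \<in> I" and u: "u \<in> borel_measurable borel" "\<And>x. \<bar>u x\<bar> \<le> b" for i b and u :: "real^'n \<Rightarrow> real"
  proof (rule Bochner_Integration.integrable_bound)
    show "integrable (M i) (\<lambda>x. b * indicator K x)"
      using lfm_compact[OF M[OF i] K(1,2)] Kb by (intro integrable_mult_right) (auto simp: M[OF i, THEN lfm_sets] M[OF i, THEN lfm_space] less_top)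
    have "(\<lambda>x. indicator K x * u x) \<in> borel_measurable borel" using u(1) by measurable
    then show "(\<lambda>x. indicator K x * u x) \<in> borel_measurable (M i)"
      by (simp cong: measurable_cong_sets add: lfm_sets[OF M[OF i]])
    show "AE x in M i. norm (indicator K x * u x) \<le> norm (b * indicator K x)"
    proof (rule AE_I2)
      fix x show "norm (indicator K x * u x) \<le> norm (b * indicator K x)"
        using u(2)[of x] by (auto simp: indicator_def)
    qed
  qed
  \<comment> \<open>The factor \<open>indicator K\<close> keeps all integrals finite. The bound
    \<open>b\<close> is generalised in the induction because dividing out a scalar changes
    it.\<close>
  have pos: "(\<Sum>i\<in>I. c i * of_real (\<integral>x. indicator K x * u x \<partial>M i)) = 0"
    if "u \<in> borel_measurable borel" "\<And>x. 0 \<le> u x" "\<And>x. u x \<le> b" for u and b :: real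
    using that
  proof (induction arbitrary: b rule: borel_measurable_induct_real)
    case (set A)
    have "relcpt_borel U (A \<inter> K)"
      using set relcpt_borel_subset[OF relcpt_borelI_compact[OF K(1,2)], of "A \<inter> K"] by auto
    moreover have "(\<integral>x. indicator K x * indicator A x \<partial>M i) = measure (M i) (A \<inter> K)" if "i \<in> I" for i
    proof -
      have "(\<integral>x. indicator K x * indicator A x \<partial>M i) = (\<integral>x. indicat_real (A \<inter> K) x \<partial>M i)"
        by (intro Bochner_Integration.integral_cong) (simp_all split: split_indicator)
      then show ?thesis using M[OF that, THEN lfm_space] by simp
    qed
    ultimately show ?case using van by simp
  next
    case (mult u d)
    show ?case
    proof (cases "d = 0")
      case False
      then have d: "d > 0" using mult by auto
      have "u x \<le> b / d" for x using mult.prems[of x] d by (simp add: field_simps)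
      then have "(\<Sum>i\<in>I. c i * of_real (\<integral>x. indicator K x * u x \<partial>M i)) = 0" by (rule mult.IH)
      moreover have "(\<integral>x. indicator K x * (d * u x) \<partial>M i) = d * (\<integral>x. indicator K x * u x \<partial>M i)" for i
        by (subst integral_mult_right_zero[symmetric]) (simp add: ac_simps)
      then have "(\<Sum>i\<in>I. c i * of_real (\<integral>x. indicator K x * (d * u x) \<partial>M i)) = d * (\<Sum>i\<in>I. c i * of_real (\<integral>x. indicator K x * u x \<partial>M i))"
        by (simp add: sum_distrib_left ac_simps)
      ultimately show ?thesis by simp
    qed simp
  next
    case (add u v)
    have ub: "u x \<le> b" "v x \<le> b" for x
      using add.hyps(2,4)[of x] add.prems[of x] by linarith+
    have "(\<integral>x. indicator K x * (v x + u x) \<partial>M i) = (\<integral>x. indicator K x * u x \<partial>M i) + (\<integral>x. indicator K x * v x \<partial>M i)" if "i \<in> I" for i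
    proof -
      have "integrable (M i) (\<lambda>x. indicator K x * u x)" "integrable (M i) (\<lambda>x. indicator K x * v x)"
        using add.hyps ub by (auto intro!: intK[OF that, of _ b] simp: abs_of_nonneg)
      then show ?thesis by (simp add: algebra_simps)
    qed
    then have "(\<Sum>i\<in>I. c i * of_real (\<integral>x. indicator K x * (v x + u x) \<partial>M i)) = 
       (\<Sum>i\<in>I. c i * of_real (\<integral>x. indicator K x * u x \<partial>M i)) + (\<Sum>i\<in>I. c i * of_real (\<integral>x. indicator K x * v x \<partial>M i))"
      by (simp add: sum.distrib[symmetric] algebra_simps)
    then show ?case using add.IH(1)[OF ub(1)] add.IH(2)[OF ub(2)] by simp
  next
    case (seq W)
    have Wu: "W j x \<le> u x" for j x
      using seq.hyps(3,4) by (auto intro!: incseq_le simp: incseq_def le_fun_def)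
    have Wb: "W j x \<le> b" for j x using Wu[of j x] seq.prems(1)[of x] seq.prems by (meson order_trans)
    have "(\<lambda>j. \<Sum>i\<in>I. c i * of_real (\<integral>x. indicator K x * W j x \<partial>M i)) \<longlonglongrightarrow> (\<Sum>i\<in>I. c i * of_real (\<integral>x. indicator K x * u x \<partial>M i))"
    proof (intro tendsto_sum tendsto_mult tendsto_const tendsto_of_real)
      fix i assume i: "i \<in> I"
      have bm: "g \<in> borel_measurable borel \<Longrightarrow> g \<in> borel_measurable (M i)" for g :: "real^'n \<Rightarrow> real"
        by (simp cong: measurable_cong_sets add: lfm_sets[OF M[OF i]])
      have u0: "0 \<le> u x" for x using seq.hyps(2)[of 0 x] Wu[of 0 x] by linarith
      have um: "u \<in> borel_measurable borel" 
        by (rule borel_measurable_LIMSEQ_real[OF _ seq.hyps(1)]) (rule seq.hyps(4))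
      show "(\<lambda>j. \<integral>x. indicator K x * W j x \<partial>M i) \<longlonglongrightarrow> (\<integral>x. indicator K x * u x \<partial>M i)"
      proof (rule integral_dominated_convergence[where w = "\<lambda>x. indicator K x * u x"])
        show "integrable (M i) (\<lambda>x. indicator K x * u x)"
          using intK[OF i um, of b] u0 seq.prems by (auto simp: abs_of_nonneg)
        show "(\<lambda>x. indicator K x * u x) \<in> borel_measurable (M i)" using um by (intro bm) measurable
        show "(\<lambda>x. indicator K x * W j x) \<in> borel_measurable (M i)" for j using seq.hyps(1)[of j] by (intro bm) measurable
        show "AE x in M i. (\<lambda>j. indicator K x * W j x) \<longlonglongrightarrow> indicator K x * u x"
          using seq.hyps(4) by (auto intro!: tendsto_intros)
        show "AE x in M i. norm (indicator K x * W j x) \<le> indicator K x * u x" for j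
          using Wu seq.hyps(2) by (auto intro!: AE_I2 mult_left_mono simp: abs_mult abs_of_nonneg)
      qed
    qed
    moreover have "(\<Sum>i\<in>I. c i * of_real (\<integral>x. indicator K x * W j x \<partial>M i)) = 0" for j
      using seq.IH Wb by blast
    ultimately show ?case by (simp add: LIMSEQ_const_iff)
  qed
  have real: "(\<Sum>i\<in>I. c i * of_real (\<integral>x. r x \<partial>M i)) = 0" and real_int: "\<And>i. i \<in> I \<Longrightarrow> integrable (M i) r"
    if r: "continuous_on U r" "\<And>x. x \<notin> K \<Longrightarrow> r x = 0" for r :: "real^'n \<Rightarrow> real"
  proof -
    have rm: "r \<in> borel_measurable borel"
    proof -
      have "(\<lambda>x. indicator K x *\<^sub>R r x) \<in> borel_measurable borel"
        using borel_measurable_continuous_on_indicator[OF Kb continuous_on_subset[OF r(1) K(2)]] .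
      moreover have "(\<lambda>x. indicator K x *\<^sub>R r x) = r" using r(2) by (auto simp: indicator_def fun_eq_iff)
      ultimately show ?thesis by simp
    qed
    have "bounded (r ` K)"
      using K(1) compact_continuous_image[OF continuous_on_subset[OF r(1) K(2)]] compact_imp_bounded by blast
    then obtain b where b: "\<And>x. x \<in> K \<Longrightarrow> \<bar>r x\<bar> \<le> b" by (auto simp: bounded_iff)
    define b' where "b' = max b 0"
    have b': "\<bar>r x\<bar> \<le> b'" for x using b[of x] r(2)[of x] by (cases "x \<in> K") (auto simp: b'_def)
    define rp where "rp x = max 0 (r x)" for x
    define rn where "rn x = max 0 (- r x)" for x
    have m: "rp \<in> borel_measurable borel" "rn \<in> borel_measurable borel"
      using rm unfolding rp_def rn_def by measurable
    have bd: "0 \<le> rp x" "0 \<le> rn x" "rp x \<le> b'" "rn x \<le> b'" for x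
      using b'[of x] by (auto simp: rp_def rn_def)
    have req: "r = (\<lambda>x. indicator K x * rp x - indicator K x * rn x)"
      using r(2) by (auto simp: fun_eq_iff rp_def rn_def indicator_def)
    have i1: "integrable (M i) (\<lambda>x. indicator K x * rp x)" "integrable (M i) (\<lambda>x. indicator K x * rn x)" if "i \<in> I" for i
      using bd by (auto intro!: intK[OF that, of _ b'] m simp: abs_of_nonneg)
    then have "(\<integral>x. r x \<partial>M i) = (\<integral>x. indicator K x * rp x \<partial>M i) - (\<integral>x. indicator K x * rn x \<partial>M i)" if "i \<in> I" for i
      using that by (subst req) simp
    then have "(\<Sum>i\<in>I. c i * of_real (\<integral>x. r x \<partial>M i)) = 
       (\<Sum>i\<in>I. c i * of_real (\<integral>x. indicator K x * rp x \<partial>M i)) - (\<Sum>i\<in>I. c i * of_real (\<integral>x. indicator K x * rn x \<partial>M i))"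
      by (simp add: sum_subtractf right_diff_distrib)
    then show "(\<Sum>i\<in>I. c i * of_real (\<integral>x. r x \<partial>M i)) = 0"
      using pos[OF m(1) bd(1,3)] pos[OF m(2) bd(2,4)] by simp
    show "integrable (M i) r" if "i \<in> I" for i using i1[OF that] by (subst req) simp
  qed
  have R: "continuous_on U (\<lambda>x. Re (\<phi> x))" "\<And>x. x \<notin> K \<Longrightarrow> Re (\<phi> x) = 0"
    and J: "continuous_on U (\<lambda>x. Im (\<phi> x))" "\<And>x. x \<notin> K \<Longrightarrow> Im (\<phi> x) = 0"
    using cont K(3) by (auto intro!: continuous_intros)
  have "(\<integral>x. \<phi> x \<partial>M i) = of_real (\<integral>x. Re (\<phi> x) \<partial>M i) + \<i> * of_real (\<integral>x. Im (\<phi> x) \<partial>M i)" if "i \<in> I" for i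
  proof -
    have "(\<integral>x. \<phi> x \<partial>M i) = (\<integral>x. of_real (Re (\<phi> x)) + \<i> * of_real (Im (\<phi> x)) \<partial>M i)"
      by (simp add: complex_eq[symmetric])
    also have "\<dots> = (\<integral>x. of_real (Re (\<phi> x)) \<partial>M i) + (\<integral>x. \<i> * of_real (Im (\<phi> x)) \<partial>M i)"
      using real_int[OF R that] real_int[OF J that] by (intro Bochner_Integration.integral_add) auto
    finally show ?thesis by simp
  qed
  then have "(\<Sum>i\<in>I. c i * (\<integral>x. \<phi> x \<partial>M i)) = (\<Sum>i\<in>I. c i * of_real (\<integral>x. Re (\<phi> x) \<partial>M i)) + \<i> * (\<Sum>i\<in>I. c i * of_real (\<integral>x. Im (\<phi> x) \<partial>M i))"
    by (simp add: sum_distrib_left sum.distrib[symmetric] algebra_simps)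
  then show ?thesis using real(1)[OF R] real(1)[OF J] by simp
qed

text \<open>Two presentations of one measure agree on relatively compact Borel sets, hence on test
  functions, so the value chosen by \<open>SOME\<close> in \<open>cr_int\<close> does not depend on
  the presentation.\<close>

lemma cr_int_eq:
  assumes rep: "cradon_rep U m M1 M2 M3 M4" and \<phi>: "Cc U \<phi>"
  shows "cr_int U m \<phi> = (integral\<^sup>L M1 \<phi> - integral\<^sup>L M2 \<phi>) + \<i> * (integral\<^sup>L M3 \<phi> - integral\<^sup>L M4 \<phi>)"
proof -
  have uniq: "(integral\<^sup>L N1 \<phi> - integral\<^sup>L N2 \<phi>) + \<i> * (integral\<^sup>L N3 \<phi> - integral\<^sup>L N4 \<phi>)
     = (integral\<^sup>L M1 \<phi> - integral\<^sup>L M2 \<phi>) + \<i> * (integral\<^sup>L M3 \<phi> - integral\<^sup>L M4 \<phi>)"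
    if rep': "cradon_rep U m N1 N2 N3 N4" for N1 N2 N3 N4
  proof -
    \<comment> \<open>Both presentations enter one combination of eight measures, the second one
      with opposite signs.\<close>
    define M where "M i = [M1,M2,M3,M4,N1,N2,N3,N4] ! i" for i
    define c :: "nat \<Rightarrow> complex" where "c i = [1,-1,\<i>,-\<i>,-1,1,-\<i>,\<i>] ! i" for i
    have "(\<Sum>i\<in>{..<8}. c i * (\<integral>x. \<phi> x \<partial>M i)) = 0"
    proof (rule vanish_on_Cc_if_vanish_on_relcpt[OF _ _ _ \<phi>])
      show "lfm U (M i)" if "i \<in> {..<8}" for i
        using that rep rep' by (auto simp: M_def cradon_rep_def less_Suc_eq numeral_eq_Suc)
      show "(\<Sum>i<8. c i * of_real (measure (M i) B)) = 0" if "relcpt_borel U B" for B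
      proof -
        have "complex_of_real (measure M1 B - measure M2 B) + \<i> * complex_of_real (measure M3 B - measure M4 B)
           = complex_of_real (measure N1 B - measure N2 B) + \<i> * complex_of_real (measure N3 B - measure N4 B)"
          using rep rep' that by (metis cradon_rep_def)
        then show ?thesis by (simp add: M_def c_def numeral_eq_Suc algebra_simps)
      qed
    qed simp
    then show ?thesis by (simp add: M_def c_def numeral_eq_Suc algebra_simps)
  qed
  have ex: "\<exists>v. \<exists>M1 M2 M3 M4. cradon_rep U m M1 M2 M3 M4 \<and>
      v = (integral\<^sup>L M1 \<phi> - integral\<^sup>L M2 \<phi>) + \<i> * (integral\<^sup>L M3 \<phi> - integral\<^sup>L M4 \<phi>)"
    using rep by blast
  show ?thesis unfolding cr_int_def by (rule someI2_ex[OF ex]) (elim exE conjE, simp only: uniq)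
qed

text \<open>Test functions determine the measure of relatively compact sets; a compact exhaustion of
  \<open>U\<close> and the vanishing off \<open>U\<close> extend this to all Borel sets.\<close>

lemma lfm_eqI:
  fixes U :: "(real^'n) set"
  assumes U: "open U" and M: "lfm U M" and N: "lfm U N"
    and eq: "\<And>\<phi>. Cc U \<phi> \<Longrightarrow> integral\<^sup>L M \<phi> = integral\<^sup>L N \<phi>"
  shows "M = N"
proof (rule measure_eqI)
  show "sets M = sets N" using M N by (simp add: lfm_def)
  fix A assume "A \<in> sets M"
  then have A: "A \<in> sets borel" using M by (simp add: lfm_def)
  have rel: "emeasure M B = emeasure N B" if B: "relcpt_borel U B" for B
  proof -
    define P where "P b = (if b then M else N)" for b
    define c :: "bool \<Rightarrow> real^'n \<Rightarrow> complex" where "c b x = (if b then 1 else -1)" for b x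
    have "(\<Sum>i\<in>UNIV. set_lebesgue_integral (P i) B (c i)) = 0"
    proof (rule vanish_on_relcpt_if_vanish_on_Cc[OF U _ _ _ _ B])
      show "\<And>i. lfm U (P i)" using M N by (auto simp: P_def)
      show "\<And>i. continuous_on U (c i)" by (simp add: c_def)
      show "\<And>\<phi>. Cc U \<phi> \<Longrightarrow> (\<Sum>i\<in>UNIV. \<integral>x. \<phi> x * c i x \<partial>P i) = 0"
        using eq by (simp add: UNIV_bool P_def c_def)
    qed simp
    then have "of_real (measure M B) = (of_real (measure N B) :: complex)"
      using B M[THEN lfm_sets] N[THEN lfm_sets] M[THEN lfm_space] N[THEN lfm_space]
      by (simp add: UNIV_bool P_def c_def set_lebesgue_integral_def relcpt_borel_def scaleR_conv_of_real)
    moreover have "emeasure M B < \<infinity>" "emeasure N B < \<infinity>"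
    proof -
      have "B \<subseteq> closure B" "compact (closure B)" "closure B \<subseteq> U" using B closure_subset by (auto simp: relcpt_borel_def)
      moreover have "closure B \<in> sets M" "closure B \<in> sets N" using M[THEN lfm_sets] N[THEN lfm_sets] by auto
      ultimately show "emeasure M B < \<infinity>" "emeasure N B < \<infinity>"
        using emeasure_mono lfm_compact[OF M] lfm_compact[OF N] by (metis le_less_trans)+
    qed
    ultimately show ?thesis by (simp add: emeasure_eq_ennreal_measure)
  qed
  obtain C where C: "\<And>n. compact (C n)" "\<And>n. C n \<subseteq> U" "\<And>n. C n \<subseteq> interior (C (Suc n))" "\<Union>(range C) = U"
    using open_Union_compact_subsets[OF U] by metis
  have incC: "incseq (\<lambda>n. A \<inter> C n)"
    using C(3) interior_subset by (intro incseq_SucI) blast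
  have AC: "relcpt_borel U (A \<inter> C n)" for n
    by (rule relcpt_borel_subset[OF relcpt_borelI_compact[OF C(1,2)]]) (use A borel_compact[OF C(1)] in auto)
  have "emeasure P A = (SUP n. emeasure P (A \<inter> C n))" if "lfm U P" for P
  proof -
    have s: "sets P = sets borel" "emeasure P (-U) = 0" using that by (auto simp: lfm_def)
    have Ub: "U \<in> sets borel" using U by simp
    have "emeasure P A = emeasure P ((A \<inter> U) \<union> (A \<inter> -U))" by (rule arg_cong[of _ _ "emeasure P"]) blast
    also have "\<dots> = emeasure P (A \<inter> U) + emeasure P (A \<inter> -U)"
      using A Ub s by (intro plus_emeasure[symmetric]) auto
    also have "emeasure P (A \<inter> -U) = 0"
      using emeasure_mono[of "A \<inter> -U" "-U" P] s Ub by auto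
    also have "A \<inter> U = (\<Union>n. A \<inter> C n)" using C(4) by blast
    also have "emeasure P (\<Union>n. A \<inter> C n) = (SUP n. emeasure P (A \<inter> C n))"
      using incC A C(1) borel_compact s by (intro SUP_emeasure_incseq[symmetric]) auto
    finally show ?thesis by simp
  qed
  then show "emeasure M A = emeasure N A" using M N rel[OF AC] by simp
qed

lemma lfm_return: "v \<in> U \<Longrightarrow> open U \<Longrightarrow> lfm U (return borel v)"
  by (auto simp: lfm_def indicator_def borel_compact)

text \<open>The point masses join the four presenting measures as Dirac measures with weights
  \<open>- a v\<close>, so that the claim becomes the vanishing of one finite combination.\<close>

lemma cr_int_finite_support:
  fixes U :: "(real^'n) set"
  assumes U: "open U" and m: "cradon U m" and V: "finite V" "V \<subseteq> U" and \<phi>: "Cc U \<phi>"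
    and eq: "\<And>B. relcpt_borel U B \<Longrightarrow> m B = (\<Sum>v\<in>V. if v \<in> B then a v else 0)"
  shows "cr_int U m \<phi> = (\<Sum>v\<in>V. a v * \<phi> v)"
proof -
  obtain M1 M2 M3 M4 where rep: "cradon_rep U m M1 M2 M3 M4" using m by (auto simp: cradon_def)
  define M where "M i = (case i of Inl k \<Rightarrow> [M1,M2,M3,M4] ! k | Inr v \<Rightarrow> return borel v)" for i
  define c :: "nat + real^'n \<Rightarrow> complex" where "c i = (case i of Inl k \<Rightarrow> [1,-1,\<i>,-\<i>] ! k | Inr v \<Rightarrow> - a v)" for i
  have S: "(\<Sum>i\<in>{..<4::nat} <+> V. F i) = (\<Sum>k<4. F (Inl k)) + (\<Sum>v\<in>V. F (Inr v))" for F :: "nat + real^'n \<Rightarrow> complex"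
    using V(1) sum.Plus[of "{..<4::nat}" V F] by simp
  have "(\<Sum>i\<in>{..<4::nat} <+> V. c i * (\<integral>x. \<phi> x \<partial>M i)) = 0"
  proof (rule vanish_on_Cc_if_vanish_on_relcpt[OF _ _ _ \<phi>])
    show "finite ({..<4::nat} <+> V)" using V by auto
    show "lfm U (M i)" if "i \<in> {..<4::nat} <+> V" for i
    proof (cases i)
      case (Inl k)
      then have "k = 0 \<or> k = 1 \<or> k = 2 \<or> k = 3" using that by auto
      then show ?thesis using rep Inl by (auto simp: M_def cradon_rep_def)
    next
      case (Inr v)
      then show ?thesis using that V(2) U lfm_return by (auto simp: M_def)
    qed
    show "(\<Sum>i\<in>{..<4::nat} <+> V. c i * of_real (measure (M i) B)) = 0" if B: "relcpt_borel U B" for B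
    proof -
      have "m B = complex_of_real (measure M1 B - measure M2 B) + \<i> * complex_of_real (measure M3 B - measure M4 B)"
        using rep B by (simp add: cradon_rep_def)
      moreover have "(\<Sum>v\<in>V. a v * of_real (measure (return borel v) B)) = m B"
        unfolding eq[OF B] using B by (intro sum.cong) (auto simp: measure_return relcpt_borel_def)
      ultimately show ?thesis unfolding S
        by (simp add: M_def c_def numeral_eq_Suc sum_negf algebra_simps)
    qed
  qed
  moreover have "(\<integral>x. \<phi> x \<partial>return borel v) = \<phi> v" if "v \<in> V" for v
  proof -
    have "integrable (return borel v) \<phi>" using Cc_integrable[OF lfm_return \<phi>] that V U by blast
    then have "\<phi> \<in> borel_measurable (return borel v)" by (rule borel_measurable_integrable)
    then have "\<phi> \<in> borel_measurable borel" by simp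
    then show ?thesis by (subst integral_return) auto
  qed
  ultimately show ?thesis unfolding S cr_int_eq[OF rep \<phi>]
    by (simp add: M_def c_def numeral_eq_Suc sum_negf algebra_simps)
qed

section \<open>The subdifferential measure\<close>

text \<open>The relation \<open>x \<in> contact U f p\<close> means that \<open>p\<close> is a
  subgradient of \<open>f\<close> at \<open>x\<close>. Grouping it by slopes prepares the
  description of the Monge-Ampere measure as an image measure on slope space.\<close>

definition contact :: "(real^'n) set \<Rightarrow> (real^'n \<Rightarrow> real) \<Rightarrow> real^'n \<Rightarrow> (real^'n) set" where
  "contact U f p = {x\<in>U. \<forall>y\<in>U. f x + p \<bullet> (y - x) \<le> f y}"

text \<open>The image of \<open>C\<close> under the subdifferential, the set whose volume is the
  Monge-Ampere measure of \<open>C\<close> in Aleksandrov's definition.\<close>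

definition hit :: "(real^'n) set \<Rightarrow> (real^'n \<Rightarrow> real) \<Rightarrow> (real^'n) set \<Rightarrow> (real^'n) set" where
  "hit U f C = {p. \<exists>x\<in>C. x \<in> contact U f p}"

definition nonunique :: "(real^'n) set \<Rightarrow> (real^'n \<Rightarrow> real) \<Rightarrow> (real^'n) set" where
  "nonunique U f = {p. \<exists>x\<in>contact U f p. \<exists>y\<in>contact U f p. x \<noteq> y}"

definition unique_contact :: "(real^'n) set \<Rightarrow> (real^'n \<Rightarrow> real) \<Rightarrow> (real^'n) set" where
  "unique_contact U f = {p. \<exists>!x. x \<in> contact U f p}"

definition contact_pt :: "(real^'n) set \<Rightarrow> (real^'n \<Rightarrow> real) \<Rightarrow> real^'n \<Rightarrow> real^'n" where
  "contact_pt U f p = (THE x. x \<in> contact U f p)"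

text \<open>Aleksandrov's Monge-Ampere measure. As an image measure it is countably additive at
  once; defined through volumes of the sets \<open>hit U f C\<close>, it would need an argument that
  disjoint sets have almost disjoint images.\<close>

definition subdiff_measure :: "(real^'n) set \<Rightarrow> (real^'n \<Rightarrow> real) \<Rightarrow> (real^'n) measure" where
  "subdiff_measure U f = distr (lebesgue_on (unique_contact U f)) borel (contact_pt U f)"

lemma contact_subset: "x \<in> contact U f p \<Longrightarrow> x \<in> U"
  by (simp add: contact_def)

lemma contact_monotone:
  assumes "x \<in> contact U f p" "y \<in> contact U f q"
  shows "0 \<le> (p - q) \<bullet> (x - y)"
proof -
  have "f x + p \<bullet> (y - x) \<le> f y" "f y + q \<bullet> (x - y) \<le> f x"
    using assms by (auto simp: contact_def)
  then show ?thesis by (simp add: inner_diff_left inner_diff_right)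
qed

lemma contact_pt_eq:
  assumes "x \<in> contact U f p" "p \<notin> nonunique U f"
  shows "contact_pt U f p = x" "p \<in> unique_contact U f"
proof -
  have *: "y = x" if "y \<in> contact U f p" for y using assms that by (auto simp: nonunique_def)
  show "contact_pt U f p = x" unfolding contact_pt_def using assms(1) * by (rule the_equality)
  show "p \<in> unique_contact U f" unfolding unique_contact_def using assms(1) * by blast
qed

lemma contact_pt_in: "p \<in> unique_contact U f \<Longrightarrow> contact_pt U f p \<in> contact U f p"
  unfolding unique_contact_def contact_pt_def mem_Collect_eq by (rule theI')

lemma unique_contact_eq: "unique_contact U f = hit U f U - nonunique U f"
proof (intro set_eqI iffI)
  fix p assume "p \<in> unique_contact U f"
  then obtain x where x: "x \<in> contact U f p" "\<And>y. y \<in> contact U f p \<Longrightarrow> y = x"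
    unfolding unique_contact_def by blast
  then show "p \<in> hit U f U - nonunique U f"
    using contact_subset[OF x(1)] unfolding hit_def nonunique_def by blast
next
  fix p assume "p \<in> hit U f U - nonunique U f"
  then obtain x where "x \<in> contact U f p" "p \<notin> nonunique U f" unfolding hit_def by blast
  then show "p \<in> unique_contact U f" by (rule contact_pt_eq(2))
qed

lemma contact_pt_vimage:
  "contact_pt U f -` S \<inter> unique_contact U f = hit U f (S \<inter> U) - nonunique U f"
proof (intro set_eqI iffI)
  fix p assume p: "p \<in> contact_pt U f -` S \<inter> unique_contact U f"
  then have "contact_pt U f p \<in> contact U f p" using contact_pt_in by blast
  moreover have "p \<notin> nonunique U f" using p unique_contact_eq by blast
  ultimately show "p \<in> hit U f (S \<inter> U) - nonunique U f"
    using p contact_subset[of "contact_pt U f p"] unfolding hit_def by blast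
next
  fix p assume "p \<in> hit U f (S \<inter> U) - nonunique U f"
  then obtain x where "x \<in> S" "x \<in> contact U f p" "p \<notin> nonunique U f" by (auto simp: hit_def)
  then show "p \<in> contact_pt U f -` S \<inter> unique_contact U f" using contact_pt_eq[of x U f p] by auto
qed

section \<open>Subgradients under locally uniform convergence\<close>

lemma conv_limD:
  assumes "conv_lim U fs f F" "compact K" "K \<subseteq> U" "e > 0"
  shows "eventually (\<lambda>i. \<forall>x\<in>K. \<bar>fs i x - f x\<bar> < e) F"
  using assms by (auto simp: conv_lim_def)

lemma conv_lim_pointwise:
  assumes "conv_lim U fs f F" "x \<in> U"
  shows "((\<lambda>i. fs i x) \<longlongrightarrow> f x) F"
proof (rule tendstoI)
  fix e :: real assume "e > 0"
  then show "eventually (\<lambda>i. dist (fs i x) (f x) < e) F"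
    using conv_limD[OF assms(1), of "{x}" e] assms(2) by (simp add: dist_real_def)
qed

lemma conv_lim_subseq:
  assumes "conv_lim U fs f sequentially" "strict_mono (r :: nat \<Rightarrow> nat)"
  shows "conv_lim U (\<lambda>k. fs (r k)) f sequentially"
  unfolding conv_lim_def
proof (intro allI impI)
  fix K :: "(real^'a) set" and e :: real assume "compact K \<and> K \<subseteq> U" "e > 0"
  then have "eventually (\<lambda>i. \<forall>x\<in>K. \<bar>fs i x - f x\<bar> < e) sequentially"
    using assms(1) by (auto simp: conv_lim_def)
  then show "eventually (\<lambda>i. \<forall>x\<in>K. \<bar>fs (r i) x - f x\<bar> < e) sequentially"
    by (rule eventually_subseq[OF assms(2)])
qed

lemma conv_lim_at_moving_point:
  fixes fs :: "nat \<Rightarrow> real^'n \<Rightarrow> real"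
  assumes "conv_lim U fs f sequentially" "continuous_on U f" "compact K" "K \<subseteq> U"
    and "\<And>k. xs k \<in> K" "xs \<longlonglongrightarrow> x" "x \<in> K"
  shows "(\<lambda>k. fs k (xs k)) \<longlonglongrightarrow> f x"
proof -
  have "continuous_on K f" using assms continuous_on_subset by blast
  then have a: "(\<lambda>k. f (xs k)) \<longlonglongrightarrow> f x"
    by (rule continuous_on_tendsto_compose[OF _ assms(6,7)]) (use assms(5) in auto)
  have "(\<lambda>k. fs k (xs k) - f (xs k)) \<longlonglongrightarrow> 0"
  proof (rule tendstoI)
    fix e :: real assume "e > 0"
    show "eventually (\<lambda>k. dist (fs k (xs k) - f (xs k)) 0 < e) sequentially"
      using conv_limD[OF assms(1,3,4) \<open>e > 0\<close>] by eventually_elim (use assms(5) in auto)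
  qed
  from tendsto_add[OF this a] show ?thesis by simp
qed

text \<open>Compactness of \<open>K\<close> yields a limit contact point, and the subgradient
  inequality passes to the limit. A constant sequence of functions gives closedness of
  \<open>hit\<close>; a constant sequence of slopes gives the semicontinuity needed for weak
  convergence.\<close>

lemma contact_closed_graph:
  fixes fs :: "nat \<Rightarrow> real^'n \<Rightarrow> real"
  assumes lim: "conv_lim U fs f sequentially" and f: "continuous_on U f" and K: "compact K" "K \<subseteq> U"
    and xs: "\<And>k. xs k \<in> K" "\<And>k. xs k \<in> contact U (fs k) (ps k)" and ps: "ps \<longlonglongrightarrow> p"
  shows "\<exists>x\<in>K. x \<in> contact U f p"
proof -
  obtain x r where x: "x \<in> K" "strict_mono r" "(\<lambda>k. xs (r k)) \<longlonglongrightarrow> x"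
    using seq_compactE[OF compact_imp_seq_compact[OF K(1)], of xs] xs(1) unfolding o_def by metis
  have l: "conv_lim U (\<lambda>k. fs (r k)) f sequentially" by (rule conv_lim_subseq[OF lim x(2)])
  have p: "(\<lambda>k. ps (r k)) \<longlonglongrightarrow> p" using LIMSEQ_subseq_LIMSEQ[OF ps x(2)] by (simp add: o_def)
  have "f x + p \<bullet> (y - x) \<le> f y" if y: "y \<in> U" for y
  proof (rule LIMSEQ_le)
    show "(\<lambda>k. fs (r k) (xs (r k)) + ps (r k) \<bullet> (y - xs (r k))) \<longlonglongrightarrow> f x + p \<bullet> (y - x)"
      by (intro tendsto_intros p x(3) conv_lim_at_moving_point[OF l f K] xs(1) x(1))
    show "(\<lambda>k. fs (r k) y) \<longlonglongrightarrow> f y" by (rule conv_lim_pointwise[OF l y])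
    show "\<exists>N. \<forall>n\<ge>N. fs (r n) (xs (r n)) + ps (r n) \<bullet> (y - xs (r n)) \<le> fs (r n) y"
      using xs(2) y by (auto simp: contact_def)
  qed
  then show ?thesis using x(1) K(2) by (auto simp: contact_def)
qed

lemma conv_lim_const: "conv_lim U (\<lambda>_. f) f F"
  by (auto simp: conv_lim_def)

lemma closed_hit:
  assumes "continuous_on U f" "compact K" "K \<subseteq> U"
  shows "closed (hit U f K)"
  unfolding closed_sequential_limits
proof (intro allI impI)
  fix ps p assume a: "(\<forall>n. ps n \<in> hit U f K) \<and> ps \<longlonglongrightarrow> p"
  then obtain xs where "\<And>n. xs n \<in> K" "\<And>n. xs n \<in> contact U f (ps n)"
    unfolding hit_def mem_Collect_eq by metis
  then show "p \<in> hit U f K"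
    using contact_closed_graph[OF conv_lim_const[of U f] assms, of xs ps p] a by (auto simp: hit_def)
qed

text \<open>Over a distance \<open>e\<close> from the contact point in the direction of
  \<open>p\<close>, the function rises by at least \<open>e * norm p\<close>, but by no more than
  \<open>2 * A\<close>.\<close>

lemma hit_bound:
  assumes e: "e > 0" "{x. infdist x K \<le> e} \<subseteq> U" and A: "\<And>x. infdist x K \<le> e \<Longrightarrow> \<bar>f x\<bar> \<le> A"
    and p: "p \<in> hit U f K"
  shows "norm p \<le> 2 * A / e"
proof (cases "p = 0")
  case True
  obtain x where "x \<in> K" using p by (auto simp: hit_def)
  then have "0 \<le> A" using A[of x] e by (simp add: order_trans[OF abs_ge_zero])
  then show ?thesis using True e by simp
next
  case False
  obtain x where x: "x \<in> K" "x \<in> contact U f p" using p by (auto simp: hit_def)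
  define y where "y = x + (e / norm p) *\<^sub>R p"
  have "dist y x = e" using False e by (simp add: y_def dist_norm)
  then have y: "infdist y K \<le> e" using infdist_le2[OF x(1), of y e] by simp
  have "f x + p \<bullet> (y - x) \<le> f y" using x(2) y e(2) by (auto simp: contact_def)
  moreover have "p \<bullet> (y - x) = e * norm p" using False
    by (simp add: y_def dot_square_norm power2_eq_square)
  moreover have "\<bar>f x\<bar> \<le> A" using A[of x] x(1) e by simp
  moreover have "\<bar>f y\<bar> \<le> A" using A[OF y] .
  ultimately have "e * norm p \<le> 2 * A" by linarith
  then show ?thesis using e by (simp add: field_simps)
qed

section \<open>Exceptional slopes and measurability of the contact map\<close>

text \<open>Fubini for pairs of a point and a shift \<open>t\<close> in \<open>{0..1}\<close> along
  \<open>e\<close>: every shift of \<open>N\<close> has the measure of \<open>N\<close>, while each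
  line meets \<open>N\<close> in a null set of parameters.\<close>

lemma null_set_if_countable_on_lines:
  fixes N :: "'a::euclidean_space set"
  assumes N[measurable]: "N \<in> sets borel" and cnt: "\<And>p. countable {t::real. p + t *\<^sub>R e \<in> N}"
  shows "N \<in> null_sets lborel"
proof -
  define g :: "'a \<Rightarrow> real \<Rightarrow> ennreal" where "g p t = indicator N (p + t *\<^sub>R e) * indicator {0..1} t" for p t
  have m: "case_prod g \<in> borel_measurable (lborel \<Otimes>\<^sub>M lborel)"
  proof -
    have "(\<lambda>z::'a \<times> real. fst z + snd z *\<^sub>R e) \<in> borel_measurable (lborel \<Otimes>\<^sub>M lborel)"
      by measurable
    then have "(\<lambda>z::'a \<times> real. indicator N (fst z + snd z *\<^sub>R e) * indicator {0..1} (snd z) :: ennreal) \<in> borel_measurable (lborel \<Otimes>\<^sub>M lborel)"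
      by measurable
    then show ?thesis by (simp add: g_def case_prod_beta')
  qed
  have "(\<integral>\<^sup>+p. g p t \<partial>lborel) = emeasure lborel N * indicator {0..1} t" for t
  proof -
    have "(\<integral>\<^sup>+p. indicator N (p + t *\<^sub>R e) \<partial>lborel) = (\<integral>\<^sup>+p. indicator N p \<partial>distr lborel borel ((+) (t *\<^sub>R e)))"
      by (subst nn_integral_distr) (auto simp: add.commute)
    also have "\<dots> = emeasure lborel N" by (simp add: lborel_distr_plus)
    finally show ?thesis unfolding g_def
      by (subst nn_integral_multc) auto
  qed
  then have "(\<integral>\<^sup>+t. \<integral>\<^sup>+p. g p t \<partial>lborel \<partial>lborel) = emeasure lborel N"
    by (simp add: nn_integral_cmult)
  moreover have "(\<integral>\<^sup>+t. \<integral>\<^sup>+p. g p t \<partial>lborel \<partial>lborel) = (\<integral>\<^sup>+p. \<integral>\<^sup>+t. g p t \<partial>lborel \<partial>lborel)"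
    using lborel_pair.Fubini'[of g] m by simp
  moreover have "(\<integral>\<^sup>+t. g p t \<partial>lborel) = 0" for p
  proof -
    have "{t::real. p + t *\<^sub>R e \<in> N} \<in> null_sets lborel"
      using cnt[of p] by (rule countable_imp_null_set_lborel)
    then have "AE t in lborel. t \<notin> {t::real. p + t *\<^sub>R e \<in> N}" by (rule AE_not_in)
    then have "(\<integral>\<^sup>+t. g p t \<partial>lborel) = (\<integral>\<^sup>+t. 0 \<partial>(lborel::real measure))"
      by (intro nn_integral_cong_AE) (auto simp: g_def elim!: eventually_mono)
    then show ?thesis by simp
  qed
  ultimately have "emeasure lborel N = 0" by simp
  then show ?thesis by (simp add: null_sets_def)
qed

lemma hit_Un: "hit U f (\<Union>i\<in>I. C i) = (\<Union>i\<in>I. hit U f (C i))"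
  by (auto simp: hit_def)

text \<open>Along a line in direction \<open>axis i 1\<close> the open intervals spanned by the \<open>i\<close>-th coordinates of the
  contact sets are disjoint by monotonicity, so only countably many of them are nonempty.\<close>
lemma nonunique_negligible:
  fixes U :: "(real^'n) set"
  assumes U: "open U" and f: "continuous_on U f"
  shows "negligible (nonunique U f)"
proof -
  define N where "N i = {p. \<exists>x\<in>contact U f p. \<exists>y\<in>contact U f p. x $ i < y $ i}" for i
  obtain C where C: "\<And>n. compact (C n)" "\<And>n. C n \<subseteq> U" "\<And>n. C n \<subseteq> interior (C (Suc n))" "\<Union>(range C) = U"
    using open_Union_compact_subsets[OF U] by metis
  have Cmono: "incseq C" using C(3) interior_subset by (intro incseq_SucI) blast
  have Nb: "N i \<in> sets borel" for i
  proof -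
    \<comment> \<open>Rational separators and a compact exhaustion exhibit \<open>N i\<close> as a
      countable union of intersections of two closed sets, hence as a Borel set.\<close>
    have "N i = (\<Union>m. \<Union>q\<in>\<rat>. \<Union>q'\<in>{q'\<in>\<rat>. q < q'}. hit U f (C m \<inter> {x. x $ i \<le> q}) \<inter> hit U f (C m \<inter> {x. q' \<le> x $ i}))" (is "_ = ?R")
    proof (intro set_eqI iffI)
      fix p assume "p \<in> N i"
      then obtain x y where xy: "x \<in> contact U f p" "y \<in> contact U f p" "x $ i < y $ i" by (auto simp: N_def)
      obtain q where q: "q \<in> \<rat>" "x $ i < q" "q < y $ i" using Rats_dense_in_real[OF xy(3)] by blast
      obtain q' where q': "q' \<in> \<rat>" "q < q'" "q' < y $ i" using Rats_dense_in_real[OF q(3)] by blast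
      obtain m1 m2 where "x \<in> C m1" "y \<in> C m2" using xy(1,2) contact_subset C(4) by blast
      then have "x \<in> C (max m1 m2)" "y \<in> C (max m1 m2)"
        using monoD[OF Cmono, of m1 "max m1 m2"] monoD[OF Cmono, of m2 "max m1 m2"] by auto
      then have "p \<in> hit U f (C (max m1 m2) \<inter> {x. x $ i \<le> q}) \<inter> hit U f (C (max m1 m2) \<inter> {x. q' \<le> x $ i})"
        using xy q q' unfolding hit_def by force
      then show "p \<in> ?R" using q q' by blast
    next
      fix p assume "p \<in> ?R"
      then show "p \<in> N i" unfolding hit_def N_def by force
    qed
    moreover have cl: "closed (hit U f (C m \<inter> {x. x $ i \<le> q}))" "closed (hit U f (C m \<inter> {x. q \<le> x $ i}))" for m q
    proof -
      have "closed {x::real^'n. x $ i \<le> q}" "closed {x::real^'n. q \<le> x $ i}"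
        by (intro closed_Collect_le continuous_intros)+
      then show "closed (hit U f (C m \<inter> {x. x $ i \<le> q}))" "closed (hit U f (C m \<inter> {x. q \<le> x $ i}))"
        using C(1,2) by (auto intro!: closed_hit[OF f] compact_Int_closed)
    qed
    moreover have "countable {q'\<in>\<rat>. (q::real) < q'}" for q
      by (rule countable_subset[OF _ countable_rat]) auto
    ultimately show ?thesis
      by (simp only:) (intro sets.countable_UN'' sets.Int borel_closed countable_rat countableI_type)
  qed
  have "countable {t. p + t *\<^sub>R axis i 1 \<in> N i}" for p i
  proof -
    define T where "T = {t. p + t *\<^sub>R axis i 1 \<in> N i}"
    have "\<forall>t\<in>T. \<exists>x y q. x \<in> contact U f (p + t *\<^sub>R axis i 1) \<and> y \<in> contact U f (p + t *\<^sub>R axis i 1) \<and> q \<in> \<rat> \<and> x $ i < q \<and> q < y $ i"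
    proof
      fix t assume "t \<in> T"
      then obtain x y where "x \<in> contact U f (p + t *\<^sub>R axis i 1)" "y \<in> contact U f (p + t *\<^sub>R axis i 1)" "x $ i < y $ i"
        by (auto simp: T_def N_def)
      then show "\<exists>x y q. x \<in> contact U f (p + t *\<^sub>R axis i 1) \<and> y \<in> contact U f (p + t *\<^sub>R axis i 1) \<and> q \<in> \<rat> \<and> x $ i < q \<and> q < y $ i"
        using Rats_dense_in_real[of "x $ i" "y $ i"] by blast
    qed
    then obtain X Y Q where XYQ: "\<And>t. t \<in> T \<Longrightarrow> X t \<in> contact U f (p + t *\<^sub>R axis i 1)" 
      "\<And>t. t \<in> T \<Longrightarrow> Y t \<in> contact U f (p + t *\<^sub>R axis i 1)" 
      "\<And>t. t \<in> T \<Longrightarrow> Q t \<in> \<rat> \<and> X t $ i < Q t \<and> Q t < Y t $ i" by metis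
    have lt: "Q s < Q t" if "s \<in> T" "t \<in> T" "s < t" for s t
    proof -
      have "0 \<le> ((p + t *\<^sub>R axis i 1) - (p + s *\<^sub>R axis i 1)) \<bullet> (X t - Y s)"
        by (rule contact_monotone[OF XYQ(1)[OF that(2)] XYQ(2)[OF that(1)]])
      also have "\<dots> = (t - s) * (X t $ i - Y s $ i)"
        by (simp add: scaleR_diff_left[symmetric] inner_axis' inner_commute)
      finally have "Y s $ i \<le> X t $ i" using that(3) by (simp add: zero_le_mult_iff)
      then show ?thesis using XYQ(3)[OF that(1)] XYQ(3)[OF that(2)] by linarith
    qed
    have "inj_on Q T"
    proof (rule inj_onI)
      fix s t assume "s \<in> T" "t \<in> T" "Q s = Q t"
      then show "s = t" using lt[of s t] lt[of t s] by (cases s t rule: linorder_cases) auto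
    qed
    moreover have "countable (Q ` T)" by (rule countable_subset[OF _ countable_rat]) (use XYQ(3) in auto)
    ultimately show ?thesis unfolding T_def[symmetric] using countable_image_inj_on by blast
  qed
  then have "N i \<in> null_sets lborel" for i using null_set_if_countable_on_lines[OF Nb] by blast
  then have "negligible (N i)" for i
    unfolding negligible_iff_null_sets by (rule null_sets_completionI)
  moreover have "nonunique U f = (\<Union>i. N i)"
  proof (intro set_eqI iffI)
    fix p assume "p \<in> nonunique U f"
    then obtain x y where xy: "x \<in> contact U f p" "y \<in> contact U f p" "x \<noteq> y" by (auto simp: nonunique_def)
    then obtain i where "x $ i \<noteq> y $ i" by (auto simp: vec_eq_iff)
    then have "x $ i < y $ i \<or> y $ i < x $ i" by linarith
    then show "p \<in> (\<Union>i. N i)" using xy unfolding N_def by blast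
  next
    fix p assume "p \<in> (\<Union>i. N i)"
    then obtain i x y where "x \<in> contact U f p" "y \<in> contact U f p" "x $ i < y $ i" unfolding N_def by blast
    moreover from this have "x \<noteq> y" by auto
    ultimately show "p \<in> nonunique U f" unfolding nonunique_def by blast
  qed
  ultimately show ?thesis by (auto intro!: negligible_Union)
qed

text \<open>Compact sets have closed images and open sets are countable unions of compact ones. The
  exceptional slopes are only known to form a negligible set, which is why measurability is claimed
  for \<open>lebesgue\<close>.\<close>

lemma sets_lebesgue_hit_diff:
  assumes U: "open U" and f: "continuous_on U f" and S: "open S"
  shows "hit U f (S \<inter> U) - nonunique U f \<in> sets lebesgue"
proof -
  have "open (S \<inter> U)" using U S by blast
  from open_Union_compact_subsets[OF this]
  obtain C where C: "\<And>n. compact (C n)" "\<And>n. C n \<subseteq> S \<inter> U" "\<And>n. C n \<subseteq> interior (C (Suc n))" "\<Union>(range C) = S \<inter> U"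
    by metis
  have "closed (hit U f (C n))" for n using C by (intro closed_hit[OF f]) auto
  then have "(\<Union>n. hit U f (C n)) \<in> sets lebesgue"
    by (intro sets.countable_UN) (auto simp: borel_closed)
  moreover have "hit U f (S \<inter> U) = (\<Union>n. hit U f (C n))" using hit_Un[of U f C UNIV] C(4) by simp
  moreover have "nonunique U f \<in> sets lebesgue"
    using nonunique_negligible[OF U f] by (rule negligible_imp_sets)
  ultimately show ?thesis by auto
qed

lemma sets_unique_contact:
  assumes "open U" "continuous_on U f"
  shows "unique_contact U f \<in> sets lebesgue"
  using sets_lebesgue_hit_diff[OF assms, of UNIV] by (simp add: unique_contact_eq)

lemma measurable_contact_pt:
  assumes "open U" "continuous_on U f"
  shows "contact_pt U f \<in> borel_measurable (lebesgue_on (unique_contact U f))"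
proof (rule borel_measurableI)
  fix S :: "(real^'a) set" assume "open S"
  then have "contact_pt U f -` S \<inter> unique_contact U f \<in> sets lebesgue"
    unfolding contact_pt_vimage by (rule sets_lebesgue_hit_diff[OF assms])
  then show "contact_pt U f -` S \<inter> space (lebesgue_on (unique_contact U f)) \<in> sets (lebesgue_on (unique_contact U f))"
    using sets_unique_contact[OF assms] by (auto simp: sets_restrict_space_iff space_restrict_space)
qed

lemma emeasure_subdiff_measure:
  assumes "open U" "continuous_on U f" "A \<in> sets borel"
  shows "emeasure (subdiff_measure U f) A = emeasure lebesgue (hit U f (A \<inter> U) - nonunique U f)"
proof -
  have sp: "space (lebesgue_on (unique_contact U f)) = unique_contact U f" by (simp add: space_restrict_space)
  have "emeasure (subdiff_measure U f) A = emeasure (lebesgue_on (unique_contact U f)) (contact_pt U f -` A \<inter> unique_contact U f)"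
    unfolding subdiff_measure_def emeasure_distr[OF measurable_contact_pt[OF assms(1,2)] assms(3)] sp ..
  also have "\<dots> = emeasure lebesgue (contact_pt U f -` A \<inter> unique_contact U f)"
    by (rule emeasure_restrict_space) (use sets_unique_contact[OF assms(1,2)] in auto)
  finally show ?thesis unfolding contact_pt_vimage .
qed

lemma bounded_hit:
  assumes U: "open U" and f: "continuous_on U f" and K: "compact K" "K \<subseteq> U"
  shows "bounded (hit U f K)"
proof (cases "K = {}")
  case True then show ?thesis by (simp add: hit_def)
next
  case False
  obtain e where e: "e > 0" "compact {x. infdist x K \<le> e}" "{x. infdist x K \<le> e} \<subseteq> U"
    using compact_neighbourhood[OF K(1) U K(2) False] by metis
  have "bounded (f ` {x. infdist x K \<le> e})"
    using e(2) compact_continuous_image[OF continuous_on_subset[OF f e(3)]] compact_imp_bounded by blast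
  then obtain A where "\<And>x. infdist x K \<le> e \<Longrightarrow> \<bar>f x\<bar> \<le> A" by (auto simp: bounded_iff)
  then show ?thesis using hit_bound[OF e(1,3), of f A] by (auto simp: bounded_iff)
qed

lemma lfm_subdiff_measure:
  assumes U: "open U" and f: "continuous_on U f"
  shows "lfm U (subdiff_measure U f)"
  unfolding lfm_def
proof (intro conjI allI impI)
  show "sets (subdiff_measure U f) = sets borel" by (simp add: subdiff_measure_def)
  have "-U \<in> sets borel" using U by simp
  then show "emeasure (subdiff_measure U f) (- U) = 0"
    by (simp add: emeasure_subdiff_measure[OF U f] hit_def)
  fix K assume K: "compact K \<and> K \<subseteq> U"
  then have Kb: "K \<in> sets borel" using borel_compact by blast
  have "closed (hit U f K)" "bounded (hit U f K)" using K closed_hit[OF f] bounded_hit[OF U f] by auto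
  then have "emeasure lebesgue (hit U f K) < \<infinity>" 
    using emeasure_bounded_finite[of "hit U f K"] by (simp add: borel_closed)
  moreover have "K \<inter> U = K" using K by auto
  moreover have "emeasure lebesgue (hit U f K - nonunique U f) \<le> emeasure lebesgue (hit U f K)"
    using \<open>closed (hit U f K)\<close> by (intro emeasure_mono) (auto simp: borel_closed)
  ultimately show "emeasure (subdiff_measure U f) K < \<infinity>"
    by (simp add: emeasure_subdiff_measure[OF U f Kb] le_less_trans)
qed

section \<open>Weak continuity of the subdifferential measure\<close>

text \<open>The test function transported to slope space. The indicator supplies the value 0 where
  \<open>contact_pt\<close> is an arbitrary value of \<open>THE\<close>.\<close>

definition contact_val :: "(real^'n) set \<Rightarrow> (real^'n \<Rightarrow> real) \<Rightarrow> (real^'n \<Rightarrow> complex) \<Rightarrow> real^'n \<Rightarrow> complex" where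
  "contact_val U f \<phi> p = indicat_real (unique_contact U f) p *\<^sub>R \<phi> (contact_pt U f p)"

lemma Cc_borel:
  assumes "Cc U \<phi>" shows "\<phi> \<in> borel_measurable borel"
proof -
  obtain K where K: "compact K" "K \<subseteq> U" "\<And>x. x \<notin> K \<Longrightarrow> \<phi> x = 0" and cont: "continuous_on U \<phi>"
    using assms by (auto simp: Cc_def)
  have "(\<lambda>x. indicator K x *\<^sub>R \<phi> x) \<in> borel_measurable borel"
    by (rule borel_measurable_continuous_on_indicator[OF borel_compact[OF K(1)] continuous_on_subset[OF cont K(2)]])
  moreover have "(\<lambda>x. indicator K x *\<^sub>R \<phi> x) = \<phi>" using K(3) by (auto simp: indicator_def fun_eq_iff)
  ultimately show ?thesis by simp
qed

lemma integral_subdiff_measure: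
  assumes "open U" "continuous_on U f" "Cc U \<phi>"
  shows "integral\<^sup>L (subdiff_measure U f) \<phi> = integral\<^sup>L lebesgue (contact_val U f \<phi>)"
    "integrable lebesgue (contact_val U f \<phi>)"
proof -
  have G: "unique_contact U f \<inter> space lebesgue \<in> sets lebesgue" using sets_unique_contact[OF assms(1,2)] by simp
  note m = measurable_contact_pt[OF assms(1,2)] Cc_borel[OF assms(3)]
  show "integral\<^sup>L (subdiff_measure U f) \<phi> = integral\<^sup>L lebesgue (contact_val U f \<phi>)"
    unfolding subdiff_measure_def contact_val_def integral_distr[OF m] by (rule integral_restrict_space[OF G])
  have "integrable (subdiff_measure U f) \<phi>" by (rule Cc_integrable[OF lfm_subdiff_measure[OF assms(1,2)] assms(3)])
  then have "integrable (lebesgue_on (unique_contact U f)) (\<lambda>p. \<phi> (contact_pt U f p))"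
    unfolding subdiff_measure_def integrable_distr_eq[OF m] .
  then show "integrable lebesgue (contact_val U f \<phi>)"
    unfolding contact_val_def integrable_restrict_space[OF G] .
qed

text \<open>Uniqueness of the contact point makes \<open>x\<close> a strict minimizer of
  \<open>f\<close> minus the linear function \<open>p\<close>, with a positive gap on a small
  sphere. Small perturbations keep a minimizer inside the ball, and for a convex function a local
  minimizer is a global one.\<close>

lemma contact_stable:
  fixes fs :: "nat \<Rightarrow> real^'n \<Rightarrow> real"
  assumes U: "open U" and f: "convex_on U f" "continuous_on U f" and fs: "\<And>k. convex_on U (fs k)" "\<And>k. continuous_on U (fs k)"
    and lim: "conv_lim U fs f sequentially"
    and x: "x \<in> contact U f p" and p: "p \<notin> nonunique U f" and d: "d > 0" "cball x d \<subseteq> U"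
  shows "eventually (\<lambda>k. \<exists>y\<in>ball x d. y \<in> contact U (fs k) p) sequentially"
proof -
  define h where "h y = f y - f x - p \<bullet> (y - x)" for y
  have h0: "h x = 0" "\<And>y. y \<in> U \<Longrightarrow> 0 \<le> h y" using x by (auto simp: h_def contact_def)
  have hpos: "h y > 0" if "y \<in> U" "y \<noteq> x" for y
  proof (rule ccontr)
    assume "\<not> h y > 0"
    then have hy: "f y = f x + p \<bullet> (y - x)" using h0(2)[OF that(1)] by (simp add: h_def)
    have "y \<in> contact U f p"
      unfolding contact_def mem_Collect_eq
    proof (intro conjI ballI that(1))
      fix z assume "z \<in> U"
      then have "f x + p \<bullet> (z - x) \<le> f z" using x by (simp add: contact_def)
      then show "f y + p \<bullet> (z - y) \<le> f z" unfolding hy by (simp add: inner_diff_right)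
    qed
    then show False using p x that(2) by (auto simp: nonunique_def)
  qed
  have "\<exists>g>0. \<forall>y\<in>sphere x d. g \<le> h y"
  proof (cases "sphere x d = {}")
    case False
    have hc: "continuous_on (sphere x d) h"
      unfolding h_def using d(2) sphere_cball by (intro continuous_intros continuous_on_subset[OF f(2)]) blast
    obtain z where z: "z \<in> sphere x d" "\<And>y. y \<in> sphere x d \<Longrightarrow> h z \<le> h y"
      using continuous_attains_inf[OF compact_sphere False hc] by blast
    have "z \<in> U" "z \<noteq> x" using z(1) d by auto
    then show ?thesis using hpos[of z] z(2) by blast
  qed (auto intro: exI[of _ 1])
  then obtain g where g: "g > 0" "\<And>y. y \<in> sphere x d \<Longrightarrow> g \<le> h y" by blast
  \<comment> \<open>Half the gap suffices: the error enters once on the sphere and once at the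
    centre.\<close>
  have "eventually (\<lambda>k. \<forall>y\<in>cball x d. \<bar>fs k y - f y\<bar> < g / 2) sequentially"
    using conv_limD[OF lim compact_cball d(2), of "g/2"] g by simp
  then show ?thesis
  proof eventually_elim
    case (elim k)
    define hk where "hk y = fs k y - p \<bullet> y" for y
    have "continuous_on (cball x d) hk"
      unfolding hk_def using d(2) by (intro continuous_intros continuous_on_subset[OF fs(2)])
    then obtain y where y: "y \<in> cball x d" "\<And>z. z \<in> cball x d \<Longrightarrow> hk y \<le> hk z"
      using continuous_attains_inf[OF compact_cball, of x d hk] d by auto
    have xin: "x \<in> cball x d" using d by simp
    have yb: "y \<in> ball x d"
    proof (rule ccontr)
      assume "y \<notin> ball x d"
      then have "y \<in> sphere x d" using y(1) by auto
      then have "g \<le> f y - f x - p \<bullet> (y - x)" using g(2)[of y] by (simp add: h_def)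
      moreover have "fs k y - p \<bullet> y \<le> fs k x - p \<bullet> x" using y(2)[OF xin] by (simp add: hk_def)
      moreover have "\<bar>fs k y - f y\<bar> < g / 2" "\<bar>fs k x - f x\<bar> < g / 2" using elim y(1) xin by blast+
      ultimately show False unfolding inner_diff_right by linarith
    qed
    have "hk y \<le> hk z" if "z \<in> U" for z
    proof -
      have "convex_on U hk"
        unfolding hk_def using fs(1)[of k]
        by (intro convex_on_diff) (auto simp: concave_on_iff convex_on_def inner_add_right)
      moreover obtain r where "r > 0" "ball y r \<subseteq> ball x d" using yb openE[OF open_ball yb] by blast
      ultimately show ?thesis
        using convex_local_global_minimum[of r U hk y] y(2) that d(2) yb by (metis ball_subset_cball subset_eq subset_trans)
    qed
    then have "y \<in> contact U (fs k) p"
      using yb d(2) by (fastforce simp: contact_def hk_def inner_diff_right)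
    then show ?case using yb by blast
  qed
qed

lemma contact_val_eq_0: "p \<notin> hit U f K \<Longrightarrow> (\<And>x. x \<notin> K \<Longrightarrow> \<phi> x = 0) \<Longrightarrow> contact_val U f \<phi> p = 0"
  using contact_pt_in[of p U f] by (auto simp: contact_val_def hit_def indicator_def)

text \<open>All integrals live on slope space, where dominated convergence applies. For a slope that
  is exceptional for none of the functions, either the contact points converge, or \<open>f\<close>
  has no contact and the approximants eventually have none over \<open>K\<close>.\<close>

theorem subdiff_measure_weak_continuous:
  fixes fs :: "nat \<Rightarrow> real^'n \<Rightarrow> real"
  assumes U: "open U" and f: "convex_on U f" and fs: "\<And>k. convex_on U (fs k)"
    and lim: "conv_lim U fs f sequentially" and \<phi>: "Cc U \<phi>"
  shows "(\<lambda>k. integral\<^sup>L (subdiff_measure U (fs k)) \<phi>) \<longlonglongrightarrow> integral\<^sup>L (subdiff_measure U f) \<phi>"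
proof -
  have fc: "continuous_on U f" and fsc: "\<And>k. continuous_on U (fs k)"
    using f fs U convex_on_continuous by blast+
  obtain K where K: "compact K" "K \<subseteq> U" "\<And>x. x \<notin> K \<Longrightarrow> \<phi> x = 0" and cont: "continuous_on U \<phi>"
    using \<phi> by (auto simp: Cc_def)
  show ?thesis
  proof (cases "K = {}")
    case True
    then have "\<phi> = (\<lambda>x. 0)" using K(3) by auto
    then show ?thesis by simp
  next
    case False
    obtain e where e: "e > 0" "compact {x. infdist x K \<le> e}" "{x. infdist x K \<le> e} \<subseteq> U"
      using compact_neighbourhood[OF K(1) U K(2) False] by metis
    have "bounded (f ` {x. infdist x K \<le> e})"
      using e(2) compact_continuous_image[OF continuous_on_subset[OF fc e(3)]] compact_imp_bounded by blast
    then obtain A where A: "\<And>x. infdist x K \<le> e \<Longrightarrow> \<bar>f x\<bar> \<le> A" by (auto simp: bounded_iff)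
    obtain k0 where k0: "\<And>k x. k \<ge> k0 \<Longrightarrow> infdist x K \<le> e \<Longrightarrow> \<bar>fs k x - f x\<bar> < 1"
      using conv_limD[OF lim e(2,3), of 1] by (auto simp: eventually_sequentially)
    \<comment> \<open>From \<open>k0\<close> on the functions differ from \<open>f\<close> by less
      than 1 near \<open>K\<close>, so they are bounded there by \<open>A + 1\<close>; all relevant
      slopes lie in one ball.\<close>
    define R where "R = 2 * (A + 1) / e"
    have hitR: "norm p \<le> R" if "p \<in> hit U (fs k) K" "k \<ge> k0" for p k
      unfolding R_def
    proof (rule hit_bound[OF e(1,3) _ that(1)])
      fix x assume "infdist x K \<le> e"
      then show "\<bar>fs k x\<bar> \<le> A + 1" using A[of x] k0[OF that(2), of x] by linarith
    qed
    have "bounded (\<phi> ` K)"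
      using K(1) compact_continuous_image[OF continuous_on_subset[OF cont K(2)]] compact_imp_bounded by blast
    then obtain B where B: "\<And>x. x \<in> K \<Longrightarrow> norm (\<phi> x) \<le> B" by (auto simp: bounded_iff)
    have B': "norm (\<phi> x) \<le> max B 0" for x using B[of x] K(3)[of x] by (cases "x \<in> K") auto
    have ae: "AE p in lebesgue. p \<notin> nonunique U f \<and> (\<forall>k. p \<notin> nonunique U (fs k))"
    proof -
      have "AE p in lebesgue. p \<notin> nonunique U g" if "continuous_on U g" for g
        using nonunique_negligible[OF U that] by (intro AE_not_in) (simp add: negligible_iff_null_sets)
      then show ?thesis using fc fsc by (simp add: AE_all_countable)
    qed
    have "(\<lambda>k. integral\<^sup>L lebesgue (contact_val U (fs (k + k0)) \<phi>)) \<longlonglongrightarrow> integral\<^sup>L lebesgue (contact_val U f \<phi>)"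
    proof (rule integral_dominated_convergence[where w = "\<lambda>p. max B 0 * indicator (cball 0 R) p"])
      show "contact_val U f \<phi> \<in> borel_measurable lebesgue"
        using integral_subdiff_measure(2)[OF U fc \<phi>] by (rule borel_measurable_integrable)
      show "contact_val U (fs (k + k0)) \<phi> \<in> borel_measurable lebesgue" for k
        using integral_subdiff_measure(2)[OF U fsc \<phi>] by (rule borel_measurable_integrable)
      show "integrable lebesgue (\<lambda>p. max B 0 * indicator (cball 0 R :: (real^'n) set) p)"
        using emeasure_bounded_finite[of "cball 0 R :: (real^'n) set"]
        by (intro integrable_mult_right) (auto simp: less_top)
      show "AE p in lebesgue. norm (contact_val U (fs (k + k0)) \<phi> p) \<le> max B 0 * indicator (cball 0 R) p" for k
      proof (rule AE_I2)
        fix p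
        show "norm (contact_val U (fs (k + k0)) \<phi> p) \<le> max B 0 * indicator (cball 0 R) p"
        proof (cases "p \<in> hit U (fs (k + k0)) K")
          case True
          then have "p \<in> cball 0 R" using hitR[of p "k + k0"] by simp
          moreover have "norm (contact_val U (fs (k + k0)) \<phi> p) \<le> max B 0"
            using B' by (auto simp: contact_val_def indicator_def)
          ultimately show ?thesis by simp
        next
          case False
          then show ?thesis using contact_val_eq_0[OF False K(3)] by simp
        qed
      qed
      show "AE p in lebesgue. (\<lambda>k. contact_val U (fs (k + k0)) \<phi> p) \<longlonglongrightarrow> contact_val U f \<phi> p"
        using ae
      proof eventually_elim
        case (elim p)
        have "(\<lambda>k. contact_val U (fs k) \<phi> p) \<longlonglongrightarrow> contact_val U f \<phi> p"
        proof (cases "p \<in> hit U f U")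
          case True
          then obtain x where x: "x \<in> contact U f p" by (auto simp: hit_def)
          have xU: "x \<in> U" by (rule contact_subset[OF x])
          have v: "contact_val U f \<phi> p = \<phi> x" using contact_pt_eq[OF x] elim by (auto simp: contact_val_def)
          obtain d0 where d0: "d0 > 0" "cball x d0 \<subseteq> U" using U xU open_contains_cball by blast
          show ?thesis unfolding v
          proof (rule tendstoI)
            fix r :: real assume "r > 0"
            have "isCont \<phi> x" using cont U xU continuous_on_eq_continuous_at by blast
            then obtain d1 where d1: "d1 > 0" "\<And>y. dist y x < d1 \<Longrightarrow> dist (\<phi> y) (\<phi> x) < r"
              using \<open>r > 0\<close> unfolding continuous_at_eps_delta by blast
            define d where "d = min d0 d1"
            have d: "d > 0" "cball x d \<subseteq> U" using d0 d1 by (auto simp: d_def)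
            have "eventually (\<lambda>k. \<exists>y\<in>ball x d. y \<in> contact U (fs k) p) sequentially"
              using contact_stable[OF U f fc fs fsc lim x _ d] elim by blast
            then show "eventually (\<lambda>k. dist (contact_val U (fs k) \<phi> p) (\<phi> x) < r) sequentially"
            proof eventually_elim
              case (elim k)
              then obtain y where y: "y \<in> ball x d" "y \<in> contact U (fs k) p" by blast
              have "contact_val U (fs k) \<phi> p = \<phi> y"
                using contact_pt_eq[OF y(2)] \<open>p \<notin> nonunique U f \<and> (\<forall>k. p \<notin> nonunique U (fs k))\<close>
                by (auto simp: contact_val_def)
              then show ?case using d1(2)[of y] y(1) by (auto simp: d_def dist_commute)
            qed
          qed
        next
          case nohit: False
          then have v: "contact_val U f \<phi> p = 0" by (auto simp: contact_val_def unique_contact_eq)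
          \<comment> \<open>Otherwise infinitely many approximants touch over \<open>K\<close> with
            slope \<open>p\<close>, and their contact points accumulate at a contact point of
            \<open>f\<close>.\<close>
          have "eventually (\<lambda>k. p \<notin> hit U (fs k) K) sequentially"
          proof (rule ccontr)
            assume "\<not> ?thesis"
            then have "\<exists>\<^sub>F k in sequentially. p \<in> hit U (fs k) K" by (simp add: frequently_def)
            then obtain r :: "nat \<Rightarrow> nat" where r: "strict_mono r" "\<And>k. p \<in> hit U (fs (r k)) K"
              by (metis (no_types, lifting) infinite_enumerate frequently_cofinite cofinite_eq_sequentially mem_Collect_eq)
            then obtain xs where "\<And>k. xs k \<in> K" "\<And>k. xs k \<in> contact U (fs (r k)) p"
              unfolding hit_def mem_Collect_eq by metis
            then have "\<exists>x\<in>K. x \<in> contact U f p"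
              using contact_closed_graph[OF conv_lim_subseq[OF lim r(1)] fc K(1,2), of xs "\<lambda>_. p" p] by simp
            then show False using nohit K(2) by (auto simp: hit_def)
          qed
          then have "eventually (\<lambda>k. contact_val U (fs k) \<phi> p = 0) sequentially"
            by eventually_elim (use contact_val_eq_0 K(3) in blast)
          then show ?thesis unfolding v by (rule tendsto_eventually)
        qed
        then show ?case by (rule LIMSEQ_ignore_initial_segment)
      qed
    qed
    then have "(\<lambda>k. integral\<^sup>L lebesgue (contact_val U (fs k) \<phi>)) \<longlonglongrightarrow> integral\<^sup>L lebesgue (contact_val U f \<phi>)"
      by (rule LIMSEQ_offset)
    then show ?thesis
      by (simp add: integral_subdiff_measure(1)[OF U fc \<phi>] integral_subdiff_measure(1)[OF U fsc \<phi>])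
  qed
qed

section \<open>The Monge-Ampere measure of a twice differentiable function\<close>

text \<open>The change of variables theorems of the library need a well-ordered index type; \<open>idx\<close> provides
  one of the same cardinality as an arbitrary finite type.\<close>
typedef ('a::finite) idx = "{..<CARD('a)}"
  morphisms idx_nat Abs_idx by (auto intro!: exI[of _ 0])

lemma idx_bij: "bij_betw idx_nat (UNIV :: 'a::finite idx set) {..<CARD('a)}"
  by (rule bij_betwI[of _ _ _ Abs_idx]) (use idx_nat idx_nat_inverse Abs_idx_inverse in auto)

instance idx :: (finite) finite
  by standard (use bij_betw_finite[OF idx_bij] in auto)

lemma card_idx: "CARD('a::finite idx) = CARD('a)"
  using bij_betw_same_card[OF idx_bij[where 'a = 'a]] by simp

instantiation idx :: (finite) wellorder
begin
definition less_eq_idx :: "'a idx \<Rightarrow> 'a idx \<Rightarrow> bool" where "less_eq_idx a b \<longleftrightarrow> idx_nat a \<le> idx_nat b"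
definition less_idx :: "'a idx \<Rightarrow> 'a idx \<Rightarrow> bool" where "less_idx a b \<longleftrightarrow> idx_nat a < idx_nat b"
instance
proof
  fix P :: "'a idx \<Rightarrow> bool" and a :: "'a idx"
  assume *: "\<And>x. (\<And>y. y < x \<Longrightarrow> P y) \<Longrightarrow> P x"
  show "P a"
  proof (induction "idx_nat a" arbitrary: a rule: less_induct)
    case less
    then show ?case using * by (auto simp: less_idx_def)
  qed
qed (auto simp: less_eq_idx_def less_idx_def idx_nat_inject)
end

section \<open>Change of variables for an arbitrary finite index type\<close>

text \<open>Conjugation with \<open>e\<close> is a bijection between the permutations of the two
  index types and preserves signs.\<close>

lemma det_reindex:
  fixes A :: "'a::comm_ring_1^'n^'n" and e :: "'m::finite \<Rightarrow> 'n"
  assumes e: "bij e"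
  shows "det (\<chi> i j. A $ e i $ e j) = det A"
proof -
  have mp: "map_permutation UNIV e p = e \<circ> p \<circ> inv e" for p
    using e by (auto simp: map_permutation_def restrict_id_def bij_def fun_eq_iff)
  have mp': "map_permutation UNIV (inv e) p = inv e \<circ> p \<circ> e" for p
    using e bij_imp_bij_inv[OF e] by (auto simp: map_permutation_def restrict_id_def bij_def fun_eq_iff inv_inv_eq)
  have ie: "inv e (e x) = x" "e (inv e y) = y" for x y
    using e by (auto simp: bij_def surj_f_inv_f)
  show ?thesis
    unfolding det_def
  proof (rule sum.reindex_bij_witness[of _ "map_permutation UNIV (inv e)" "map_permutation UNIV e"])
    fix p :: "'m \<Rightarrow> 'm" assume p: "p \<in> {p. p permutes UNIV}"
    show "map_permutation UNIV (inv e) (map_permutation UNIV e p) = p"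
      by (simp add: mp mp' fun_eq_iff ie)
    show "map_permutation UNIV e p \<in> {p. p permutes UNIV}"
      using p e by (auto intro: map_permutation_permutes)
    have s: "sign (map_permutation UNIV e p) = sign p"
      using p e by (intro sign_map_permutation) (auto simp: bij_def)
    have "(\<Prod>k\<in>UNIV. A $ k $ map_permutation UNIV e p k) = (\<Prod>i\<in>UNIV. A $ e i $ map_permutation UNIV e p (e i))"
      using e by (intro prod.reindex_bij_betw[symmetric]) auto
    then show "of_int (sign (map_permutation UNIV e p)) * (\<Prod>i\<in>UNIV. A $ i $ map_permutation UNIV e p i) =
      of_int (sign p) * (\<Prod>i\<in>UNIV. (\<chi> i j. A $ e i $ e j) $ i $ p i)"
      by (simp only: s) (simp add: mp ie)
  next
    fix q :: "'n \<Rightarrow> 'n" assume q: "q \<in> {p. p permutes UNIV}"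
    show "map_permutation UNIV e (map_permutation UNIV (inv e) q) = q"
      by (simp add: mp mp' fun_eq_iff ie)
    show "map_permutation UNIV (inv e) q \<in> {p. p permutes UNIV}"
      using q bij_imp_bij_inv[OF e] by (auto intro: map_permutation_permutes)
  qed
qed

definition permute_coords :: "('m \<Rightarrow> 'n) \<Rightarrow> real^'n \<Rightarrow> real^'m" where
  "permute_coords e x = (\<chi> i. x $ e i)"

lemma linear_permute_coords: "linear (permute_coords e)"
  by (rule linearI) (simp_all add: permute_coords_def vec_eq_iff)

lemma continuous_on_permute_coords: "continuous_on S (permute_coords (e :: 'm::finite \<Rightarrow> 'n::finite))"
  using linear_permute_coords linear_conv_bounded_linear linear_continuous_on by blast

lemma permute_coords_inv:
  assumes "bij e" 
  shows "permute_coords (inv e) (permute_coords e x) = x" "permute_coords e (permute_coords (inv e) y) = y"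
  using assms by (auto simp: permute_coords_def vec_eq_iff bij_def surj_f_inv_f)

text \<open>Relabelling coordinates takes boxes to boxes with the same side lengths, and boxes
  determine Lebesgue measure.\<close>

lemma lborel_distr_permute_coords:
  fixes e :: "'m::finite \<Rightarrow> 'n::finite"
  assumes e: "bij e"
  shows "distr lborel borel (permute_coords e) = lborel"
proof (rule lborel_eqI[symmetric])
  fix l u :: "real^'m" assume le: "\<And>b. b \<in> Basis \<Longrightarrow> l \<bullet> b \<le> u \<bullet> b"
  have m: "permute_coords e \<in> borel_measurable borel"
    using continuous_on_permute_coords by (rule borel_measurable_continuous_onI)
  have le': "l $ i \<le> u $ i" for i using le[of "axis i 1"] by (simp add: cart_eq_inner_axis)
  have surj: "\<exists>k. i = e k" for i using e by (metis bij_pointE)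
  have "permute_coords e -` box l u = box (permute_coords (inv e) l) (permute_coords (inv e) u)"
  proof (intro set_eqI)
    fix x
    have "x \<in> permute_coords e -` box l u \<longleftrightarrow> (\<forall>i. l $ i < x $ e i \<and> x $ e i < u $ i)"
      by (simp add: mem_box_cart permute_coords_def)
    also have "\<dots> \<longleftrightarrow> (\<forall>k. l $ inv e k < x $ k \<and> x $ k < u $ inv e k)"
      using e by (metis bij_inv_eq_iff)
    finally show "x \<in> permute_coords e -` box l u \<longleftrightarrow> x \<in> box (permute_coords (inv e) l) (permute_coords (inv e) u)"
      by (simp add: mem_box_cart permute_coords_def)
  qed
  then have "emeasure (distr lborel borel (permute_coords e)) (box l u) = emeasure lborel (box (permute_coords (inv e) l) (permute_coords (inv e) u))"
    using m by (simp add: emeasure_distr)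
  also have "\<dots> = (\<Prod>b\<in>Basis. (permute_coords (inv e) u - permute_coords (inv e) l) \<bullet> b)"
    by (rule emeasure_lborel_box) (auto simp: Basis_vec_def permute_coords_def inner_axis le')
  also have "\<dots> = (\<Prod>k\<in>UNIV. u $ inv e k - l $ inv e k)"
    by (simp add: Basis_vec_def prod.UNION_disjoint UNION_singleton_eq_range prod.reindex inj_on_def axis_eq_axis inner_axis permute_coords_def)
  also have "\<dots> = (\<Prod>i\<in>UNIV. u $ i - l $ i)"
    using prod.reindex_bij_betw[OF bij_imp_bij_inv[OF e], of "\<lambda>i. u $ i - l $ i"] by simp
  also have "\<dots> = (\<Prod>b\<in>Basis. (u - l) \<bullet> b)"
    by (simp add: Basis_vec_def UNION_singleton_eq_range prod.reindex inj_on_def axis_eq_axis inner_axis)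
  finally show "emeasure (distr lborel borel (permute_coords e)) (box l u) = (\<Prod>b\<in>Basis. (u - l) \<bullet> b)" .
qed simp

lemma continuous_on_det [continuous_intros]:
  fixes f :: "'a::topological_space \<Rightarrow> real^'n^'n"
  shows "continuous_on S f \<Longrightarrow> continuous_on S (\<lambda>x. det (f x))"
  unfolding det_def by (intro continuous_intros)

lemma emeasure_image_wellorder:
  fixes g :: "real^'m::{finite,wellorder} \<Rightarrow> real^'m::_"
  assumes K: "compact K" and g: "\<And>x. x \<in> K \<Longrightarrow> (g has_derivative (\<lambda>h. H x *v h)) (at x)"
    and H: "continuous_on K H" and inj: "inj_on g K"
  shows "emeasure lebesgue (g ` K) = (\<integral>\<^sup>+x. ennreal \<bar>det (H x)\<bar> * indicator K x \<partial>lborel)"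
proof -
  have KL: "K \<in> sets lebesgue" using borel_compact[OF K] by simp
  have "continuous_on K (\<lambda>x. \<bar>det (H x)\<bar>)" using H by (intro continuous_intros)
  from borel_integrable_compact[OF K this]
  have "set_integrable lborel K (\<lambda>x. \<bar>det (H x)\<bar>)" by (simp add: set_integrable_def)
  then have i: "(\<lambda>x. \<bar>det (H x)\<bar>) integrable_on K" by (rule set_borel_integral_eq_integral)
  have "(g has_derivative (\<lambda>h. H x *v h)) (at x within K)" if "x \<in> K" for x
    using g[OF that] by (rule has_derivative_at_withinI)
  from has_measure_differentiable_image[OF KL this inj, of "integral K (\<lambda>x. \<bar>det (H x)\<bar>)"]
  have *: "g ` K \<in> lmeasurable" "measure lebesgue (g ` K) = integral K (\<lambda>x. \<bar>det (H x)\<bar>)"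
    using i by (auto intro: integrable_integral)
  have "(\<integral>\<^sup>+x. ennreal \<bar>det (H x)\<bar> * indicator K x \<partial>lborel) = ennreal (integral K (\<lambda>x. \<bar>det (H x)\<bar>))"
    by (rule nn_integral_has_integral_lebesgue') (use i in \<open>auto intro: integrable_integral\<close>)
  then show ?thesis using * by (simp add: emeasure_eq_measure2)
qed

text \<open>The formula is carried over from the index type \<open>'n idx\<close>: relabelling
  preserves Lebesgue measure and, being applied to arguments and values alike, leaves the Jacobian
  determinant unchanged.\<close>

proposition emeasure_differentiable_image:
  fixes g :: "real^'n \<Rightarrow> real^'n"
  assumes K: "compact K" and g: "\<And>x. x \<in> K \<Longrightarrow> (g has_derivative (\<lambda>h. H x *v h)) (at x)"
    and H: "continuous_on K H" and inj: "inj_on g K"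
  shows "emeasure lebesgue (g ` K) = (\<integral>\<^sup>+x. ennreal \<bar>det (H x)\<bar> * indicator K x \<partial>lborel)"
proof -
  obtain e :: "'n idx \<Rightarrow> 'n" where e: "bij e"
    using finite_same_card_bij[of "UNIV :: 'n idx set" "UNIV :: 'n set"] card_idx[where 'a='n] by auto
  define L where "L = permute_coords e"
  define L' where "L' = permute_coords (inv e)"
  have LL: "L' (L x) = x" "L (L' y) = y" for x y by (auto simp: L_def L'_def permute_coords_inv[OF e])
  have Lc: "continuous_on S L" "continuous_on S' L'" for S S'
    by (auto simp: L_def L'_def continuous_on_permute_coords)
  have Lm[measurable]: "L \<in> borel_measurable borel" using Lc(1) by (rule borel_measurable_continuous_onI)
  have bl: "bounded_linear L" "bounded_linear L'"
    using linear_permute_coords linear_conv_bounded_linear unfolding L_def L'_def by blast+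
  have dL: "distr lborel borel L = lborel" unfolding L_def by (rule lborel_distr_permute_coords[OF e])
  define H' where "H' y = (\<chi> i j. H (L' y) $ e i $ e j)" for y
  have H'v: "H' y *v h = L (H (L' y) *v L' h)" for y h
  proof -
    have "(\<Sum>j\<in>UNIV. H (L' y) $ e i $ e j * h $ j) = (\<Sum>k\<in>UNIV. H (L' y) $ e i $ k * h $ inv e k)" for i
      using sum.reindex_bij_betw[OF e, of "\<lambda>k. H (L' y) $ e i $ k * h $ inv e k"] e by (simp add: bij_def)
    then show ?thesis by (simp add: vec_eq_iff matrix_vector_mult_def H'_def L_def L'_def permute_coords_def)
  qed
  have cgK: "continuous_on K g"
    using g by (meson has_derivative_continuous continuous_at_imp_continuous_on)
  have cK': "compact (L ` K)" by (rule compact_continuous_image[OF Lc(1) K])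
  have cgK': "compact (g ` K)" by (rule compact_continuous_image[OF cgK K])
  have cLgK: "compact (L ` (g ` K))" by (rule compact_continuous_image[OF Lc(1) cgK'])
  have 1: "emeasure lebesgue ((L \<circ> g \<circ> L') ` (L ` K)) = (\<integral>\<^sup>+y. ennreal \<bar>det (H' y)\<bar> * indicator (L ` K) y \<partial>lborel)"
  proof (rule emeasure_image_wellorder[OF cK'])
    fix y assume "y \<in> L ` K"
    then have "L' y \<in> K" by (auto simp: LL)
    have "(L' has_derivative L') (at y)" by (rule bounded_linear_imp_has_derivative[OF bl(2)])
    moreover have "(g has_derivative (\<lambda>h. H (L' y) *v h)) (at (L' y))" by (rule g) fact
    moreover have "(L has_derivative L) (at (g (L' y)))" by (rule bounded_linear_imp_has_derivative[OF bl(1)])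
    ultimately have "((\<lambda>y. L (g (L' y))) has_derivative (\<lambda>h. L (H (L' y) *v (L' h)))) (at y)"
      using has_derivative_compose[of L' L' y UNIV g] has_derivative_compose[of "\<lambda>y. g (L' y)" _ y UNIV L] by blast
    then show "((L \<circ> g \<circ> L') has_derivative (\<lambda>h. H' y *v h)) (at y)" by (simp add: H'v o_def)
  next
    have "L' ` (L ` K) = K" by (auto simp: LL image_image)
    then have "continuous_on (L ` K) (\<lambda>y. H (L' y))"
      using continuous_on_compose2[OF H Lc(2)] by (metis order_refl)
    then show "continuous_on (L ` K) H'"
      unfolding H'_def by (intro continuous_intros)
  next
    show "inj_on (L \<circ> g \<circ> L') (L ` K)"
    proof (rule inj_onI)
      fix y z assume "y \<in> L ` K" "z \<in> L ` K" "(L \<circ> g \<circ> L') y = (L \<circ> g \<circ> L') z"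
      then have "L' y \<in> K" "L' z \<in> K" "g (L' y) = g (L' z)" by (auto simp: LL) (metis LL(1))
      then have "L' y = L' z" using inj by (auto simp: inj_on_def)
      then show "y = z" by (metis LL(2))
    qed
  qed
  have "(L \<circ> g \<circ> L') ` (L ` K) = L ` (g ` K)" by (auto simp: LL image_image)
  then have "emeasure lebesgue ((L \<circ> g \<circ> L') ` (L ` K)) = emeasure lborel (L ` (g ` K))"
    using borel_compact[OF cLgK] by simp
  also have "\<dots> = emeasure (distr lborel borel L) (L ` (g ` K))" by (simp add: dL)
  also have "\<dots> = emeasure lborel (L -` (L ` (g ` K)))"
    using borel_compact[OF cLgK] by (subst emeasure_distr) auto
  also have "L -` (L ` (g ` K)) = g ` K" by (auto simp: image_iff) (metis LL(1))
  also have "emeasure lborel (g ` K) = emeasure lebesgue (g ` K)" using borel_compact[OF cgK'] by simp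
  finally have 2: "emeasure lebesgue ((L \<circ> g \<circ> L') ` (L ` K)) = emeasure lebesgue (g ` K)" .
  have L'im: "L' ` (L ` K) = K" by (auto simp: LL image_image)
  then have "continuous_on (L ` K) (\<lambda>y. H (L' y))"
    using continuous_on_compose2[OF H Lc(2)] by (metis order_refl)
  then have cH': "continuous_on (L ` K) (\<lambda>y. \<bar>det (H' y)\<bar>)"
    unfolding H'_def by (intro continuous_intros)
  have "(\<integral>\<^sup>+y. ennreal \<bar>det (H' y)\<bar> * indicator (L ` K) y \<partial>lborel) = (\<integral>\<^sup>+y. ennreal (indicator (L ` K) y *\<^sub>R \<bar>det (H' y)\<bar>) \<partial>lborel)"
    by (intro nn_integral_cong) (auto simp: indicator_def)
  also have "\<dots> = (\<integral>\<^sup>+y. ennreal (indicator (L ` K) y *\<^sub>R \<bar>det (H' y)\<bar>) \<partial>distr lborel borel L)" by (simp add: dL)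
  also have "\<dots> = (\<integral>\<^sup>+x. ennreal (indicator (L ` K) (L x) *\<^sub>R \<bar>det (H' (L x))\<bar>) \<partial>lborel)"
    using borel_measurable_continuous_on_indicator[OF borel_compact[OF cK'] cH']
    by (subst nn_integral_distr) auto
  also have "\<dots> = (\<integral>\<^sup>+x. ennreal \<bar>det (H x)\<bar> * indicator K x \<partial>lborel)"
  proof (intro nn_integral_cong)
    fix x
    have "L x \<in> L ` K \<longleftrightarrow> x \<in> K" by (auto simp: image_iff) (metis LL(1))
    moreover have "det (H' (L x)) = det (H x)" by (simp add: H'_def LL det_reindex[OF e])
    ultimately show "ennreal (indicator (L ` K) (L x) *\<^sub>R \<bar>det (H' (L x))\<bar>) = ennreal \<bar>det (H x)\<bar> * indicator K x"
      by (auto simp: indicator_def)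
  qed
  finally show ?thesis using 1 2 by simp
qed

section \<open>Gradients and Hessians of convex functions\<close>

text \<open>On the segment from \<open>A\<close> to the identity the quadratic form stays positive
  on nonzero vectors, so no matrix there is singular and the determinant cannot change sign before
  it reaches 1.\<close>

lemma det_pos_if_posdef:
  fixes A :: "real^'n^'n"
  assumes pos: "\<And>h. h \<noteq> 0 \<Longrightarrow> 0 < h \<bullet> (A *v h)"
  shows "det A > 0"
proof (rule ccontr)
  assume "\<not> det A > 0"
  define d where "d t = det ((1 - t) *\<^sub>R A + t *\<^sub>R mat 1)" for t :: real
  have "\<exists>t\<ge>0. t \<le> 1 \<and> d t = 0"
  proof (rule IVT')
    show "d 0 \<le> 0" "0 \<le> d 1" using \<open>\<not> det A > 0\<close> by (auto simp: d_def)
    show "continuous_on {0..1} d" unfolding d_def by (intro continuous_intros)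
  qed simp
  then obtain t where t: "t \<ge> 0" "t \<le> 1" "d t = 0" by blast
  then obtain h where h: "h \<noteq> 0" "((1 - t) *\<^sub>R A + t *\<^sub>R mat 1) *v h = 0"
    unfolding d_def det_eq_0_rank using matrix_nonfull_linear_equations_eq by (metis less_irrefl)
  then have "0 = h \<bullet> (((1 - t) *\<^sub>R A + t *\<^sub>R mat 1) *v h)" by simp
  also have "\<dots> = (1 - t) * (h \<bullet> (A *v h)) + t * (h \<bullet> h)"
    by (simp add: matrix_vector_mult_add_rdistrib scaleR_matrix_vector_assoc[symmetric] inner_add_right)
  finally have eq: "(1 - t) * (h \<bullet> (A *v h)) + t * (h \<bullet> h) = 0" by simp
  have p: "h \<bullet> (A *v h) > 0" "h \<bullet> h > 0" using pos h(1) by auto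
  then have "(1 - t) * (h \<bullet> (A *v h)) \<ge> 0" "t * (h \<bullet> h) \<ge> 0" using t by auto
  then have "(1 - t) * (h \<bullet> (A *v h)) = 0" "t * (h \<bullet> h) = 0" using eq by linarith+
  then show False using p by auto
qed

text \<open>Convexity bounds the difference quotients towards \<open>y\<close> by
  \<open>g y - g x\<close>; letting the step tend to 0 gives the tangent inequality.\<close>

lemma gradient_contact:
  assumes U: "open U" and g: "convex_on U g" and x: "x \<in> U" and d: "(g has_derivative (\<lambda>h. D \<bullet> h)) (at x)"
  shows "x \<in> contact U g D"
  unfolding contact_def mem_Collect_eq
proof (intro conjI ballI x)
  fix y assume y: "y \<in> U"
  have "((\<lambda>t::real. g (x + t *\<^sub>R (y - x))) has_derivative (\<lambda>t. D \<bullet> (t *\<^sub>R (y - x)))) (at 0)"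
  proof -
    have "((\<lambda>t::real. x + t *\<^sub>R (y - x)) has_derivative (\<lambda>t. t *\<^sub>R (y - x))) (at 0)"
      by (auto intro!: derivative_eq_intros)
    moreover have "(g has_derivative (\<lambda>h. D \<bullet> h)) (at (x + (0::real) *\<^sub>R (y - x)))" using d by simp
    ultimately show ?thesis by (rule has_derivative_compose)
  qed
  then have "((\<lambda>t::real. g (x + t *\<^sub>R (y - x))) has_field_derivative (D \<bullet> (y - x))) (at 0)"
    unfolding has_field_derivative_def by (rule back_subst[of "\<lambda>f. (_ has_derivative f) _"]) auto
  then have "((\<lambda>t::real. (g (x + t *\<^sub>R (y - x)) - g x) / t) \<longlongrightarrow> D \<bullet> (y - x)) (at 0)"
    by (simp add: has_field_derivative_iff)
  then have l: "((\<lambda>t::real. (g (x + t *\<^sub>R (y - x)) - g x) / t) \<longlongrightarrow> D \<bullet> (y - x)) (at_right 0)"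
    by (rule filterlim_mono) (auto simp: at_within_le_at)
  have "eventually (\<lambda>t::real. (g (x + t *\<^sub>R (y - x)) - g x) / t \<le> g y - g x) (at_right 0)"
    using eventually_at_right_less[of 0] eventually_at_right_real[of 0 1, simplified]
  proof eventually_elim
    case (elim t)
    then have t: "0 < t" "t < 1" by auto
    have "g ((1 - t) *\<^sub>R x + t *\<^sub>R y) \<le> (1 - t) * g x + t * g y"
      using convex_onD[OF g, of t x y] t x y by auto
    moreover have "(1 - t) *\<^sub>R x + t *\<^sub>R y = x + t *\<^sub>R (y - x)" by (simp add: algebra_simps)
    ultimately have "g (x + t *\<^sub>R (y - x)) - g x \<le> t * (g y - g x)" by (simp add: algebra_simps)
    then show ?case using t by (simp add: field_simps)
  qed
  then have "D \<bullet> (y - x) \<le> g y - g x"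
    by (rule tendsto_upperbound[OF l]) simp
  then show "g x + D \<bullet> (y - x) \<le> g y" by simp
qed

lemma contact_gradient:
  assumes U: "open U" and x: "x \<in> contact U g p" and d: "(g has_derivative (\<lambda>h. D \<bullet> h)) (at x)"
  shows "p = D"
proof -
  have xU: "x \<in> U" using x contact_subset by blast
  have "((\<lambda>y. g y - p \<bullet> y) has_derivative (\<lambda>h. D \<bullet> h - p \<bullet> h)) (at x)"
    by (auto intro!: derivative_eq_intros d)
  moreover have "eventually (\<lambda>y. g x - p \<bullet> x \<le> g y - p \<bullet> y) (at x)"
  proof -
    have "eventually (\<lambda>y. y \<in> U) (at x)" using U xU by (rule eventually_at_in_open')
    then show ?thesis by eventually_elim (use x in \<open>force simp: contact_def inner_diff_right\<close>)
  qed
  ultimately have "(\<lambda>h. D \<bullet> h - p \<bullet> h) = (\<lambda>h. 0)" by (rule has_derivative_local_min)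
  then have "(D - p) \<bullet> (D - p) = 0" by (simp add: fun_eq_iff inner_diff_left)
  then show ?thesis by simp
qed

text \<open>The gradient is monotone, so its difference quotients in direction \<open>h\<close>,
  paired with \<open>h\<close>, are nonnegative.\<close>

lemma C2_hess_psd:
  assumes U: "open U" and g: "C2_hess U g H" and x: "x \<in> U"
  shows "0 \<le> h \<bullet> (H x *v h)"
proof -
  obtain Dg where conv: "convex_on U g" and Dg: "\<And>x. x \<in> U \<Longrightarrow> (g has_derivative (\<lambda>h. Dg x \<bullet> h)) (at x)"
    "\<And>x. x \<in> U \<Longrightarrow> (Dg has_derivative (\<lambda>h. H x *v h)) (at x)"
    using g by (auto simp: C2_hess_def)
  have "((\<lambda>t::real. Dg (x + t *\<^sub>R h) \<bullet> h) has_derivative (\<lambda>t. (H x *v (t *\<^sub>R h)) \<bullet> h)) (at 0)"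
  proof -
    have "((\<lambda>t::real. x + t *\<^sub>R h) has_derivative (\<lambda>t. t *\<^sub>R h)) (at 0)"
      by (auto intro!: derivative_eq_intros)
    moreover have "(Dg has_derivative (\<lambda>h. H x *v h)) (at (x + (0::real) *\<^sub>R h))" using Dg(2)[OF x] by simp
    ultimately have "((\<lambda>t::real. Dg (x + t *\<^sub>R h)) has_derivative (\<lambda>t. H x *v (t *\<^sub>R h))) (at 0)"
      by (rule has_derivative_compose)
    then show ?thesis by (rule has_derivative_inner_left)
  qed
  then have "((\<lambda>t::real. Dg (x + t *\<^sub>R h) \<bullet> h) has_field_derivative ((H x *v h) \<bullet> h)) (at 0)"
    unfolding has_field_derivative_def
    by (rule back_subst[of "\<lambda>f. (_ has_derivative f) _"]) (auto simp: matrix_vector_mult_scaleR)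
  then have "((\<lambda>t::real. (Dg (x + t *\<^sub>R h) \<bullet> h - Dg x \<bullet> h) / t) \<longlongrightarrow> (H x *v h) \<bullet> h) (at 0)"
    by (simp add: has_field_derivative_iff)
  then have l: "((\<lambda>t::real. (Dg (x + t *\<^sub>R h) \<bullet> h - Dg x \<bullet> h) / t) \<longlongrightarrow> (H x *v h) \<bullet> h) (at_right 0)"
    by (rule filterlim_mono) (auto simp: at_within_le_at)
  have "((\<lambda>t::real. x + t *\<^sub>R h) \<longlongrightarrow> x + 0 *\<^sub>R h) (at_right 0)" by (intro tendsto_intros)
  then have "eventually (\<lambda>t::real. x + t *\<^sub>R h \<in> U) (at_right 0)"
    using U x by (simp add: topological_tendstoD)
  then have "eventually (\<lambda>t::real. 0 \<le> (Dg (x + t *\<^sub>R h) \<bullet> h - Dg x \<bullet> h) / t) (at_right 0)"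
    using eventually_at_right_less[of 0]
  proof eventually_elim
    case (elim t)
    have "0 \<le> (Dg (x + t *\<^sub>R h) - Dg x) \<bullet> ((x + t *\<^sub>R h) - x)"
      by (rule contact_monotone[OF gradient_contact gradient_contact]) (use U conv elim x Dg in auto)
    then have "0 \<le> t * (Dg (x + t *\<^sub>R h) \<bullet> h - Dg x \<bullet> h)" by (simp add: inner_diff_left)
    then show ?case using elim by (simp add: zero_le_mult_iff)
  qed
  then have "0 \<le> (H x *v h) \<bullet> h" by (rule tendsto_lowerbound[OF l]) simp
  then show ?thesis by (simp add: inner_commute)
qed

text \<open>Closed sets form an intersection-stable generator; inside \<open>U\<close> they are
  exhausted by compact sets, and off \<open>U\<close> both measures vanish. Adding
  \<open>- U\<close> to the exhausting compact sets makes them cover the space without changing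
  their finite measure.\<close>

lemma lfm_eqI_compact:
  assumes U: "open U" and M: "lfm U M" and N: "lfm U N"
    and eq: "\<And>K. compact K \<Longrightarrow> K \<subseteq> U \<Longrightarrow> emeasure M K = emeasure N K"
  shows "M = N"
proof -
  obtain C where C: "\<And>n. compact (C n)" "\<And>n. C n \<subseteq> U" "\<And>n. C n \<subseteq> interior (C (Suc n))" "\<Union>(range C) = U"
    using open_Union_compact_subsets[OF U] by metis
  have off: "emeasure P (A \<union> -U) = emeasure P A" if "lfm U P" "A \<in> sets borel" for P A
  proof (rule antisym)
    have s: "sets P = sets borel" "emeasure P (-U) = 0" using that by (auto simp: lfm_def)
    have "emeasure P (A \<union> -U) \<le> emeasure P A + emeasure P (-U)"
      using that(2) U s by (intro emeasure_subadditive) auto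
    then show "emeasure P (A \<union> -U) \<le> emeasure P A" using s by simp
    show "emeasure P A \<le> emeasure P (A \<union> -U)" using that(2) U s by (intro emeasure_mono) auto
  qed
  have cl: "emeasure P A = (SUP n. emeasure P (A \<inter> C n))" if P: "lfm U P" and A: "closed A" for P A
  proof -
    have s: "sets P = sets borel" using P by (auto simp: lfm_def)
    have "emeasure P A = emeasure P ((A \<inter> U) \<union> -U)"
      using off[OF P, of A] off[OF P, of "A \<inter> U"] A U by (metis Un_Int_distrib2 borel_closed borel_open compl_sup_top sup_commute inf_top_right sets.Int sup_compl_top)
    also have "\<dots> = emeasure P (A \<inter> U)" using off[OF P, of "A \<inter> U"] A U by auto
    also have "A \<inter> U = (\<Union>n. A \<inter> C n)" using C(4) by blast
    also have "emeasure P (\<Union>n. A \<inter> C n) = (SUP n. emeasure P (A \<inter> C n))"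
    proof (rule SUP_emeasure_incseq[symmetric])
      show "range (\<lambda>n. A \<inter> C n) \<subseteq> sets P" using A borel_compact[OF C(1)] s by auto
      show "incseq (\<lambda>n. A \<inter> C n)" using C(3) interior_subset by (intro incseq_SucI) blast
    qed
    finally show ?thesis .
  qed
  show ?thesis
  proof (rule measure_eqI_generator_eq[of "Collect closed" UNIV])
    show "Int_stable (Collect closed :: (real^'a) set set)" by (auto simp: Int_stable_def)
    show "sets M = sigma_sets UNIV (Collect closed)" "sets N = sigma_sets UNIV (Collect closed)"
      using M N by (auto simp: lfm_def borel_eq_closed)
    show "emeasure M A = emeasure N A" if "A \<in> Collect closed" for A
    proof -
      have "emeasure M (A \<inter> C n) = emeasure N (A \<inter> C n)" for n
        using that C(1,2) by (intro eq) (auto intro: closed_Int_compact)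
      then show ?thesis using cl[OF M] cl[OF N] that by simp
    qed
    show "range (\<lambda>n. C n \<union> -U) \<subseteq> Collect closed" using C(1) U by (auto intro: compact_imp_closed)
    show "(\<Union>n. C n \<union> -U) = UNIV" using C(4) by auto
    show "emeasure M (C n \<union> -U) \<noteq> \<infinity>" for n
      using off[OF M borel_compact[OF C(1)], of n] lfm_compact[OF M C(1,2), of n] by auto
  qed auto
qed

lemma emeasure_hess_measure:
  assumes U: "open U" and H: "continuous_on U H" and K: "K \<in> sets borel" "K \<subseteq> U" 
  shows "emeasure (hess_measure U H) K = (\<integral>\<^sup>+x. ennreal (det (H x)) * indicator K x \<partial>lborel)"
proof -
  have m: "(\<lambda>x. indicator U x *\<^sub>R det (H x)) \<in> borel_measurable borel"
    using U H by (intro borel_measurable_continuous_on_indicator continuous_intros) auto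
  have "emeasure (hess_measure U H) K = (\<integral>\<^sup>+x. ennreal (indicator U x * det (H x)) * indicator K x \<partial>lborel)"
    unfolding hess_measure_def using m K by (subst emeasure_density) auto
  also have "\<dots> = (\<integral>\<^sup>+x. ennreal (det (H x)) * indicator K x \<partial>lborel)"
    using K(2) by (intro nn_integral_cong) (auto simp: indicator_def)
  finally show ?thesis .
qed

lemma lfm_hess_measure:
  assumes U: "open U" and H: "continuous_on U H"
  shows "lfm U (hess_measure U H)"
  unfolding lfm_def
proof (intro conjI allI impI)
  show "sets (hess_measure U H) = sets borel" by (simp add: hess_measure_def)
  have m: "(\<lambda>x. indicator U x *\<^sub>R det (H x)) \<in> borel_measurable borel"
    using U H by (intro borel_measurable_continuous_on_indicator continuous_intros) auto
  have "emeasure (hess_measure U H) (-U) = (\<integral>\<^sup>+x. ennreal (indicator U x * det (H x)) * indicator (-U) x \<partial>lborel)"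
    unfolding hess_measure_def using m U by (subst emeasure_density) auto
  also have "\<dots> = (\<integral>\<^sup>+x. 0 \<partial>(lborel :: (real^'a) measure))"
    by (intro nn_integral_cong) (auto simp: indicator_def)
  finally show "emeasure (hess_measure U H) (-U) = 0" by simp
  fix K assume K: "compact K \<and> K \<subseteq> U"
  \<comment> \<open>\<open>ennreal\<close> truncates negative densities, so the positive part of the
    determinant is the function to integrate.\<close>
  have "continuous_on K (\<lambda>x. max 0 (det (H x)))" 
    using H K by (intro continuous_intros continuous_on_subset[OF H]) auto
  then have i: "integrable lborel (\<lambda>x. indicator K x *\<^sub>R max 0 (det (H x)))"
    using K by (intro borel_integrable_compact) auto
  have "emeasure (hess_measure U H) K = (\<integral>\<^sup>+x. ennreal (indicator K x *\<^sub>R max 0 (det (H x))) \<partial>lborel)"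
    using K borel_compact[of K] emeasure_hess_measure[OF U H, of K]
    by (auto intro!: nn_integral_cong simp: indicator_def ennreal_max_0)
  also have "\<dots> < \<infinity>"
    using i by (subst nn_integral_eq_integral) (auto simp: indicator_def)
  finally show "emeasure (hess_measure U H) K < \<infinity>" .
qed

text \<open>The quadratic term makes the gradient injective with positive Jacobian determinant. Each
  slope then has at most one contact point, \<open>hit\<close> becomes the image under the gradient,
  and the change of variables formula computes its volume.\<close>

lemma C2_hess_add_square:
  assumes U: "open U" and g: "C2_hess U g H" and e: "e > 0"
  shows "subdiff_measure U (\<lambda>x. g x + e * (x \<bullet> x)) = hess_measure U (\<lambda>x. H x + (2 * e) *\<^sub>R mat 1)" (is "_ = hess_measure U ?H")
    and "convex_on U (\<lambda>x. g x + e * (x \<bullet> x))"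
    and "\<And>x. x \<in> U \<Longrightarrow> 0 < det (H x + (2 * e) *\<^sub>R mat 1)"
proof -
  obtain Dg where conv: "convex_on U g" and Hc: "continuous_on U H" and Dg: "\<And>x. x \<in> U \<Longrightarrow> (g has_derivative (\<lambda>h. Dg x \<bullet> h)) (at x)"
    "\<And>x. x \<in> U \<Longrightarrow> (Dg has_derivative (\<lambda>h. H x *v h)) (at x)"
    using g by (auto simp: C2_hess_def)
  let ?g = "\<lambda>x. g x + e * (x \<bullet> x)"
  define D where "D x = Dg x + (2 * e) *\<^sub>R x" for x
  have D1: "(?g has_derivative (\<lambda>h. D x \<bullet> h)) (at x)" if "x \<in> U" for x
    using Dg(1)[OF that] by (auto intro!: derivative_eq_intros simp: D_def inner_add_left inner_commute algebra_simps)
  have D2: "(D has_derivative (\<lambda>h. ?H x *v h)) (at x)" if "x \<in> U" for x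
    unfolding D_def using Dg(2)[OF that]
    by (auto intro!: derivative_eq_intros simp: matrix_vector_mult_add_rdistrib scaleR_matrix_vector_assoc[symmetric])
  show cv: "convex_on U ?g"
  proof (rule convex_onI)
    fix t :: real and x y assume *: "t > 0" "t < 1" "x \<in> U" "y \<in> U"
    have 1: "g ((1 - t) *\<^sub>R x + t *\<^sub>R y) \<le> (1 - t) * g x + t * g y"
      using convex_onD[OF conv, of t x y] * by auto
    have "(1 - t) * (x \<bullet> x) + t * (y \<bullet> y) - ((1 - t) *\<^sub>R x + t *\<^sub>R y) \<bullet> ((1 - t) *\<^sub>R x + t *\<^sub>R y) = t * (1 - t) * ((x - y) \<bullet> (x - y))"
      by (simp add: inner_add_left inner_add_right inner_diff_left inner_diff_right inner_commute algebra_simps)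
    also have "\<dots> \<ge> 0" using * by auto
    finally have "((1 - t) *\<^sub>R x + t *\<^sub>R y) \<bullet> ((1 - t) *\<^sub>R x + t *\<^sub>R y) \<le> (1 - t) * (x \<bullet> x) + t * (y \<bullet> y)" by simp
    from mult_left_mono[OF this, of e] e 1
    show "g ((1 - t) *\<^sub>R x + t *\<^sub>R y) + e * (((1 - t) *\<^sub>R x + t *\<^sub>R y) \<bullet> ((1 - t) *\<^sub>R x + t *\<^sub>R y))
       \<le> (1 - t) * (g x + e * (x \<bullet> x)) + t * (g y + e * (y \<bullet> y))"
      by (simp add: algebra_simps)
  qed (use conv in \<open>simp add: convex_on_def\<close>)
  show dp: "0 < det (?H x)" if "x \<in> U" for x
  proof (rule det_pos_if_posdef)
    fix h :: "real^'a" assume "h \<noteq> 0"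
    have "h \<bullet> (?H x *v h) = h \<bullet> (H x *v h) + 2 * e * (h \<bullet> h)"
      by (simp add: matrix_vector_mult_add_rdistrib scaleR_matrix_vector_assoc[symmetric] inner_add_right)
    then show "0 < h \<bullet> (?H x *v h)" using C2_hess_psd[OF U g that, of h] e \<open>h \<noteq> 0\<close> by (simp add: add_nonneg_pos)
  qed
  \<comment> \<open>Monotonicity of the gradient of \<open>g\<close> together with the summand
    \<open>(2 * e) *\<^sub>R x\<close> makes \<open>D\<close> strictly monotone.\<close>
  have inj: "inj_on D U"
  proof (rule inj_onI)
    fix x y assume *: "x \<in> U" "y \<in> U" "D x = D y"
    have "0 \<le> (Dg x - Dg y) \<bullet> (x - y)"
      by (rule contact_monotone[OF gradient_contact gradient_contact]) (use U conv * Dg in auto)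
    moreover have "Dg x - Dg y = (2 * e) *\<^sub>R (y - x)" using *(3) by (simp add: D_def algebra_simps)
    ultimately have "0 \<le> 2 * e * ((y - x) \<bullet> (x - y))" by simp
    then have "0 \<le> (y - x) \<bullet> (x - y)" using e by (simp add: zero_le_mult_iff)
    moreover have "(y - x) \<bullet> (x - y) = - ((x - y) \<bullet> (x - y))" by (simp add: inner_diff_left inner_diff_right)
    ultimately have "(x - y) \<bullet> (x - y) = 0" using inner_ge_zero[of "x - y"] by linarith
    then show "x = y" by simp
  qed
  have cont: "x \<in> contact U ?g p \<longleftrightarrow> x \<in> U \<and> p = D x" for x p
    using contact_subset[of x U ?g p] contact_gradient[OF U _ D1] gradient_contact[OF U cv _ D1] by blast
  have nu: "nonunique U ?g = {}" using inj by (auto simp: nonunique_def cont inj_on_def)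
  have cg: "continuous_on U ?g" by (rule convex_on_continuous[OF U cv])
  have Hc': "continuous_on U ?H" using Hc by (intro continuous_intros)
  show "subdiff_measure U ?g = hess_measure U ?H"
  proof (rule lfm_eqI_compact[OF U lfm_subdiff_measure[OF U cg] lfm_hess_measure[OF U Hc']])
    fix K assume K: "compact K" "K \<subseteq> U"
    then have KU: "K \<inter> U = K" by auto
    have "emeasure (subdiff_measure U ?g) K = emeasure lebesgue (hit U ?g K)"
      by (simp add: emeasure_subdiff_measure[OF U cg borel_compact[OF K(1)]] nu KU)
    also have "hit U ?g K = D ` K" using K(2) by (auto simp: hit_def cont)
    also have "emeasure lebesgue (D ` K) = (\<integral>\<^sup>+x. ennreal \<bar>det (?H x)\<bar> * indicator K x \<partial>lborel)"
      using K D2 inj Hc' by (intro emeasure_differentiable_image) (auto intro: inj_on_subset continuous_on_subset)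
    also have "\<dots> = (\<integral>\<^sup>+x. ennreal (det (?H x)) * indicator K x \<partial>lborel)"
      using dp K(2) by (intro nn_integral_cong) (force simp: indicator_def)
    also have "\<dots> = emeasure (hess_measure U ?H) K"
      using emeasure_hess_measure[OF U Hc' borel_compact[OF K(1)] K(2)] by simp
    finally show "emeasure (subdiff_measure U ?g) K = emeasure (hess_measure U ?H) K" .
  qed
qed

lemma integral_hess_measure:
  assumes U: "open U" and H: "continuous_on U H" and pos: "\<And>x. x \<in> U \<Longrightarrow> 0 \<le> det (H x)" and \<phi>: "Cc U \<phi>"
  shows "integral\<^sup>L (hess_measure U H) \<phi> = (\<integral>x. (indicator U x * det (H x)) *\<^sub>R \<phi> x \<partial>lborel)"
  unfolding hess_measure_def
proof (rule integral_density)
  show "\<phi> \<in> borel_measurable lborel" using Cc_borel[OF \<phi>] by simp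
  have "(\<lambda>x. indicator U x *\<^sub>R det (H x)) \<in> borel_measurable borel"
    using U H by (intro borel_measurable_continuous_on_indicator continuous_intros) auto
  then show "(\<lambda>x. indicat_real U x * det (H x)) \<in> borel_measurable lborel" by simp
  show "AE x in lborel. 0 \<le> indicat_real U x * det (H x)" using pos by (auto simp: indicator_def)
qed

lemma det_C2_hess_nonneg:
  assumes U: "open U" and g: "C2_hess U g H" and x: "x \<in> U"
  shows "0 \<le> det (H x)"
proof -
  have "((\<lambda>e::real. det (H x + (2 * e) *\<^sub>R mat 1)) \<longlongrightarrow> det (H x + (2 * 0) *\<^sub>R mat 1)) (at_right 0)"
  proof -
    have "continuous_on UNIV (\<lambda>e::real. det (H x + (2 * e) *\<^sub>R mat 1))" by (intro continuous_intros)
    then have "isCont (\<lambda>e::real. det (H x + (2 * e) *\<^sub>R mat 1)) 0" by (simp add: continuous_on_eq_continuous_at)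
    then show ?thesis unfolding isCont_def by (rule filterlim_mono) (auto simp: at_within_le_at)
  qed
  then have "((\<lambda>e::real. det (H x + (2 * e) *\<^sub>R mat 1)) \<longlongrightarrow> det (H x)) (at_right 0)" by simp
  moreover have "eventually (\<lambda>e::real. 0 \<le> det (H x + (2 * e) *\<^sub>R mat 1)) (at_right 0)"
    using eventually_at_right_less[of 0] by eventually_elim (use C2_hess_add_square(3)[OF U g _ x] less_imp_le in blast)
  ultimately show ?thesis by (rule tendsto_lowerbound) simp
qed

text \<open>The identity for \<open>g\<close> plus a small multiple of the squared norm survives the
  limit: the left side by dominated convergence of the determinants, the right side by weak
  continuity of the subdifferential measure.\<close>

proposition integral_hess_eq_subdiff:
  assumes U: "open U" and g: "C2_hess U g H" and \<phi>: "Cc U \<phi>"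
  shows "integral\<^sup>L (hess_measure U H) \<phi> = integral\<^sup>L (subdiff_measure U g) \<phi>"
proof -
  have conv: "convex_on U g" and Hc: "continuous_on U H" using g by (auto simp: C2_hess_def)
  obtain K where K: "compact K" "K \<subseteq> U" "\<And>x. x \<notin> K \<Longrightarrow> \<phi> x = 0" and \<phi>c: "continuous_on U \<phi>"
    using \<phi> by (auto simp: Cc_def)
  define e where "e k = inverse (real (Suc k))" for k
  have e: "e k > 0" "e k \<le> 1" for k by (auto simp: e_def inverse_le_1_iff)
  have e0: "e \<longlonglongrightarrow> 0" unfolding e_def by (rule LIMSEQ_inverse_real_of_nat)
  define g' where "g' k x = g x + e k * (x \<bullet> x)" for k x
  define H' where "H' k x = H x + (2 * e k) *\<^sub>R mat 1" for k x
  have sub: "subdiff_measure U (g' k) = hess_measure U (H' k)" and cv: "convex_on U (g' k)"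
    and dp: "\<And>x. x \<in> U \<Longrightarrow> 0 < det (H' k x)" for k
    using C2_hess_add_square[OF U g e(1)] unfolding g'_def H'_def by blast+
  have H'c: "continuous_on U (H' k)" for k unfolding H'_def using Hc by (intro continuous_intros)
  have lim: "conv_lim U g' g sequentially"
    unfolding conv_lim_def
  proof (intro allI impI)
    fix L :: "(real^'a) set" and r :: real assume L: "compact L \<and> L \<subseteq> U" and r: "r > 0"
    then have "bounded L" by (simp add: compact_imp_bounded)
    then obtain B where B: "\<And>x. x \<in> L \<Longrightarrow> norm x \<le> B" by (auto simp: bounded_iff)
    have "(\<lambda>k. e k * (B\<^sup>2 + 1)) \<longlonglongrightarrow> 0 * (B\<^sup>2 + 1)" by (intro tendsto_intros e0)
    then have "eventually (\<lambda>k. e k * (B\<^sup>2 + 1) < r) sequentially" using order_tendstoD(2)[of _ "0 * (B\<^sup>2 + 1)" _ r] r by simp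
    then show "eventually (\<lambda>k. \<forall>x\<in>L. \<bar>g' k x - g x\<bar> < r) sequentially"
    proof eventually_elim
      case (elim k)
      show ?case
      proof
        fix x assume "x \<in> L"
        then have "(norm x)\<^sup>2 \<le> B\<^sup>2" using B[of x] by (intro power_mono) auto
        then have "x \<bullet> x \<le> B\<^sup>2 + 1" by (simp add: dot_square_norm)
        then have "e k * (x \<bullet> x) \<le> e k * (B\<^sup>2 + 1)" using e(1)[of k] by (intro mult_left_mono) auto
        then have "e k * (x \<bullet> x) < r" using elim by (rule le_less_trans)
        then show "\<bar>g' k x - g x\<bar> < r" using e(1)[of k] by (simp add: g'_def)
      qed
    qed
  qed
  have 1: "(\<lambda>k. integral\<^sup>L (hess_measure U (H' k)) \<phi>) \<longlonglongrightarrow> integral\<^sup>L (subdiff_measure U g) \<phi>"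
    using subdiff_measure_weak_continuous[OF U conv cv lim \<phi>] by (simp add: sub)
  \<comment> \<open>Continuity on the compact product \<open>K \<times> {0..1}\<close> bounds the
    determinants uniformly in the perturbation.\<close>
  define F where "F = (\<lambda>z::(real^'a) \<times> real. det (H (fst z) + (2 * snd z) *\<^sub>R mat 1))"
  have "continuous_on (K \<times> {0..1}) F"
    unfolding F_def by (intro continuous_intros continuous_on_compose2[OF Hc]) (use K(2) in auto)
  then have "compact (F ` (K \<times> {0..1}))"
    using K(1) by (intro compact_continuous_image compact_Times) auto
  then have "bounded (F ` (K \<times> {0..1}))" by (rule compact_imp_bounded)
  then obtain B where B: "\<And>z. z \<in> K \<times> {0..1} \<Longrightarrow> \<bar>F z\<bar> \<le> B" by (auto simp: bounded_iff)
  have \<phi>i: "integrable lborel \<phi>"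
  proof -
    have "integrable lborel (\<lambda>x. indicator K x *\<^sub>R \<phi> x)"
      using K by (intro borel_integrable_compact continuous_on_subset[OF \<phi>c]) auto
    moreover have "(\<lambda>x. indicator K x *\<^sub>R \<phi> x) = \<phi>" using K(3) by (auto simp: indicator_def fun_eq_iff)
    ultimately show ?thesis by simp
  qed
  have m: "(\<lambda>x. (indicat_real U x * det (J x)) *\<^sub>R \<phi> x) \<in> borel_measurable lborel" if "continuous_on U J" for J :: "real^'a \<Rightarrow> real^'a^'a"
  proof -
    have "(\<lambda>x. indicator U x *\<^sub>R det (J x)) \<in> borel_measurable borel"
      using U that by (intro borel_measurable_continuous_on_indicator continuous_intros) auto
    then have "(\<lambda>x. indicator U x * det (J x)) \<in> borel_measurable borel" by simp
    from borel_measurable_scaleR[OF this Cc_borel[OF \<phi>]] show ?thesis by simp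
  qed
  have 2: "(\<lambda>k. \<integral>x. (indicator U x * det (H' k x)) *\<^sub>R \<phi> x \<partial>lborel) \<longlonglongrightarrow> (\<integral>x. (indicator U x * det (H x)) *\<^sub>R \<phi> x \<partial>lborel)"
  proof (rule integral_dominated_convergence[where w = "\<lambda>x. \<bar>B\<bar> * norm (\<phi> x)"])
    show "integrable lborel (\<lambda>x. \<bar>B\<bar> * norm (\<phi> x))" using \<phi>i by auto
    show "AE x in lborel. (\<lambda>k. (indicator U x * det (H' k x)) *\<^sub>R \<phi> x) \<longlonglongrightarrow> (indicator U x * det (H x)) *\<^sub>R \<phi> x"
    proof (rule AE_I2)
      fix x
      have "continuous_on UNIV (\<lambda>e::real. det (H x + (2 * e) *\<^sub>R mat 1))" by (intro continuous_intros)
      then have "isCont (\<lambda>e::real. det (H x + (2 * e) *\<^sub>R mat 1)) 0" by (simp add: continuous_on_eq_continuous_at)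
      from isCont_tendsto_compose[OF this e0]
      have "(\<lambda>k. det (H' k x)) \<longlonglongrightarrow> det (H x)" by (simp add: H'_def)
      then show "(\<lambda>k. (indicator U x * det (H' k x)) *\<^sub>R \<phi> x) \<longlonglongrightarrow> (indicator U x * det (H x)) *\<^sub>R \<phi> x"
        by (intro tendsto_intros)
    qed
    show "AE x in lborel. norm ((indicator U x * det (H' k x)) *\<^sub>R \<phi> x) \<le> \<bar>B\<bar> * norm (\<phi> x)" for k
    proof (rule AE_I2)
      fix x
      show "norm ((indicator U x * det (H' k x)) *\<^sub>R \<phi> x) \<le> \<bar>B\<bar> * norm (\<phi> x)"
      proof (cases "x \<in> K")
        case True
        then have "\<bar>det (H' k x)\<bar> \<le> B" using B[of "(x, e k)"] e[of k] by (auto simp: F_def H'_def)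
        then have "\<bar>indicator U x * det (H' k x)\<bar> \<le> \<bar>B\<bar>" by (auto simp: indicator_def)
        then show ?thesis by (simp add: mult_right_mono)
      qed (use K(3) in auto)
    qed
  qed (use m Hc H'c in auto)
  have "(\<lambda>k. integral\<^sup>L (hess_measure U (H' k)) \<phi>) \<longlonglongrightarrow> integral\<^sup>L (hess_measure U H) \<phi>"
  proof -
    have "integral\<^sup>L (hess_measure U H) \<phi> = (\<integral>x. (indicator U x * det (H x)) *\<^sub>R \<phi> x \<partial>lborel)"
      by (rule integral_hess_measure[OF U Hc _ \<phi>]) (rule det_C2_hess_nonneg[OF U g])
    moreover have "integral\<^sup>L (hess_measure U (H' k)) \<phi> = (\<integral>x. (indicator U x * det (H' k x)) *\<^sub>R \<phi> x \<partial>lborel)" for k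
      by (rule integral_hess_measure[OF U H'c _ \<phi>]) (rule less_imp_le[OF dp])
    ultimately show ?thesis using 2 by simp
  qed
  from LIMSEQ_unique[OF this 1] show ?thesis .
qed

text \<open>The subdifferential measure meets the condition under \<open>SOME\<close> for every
  approximating sequence, so the choice in \<open>MA\<close> succeeds. One such sequence makes that
  condition fix the integrals of all test functions, hence the chosen measure.\<close>

theorem MA_eq_subdiff_measure:
  assumes U: "open U" and f: "convex_on U f"
    and ex: "\<And>k::nat. C2_hess U (fs k) (Hs k)" "conv_lim U fs f sequentially"
  shows "MA U f = subdiff_measure U f"
proof -
  let ?P = "\<lambda>\<mu>. lfm U \<mu> \<and>
     (\<forall>fs Hs. (\<forall>k::nat. C2_hess U (fs k) (Hs k)) \<longrightarrow> conv_lim U fs f sequentially \<longrightarrow>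
        (\<forall>\<phi>. Cc U \<phi> \<longrightarrow>
           (\<lambda>k. integral\<^sup>L (hess_measure U (Hs k)) \<phi>) \<longlonglongrightarrow> integral\<^sup>L \<mu> \<phi>))"
  have fc: "continuous_on U f" by (rule convex_on_continuous[OF U f])
  have P: "?P (subdiff_measure U f)"
  proof (intro conjI allI impI lfm_subdiff_measure[OF U fc])
    fix fs :: "nat \<Rightarrow> real^'a \<Rightarrow> real" and Hs \<phi>
    assume C: "\<forall>k. C2_hess U (fs k) (Hs k)" and l: "conv_lim U fs f sequentially" and \<phi>: "Cc U \<phi>"
    have "\<And>k. convex_on U (fs k)" using C by (auto simp: C2_hess_def)
    from subdiff_measure_weak_continuous[OF U f this l \<phi>]
    show "(\<lambda>k. integral\<^sup>L (hess_measure U (Hs k)) \<phi>) \<longlonglongrightarrow> integral\<^sup>L (subdiff_measure U f) \<phi>"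
      by (simp add: integral_hess_eq_subdiff[OF U C[rule_format] \<phi>])
  qed
  then have "?P (MA U f)" unfolding MA_def by (rule someI)
  then have M: "lfm U (MA U f)" "\<And>\<phi>. Cc U \<phi> \<Longrightarrow> (\<lambda>k. integral\<^sup>L (hess_measure U (Hs k)) \<phi>) \<longlonglongrightarrow> integral\<^sup>L (MA U f) \<phi>"
    using ex by blast+
  show ?thesis
  proof (rule lfm_eqI[OF U M(1) lfm_subdiff_measure[OF U fc]])
    fix \<phi> assume \<phi>: "Cc U \<phi>"
    have "(\<lambda>k. integral\<^sup>L (hess_measure U (Hs k)) \<phi>) \<longlonglongrightarrow> integral\<^sup>L (subdiff_measure U f) \<phi>"
      using P ex \<phi> by blast
    from LIMSEQ_unique[OF M(2)[OF \<phi>] this] show "integral\<^sup>L (MA U f) \<phi> = integral\<^sup>L (subdiff_measure U f) \<phi>" .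
  qed
qed

section \<open>Maxima of affine functions\<close>

definition maxaff :: "((real^'n) \<times> real) set \<Rightarrow> real^'n \<Rightarrow> real" where
  "maxaff A x = Max ((\<lambda>p. fst p \<bullet> x + snd p) ` A)"

definition active :: "((real^'n) \<times> real) set \<Rightarrow> real^'n \<Rightarrow> ((real^'n) \<times> real) set" where
  "active A x = {p\<in>A. fst p \<bullet> x + snd p = maxaff A x}"

text \<open>The subdifferential of the maximum at \<open>x\<close>.\<close>

definition cell :: "((real^'n) \<times> real) set \<Rightarrow> real^'n \<Rightarrow> (real^'n) set" where
  "cell A x = convex hull (fst ` active A x)"

definition in_hyperplane :: "(real^'n) set \<Rightarrow> bool" where
  "in_hyperplane S \<longleftrightarrow> (\<exists>a \<beta>. a \<noteq> 0 \<and> (\<forall>s\<in>S. a \<bullet> s = \<beta>))"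

text \<open>The points with a full-dimensional subdifferential. Elsewhere it is flat and has neither
  volume nor, by dual simplicity, a contribution to \<open>\<Psi>\<close>.\<close>

definition vertices :: "((real^'n) \<times> real) set \<Rightarrow> (real^'n) set" where
  "vertices A = {x. \<not> in_hyperplane (fst ` active A x)}"

definition supp :: "(real^'n) set \<Rightarrow> real^'n \<Rightarrow> real" where
  "supp P y = (SUP p\<in>P. p \<bullet> y)"

lemma maxaff_ge: "finite A \<Longrightarrow> p \<in> A \<Longrightarrow> fst p \<bullet> x + snd p \<le> maxaff A x"
  unfolding maxaff_def by (rule Max_ge) auto

lemma maxaff_attained:
  assumes "finite A" "A \<noteq> {}"
  obtains p where "p \<in> A" "maxaff A x = fst p \<bullet> x + snd p"
proof -
  have "maxaff A x \<in> (\<lambda>p. fst p \<bullet> x + snd p) ` A" unfolding maxaff_def using assms by (intro Max_in) auto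
  then show ?thesis using that by auto
qed

lemma maxaff_le_iff: "finite A \<Longrightarrow> A \<noteq> {} \<Longrightarrow> maxaff A x \<le> c \<longleftrightarrow> (\<forall>p\<in>A. fst p \<bullet> x + snd p \<le> c)"
  unfolding maxaff_def by (subst Max_le_iff) auto

lemma active_nonempty: "finite A \<Longrightarrow> A \<noteq> {} \<Longrightarrow> active A x \<noteq> {}"
  using maxaff_attained[of A x] unfolding active_def by (metis (mono_tags, lifting) empty_iff mem_Collect_eq)

lemma active_subset: "active A x \<subseteq> A"
  by (auto simp: active_def)

lemma convex_on_maxaff:
  assumes "finite A" "A \<noteq> {}" "convex U"
  shows "convex_on U (maxaff A)"
proof (rule convex_onI)
  fix t :: real and x y assume t: "t > 0" "t < 1"
  show "maxaff A ((1 - t) *\<^sub>R x + t *\<^sub>R y) \<le> (1 - t) * maxaff A x + t * maxaff A y"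
    unfolding maxaff_le_iff[OF assms(1,2)]
  proof
    fix p assume p: "p \<in> A"
    have "fst p \<bullet> ((1 - t) *\<^sub>R x + t *\<^sub>R y) + snd p = (1 - t) * (fst p \<bullet> x + snd p) + t * (fst p \<bullet> y + snd p)"
      by (simp add: inner_add_right algebra_simps)
    also have "\<dots> \<le> (1 - t) * maxaff A x + t * maxaff A y"
      using t maxaff_ge[OF assms(1) p] by (intro add_mono mult_left_mono) auto
    finally show "fst p \<bullet> ((1 - t) *\<^sub>R x + t *\<^sub>R y) + snd p \<le> (1 - t) * maxaff A x + t * maxaff A y" .
  qed
qed fact

lemma continuous_on_maxaff:
  assumes "finite A" "A \<noteq> {}"
  shows "continuous_on S (maxaff A)"
  using convex_on_continuous[OF open_UNIV convex_on_maxaff[OF assms convex_UNIV]] continuous_on_subset by blast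

lemma supp_upper:
  assumes "bounded P" "p \<in> P" shows "p \<bullet> y \<le> supp P y"
  unfolding supp_def
proof (rule cSUP_upper[OF assms(2)])
  obtain B where "\<And>p. p \<in> P \<Longrightarrow> norm p \<le> B" using assms(1) by (auto simp: bounded_iff)
  then have "\<And>p. p \<in> P \<Longrightarrow> p \<bullet> y \<le> B * norm y"
    by (meson norm_cauchy_schwarz mult_right_mono norm_ge_zero order_trans)
  then show "bdd_above ((\<lambda>p. p \<bullet> y) ` P)" by (rule bdd_aboveI2)
qed

lemma supp_least: "P \<noteq> {} \<Longrightarrow> (\<And>p. p \<in> P \<Longrightarrow> p \<bullet> y \<le> c) \<Longrightarrow> supp P y \<le> c"
  unfolding supp_def by (rule cSUP_least)

lemma supp_hull:
  assumes S: "finite S" "S \<noteq> {}"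
  shows "supp (convex hull S) y = Max ((\<lambda>s. s \<bullet> y) ` S)"
proof (rule antisym)
  have b: "bounded (convex hull S)" using S by (simp add: bounded_convex_hull finite_imp_bounded)
  have "convex hull S \<subseteq> {p. y \<bullet> p \<le> Max ((\<lambda>s. s \<bullet> y) ` S)}"
    using S by (intro hull_minimal convex_halfspace_le) (auto simp: inner_commute intro!: Max_ge)
  then show "supp (convex hull S) y \<le> Max ((\<lambda>s. s \<bullet> y) ` S)"
    using S by (intro supp_least) (auto simp: inner_commute)
  show "Max ((\<lambda>s. s \<bullet> y) ` S) \<le> supp (convex hull S) y"
    using S supp_upper[OF b] by (intro Max.boundedI) (auto simp: hull_inc)
qed

lemma active_eq: "p \<in> active A x \<Longrightarrow> fst p \<bullet> y + snd p = maxaff A x + fst p \<bullet> (y - x)"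
  by (auto simp: active_def inner_diff_right)

lemma maxaff_active:
  assumes A: "finite A" "A \<noteq> {}"
  shows "maxaff (active A x) y = maxaff A x + supp (cell A x) (y - x)"
proof -
  have f: "finite (active A x)" "active A x \<noteq> {}" using A active_nonempty active_subset finite_subset by metis+
  have "maxaff (active A x) y = Max ((\<lambda>p. maxaff A x + fst p \<bullet> (y - x)) ` active A x)"
    unfolding maxaff_def[of "active A x"] by (intro arg_cong[of _ _ Max] image_cong refl active_eq)
  also have "\<dots> = Max ((\<lambda>r. maxaff A x + r) ` (\<lambda>s. s \<bullet> (y - x)) ` fst ` active A x)"
    by (simp add: image_image)
  also have "\<dots> = maxaff A x + Max ((\<lambda>s. s \<bullet> (y - x)) ` fst ` active A x)"
    using f by (intro mono_Max_commute[symmetric]) (auto intro!: monoI)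
  finally show ?thesis unfolding cell_def using f by (subst supp_hull) auto
qed

text \<open>The finitely many inactive pieces stay strictly below the maximum near \<open>x\<close>,
  and the active ones form a cone there. This is what lets local determination reduce
  \<open>\<Psi>\<close> to cones.\<close>

lemma maxaff_local:
  assumes A: "finite A" "A \<noteq> {}"
  shows "\<exists>e>0. \<forall>y\<in>ball x e. maxaff A y = maxaff A x + supp (cell A x) (y - x)"
proof -
  have f: "finite (active A x)" "active A x \<noteq> {}" using A active_nonempty active_subset finite_subset by metis+
  have "eventually (\<lambda>y. \<forall>p\<in>A - active A x. fst p \<bullet> y + snd p < maxaff (active A x) y) (nhds x)"
  proof (rule eventually_ball_finite)
    show "finite (A - active A x)" using A by simp
    show "\<forall>p\<in>A - active A x. eventually (\<lambda>y. fst p \<bullet> y + snd p < maxaff (active A x) y) (nhds x)"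
    proof
      fix p assume p: "p \<in> A - active A x"
      have "maxaff (active A x) x = maxaff A x"
      proof (rule antisym)
        show "maxaff (active A x) x \<le> maxaff A x"
          unfolding maxaff_le_iff[OF f] by (simp add: active_def)
        obtain q where "q \<in> active A x" using f by blast
        then show "maxaff A x \<le> maxaff (active A x) x" using maxaff_ge[OF f(1), of q x] by (simp add: active_def)
      qed
      moreover have "fst p \<bullet> x + snd p < maxaff A x"
        using maxaff_ge[OF A(1), of p x] p by (auto simp: active_def less_le)
      ultimately have h0: "0 < maxaff (active A x) x - (fst p \<bullet> x + snd p)" by simp
      define h where "h y = maxaff (active A x) y - (fst p \<bullet> y + snd p)" for y
      have "continuous_on UNIV h"
        unfolding h_def by (intro continuous_intros continuous_on_maxaff f)
      then have "isCont h x" by (simp add: continuous_on_eq_continuous_at)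
      then have "(h \<longlongrightarrow> h x) (nhds x)"
        unfolding isCont_def tendsto_at_iff_tendsto_nhds .
      then have "eventually (\<lambda>y. 0 < h y) (nhds x)"
        by (rule order_tendstoD) (use h0 in \<open>simp add: h_def\<close>)
      then show "eventually (\<lambda>y. fst p \<bullet> y + snd p < maxaff (active A x) y) (nhds x)" by (simp add: h_def)
    qed
  qed
  then obtain e where e: "e > 0" "\<And>y p. dist y x < e \<Longrightarrow> p \<in> A - active A x \<Longrightarrow> fst p \<bullet> y + snd p < maxaff (active A x) y"
    by (auto simp: eventually_nhds_metric)
  have "maxaff A y = maxaff (active A x) y" if "y \<in> ball x e" for y
  proof (rule antisym)
    show "maxaff A y \<le> maxaff (active A x) y"
      unfolding maxaff_le_iff[OF A]
    proof
      fix p assume "p \<in> A"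
      then show "fst p \<bullet> y + snd p \<le> maxaff (active A x) y"
        using e(2)[of y p] that maxaff_ge[OF f(1), of p y] by (cases "p \<in> active A x") (auto simp: dist_commute intro: less_imp_le)
    qed
    show "maxaff (active A x) y \<le> maxaff A y"
      unfolding maxaff_le_iff[OF f] using maxaff_ge[OF A(1)] active_subset by blast
  qed
  then show ?thesis using e(1) maxaff_active[OF A] by metis
qed

lemma compact_cell: "finite A \<Longrightarrow> compact (cell A x)"
  unfolding cell_def using finite_subset[OF active_subset] by (intro compact_convex_hull finite_imp_compact) auto

lemma cell_nonempty: "finite A \<Longrightarrow> A \<noteq> {} \<Longrightarrow> cell A x \<noteq> {}"
  by (simp add: cell_def active_nonempty)

text \<open>Active slopes are subgradients, and subgradients at \<open>x\<close> form a convex set.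
  Conversely, a slope outside the compact convex cell is strictly separated from it by some vector
  \<open>a\<close>, and a short step along \<open>- a\<close> violates the subgradient
  inequality.\<close>

lemma contact_maxaff:
  assumes A: "finite A" "A \<noteq> {}" and U: "open U" and x: "x \<in> U" and f: "\<And>y. y \<in> U \<Longrightarrow> f y = maxaff A y"
  shows "x \<in> contact U f p \<longleftrightarrow> p \<in> cell A x"
proof
  assume p: "p \<in> cell A x"
  have "cell A x \<subseteq> {p. \<forall>y. p \<bullet> (y - x) \<le> maxaff A y - maxaff A x}"
    unfolding cell_def
  proof (rule hull_minimal)
    show "fst ` active A x \<subseteq> {p. \<forall>y. p \<bullet> (y - x) \<le> maxaff A y - maxaff A x}"
    proof clarify
      fix s b y assume a: "(s, b) \<in> active A x"
      then show "fst (s, b) \<bullet> (y - x) \<le> maxaff A y - maxaff A x"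
        using active_eq[OF a, of y] maxaff_ge[OF A(1), of "(s,b)" y] active_subset[of A x] by auto
    qed
    have "{p. \<forall>y. p \<bullet> (y - x) \<le> maxaff A y - maxaff A x} = (\<Inter>y. {p. (y - x) \<bullet> p \<le> maxaff A y - maxaff A x})"
      by (auto simp: inner_commute)
    then show "convex {p. \<forall>y. p \<bullet> (y - x) \<le> maxaff A y - maxaff A x}"
      by (simp add: convex_INT convex_halfspace_le)
  qed
  then have "\<forall>y. p \<bullet> (y - x) \<le> maxaff A y - maxaff A x" using p by blast
  then have "\<forall>y\<in>U. maxaff A x + p \<bullet> (y - x) \<le> maxaff A y" by (simp add: le_diff_eq add.commute)
  then show "x \<in> contact U f p" using x f by (simp add: contact_def)
next
  assume c: "x \<in> contact U f p"
  show "p \<in> cell A x"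
  proof (rule ccontr)
    assume np: "p \<notin> cell A x"
    have cc: "convex (cell A x)" by (simp add: cell_def)
    have cl: "closed (cell A x)" using compact_cell[OF A(1)] by (rule compact_imp_closed)
    obtain a b where ab: "a \<bullet> p < b" "\<And>q. q \<in> cell A x \<Longrightarrow> b < a \<bullet> q"
      using separating_hyperplane_closed_point[OF cc cl np] by blast
    obtain e where e: "e > 0" "\<And>y. y \<in> ball x e \<Longrightarrow> maxaff A y = maxaff A x + supp (cell A x) (y - x)"
      using maxaff_local[OF A] by blast
    obtain e' where e': "e' > 0" "ball x e' \<subseteq> U" using U x openE by blast
    \<comment> \<open>A step that stays within both radii; the summand 1 avoids division by
      zero.\<close>
    define t where "t = min e e' / (2 * (norm a + 1))"
    have t: "t > 0" using e e' by (simp add: t_def add_nonneg_pos)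
    have "t * norm a \<le> min e e' / 2 * (norm a / (norm a + 1))" by (simp add: t_def)
    also have "\<dots> \<le> min e e' / 2 * 1" using e(1) e'(1) by (intro mult_left_mono) (auto simp: divide_le_eq_1 add_nonneg_pos)
    finally have tn: "t * norm a < min e e'" using e(1) e'(1) by (auto simp: min_def split: if_splits)
    define y where "y = x - t *\<^sub>R a"
    have "dist x y = t * norm a" using t by (simp add: y_def dist_norm)
    then have y: "y \<in> ball x e" "y \<in> U" using tn e'(2) by auto
    have "supp (cell A x) (y - x) \<le> - (t * b)"
    proof (rule supp_least[OF cell_nonempty[OF A]])
      fix q assume "q \<in> cell A x"
      then have "t * b \<le> t * (a \<bullet> q)" using ab(2)[of q] t by (intro mult_left_mono) auto
      then show "q \<bullet> (y - x) \<le> - (t * b)" by (simp add: y_def inner_commute)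
    qed
    moreover have "maxaff A x + p \<bullet> (y - x) \<le> maxaff A y" using c y(2) x f by (simp add: contact_def)
    moreover have "p \<bullet> (y - x) = - (t * (a \<bullet> p))" by (simp add: y_def inner_commute)
    ultimately have "t * b \<le> t * (a \<bullet> p)" using e(2)[OF y(1)] by simp
    then show False using ab(1) t by simp
  qed
qed

text \<open>A vertex is determined by its active pieces: if distinct \<open>x\<close> and
  \<open>y\<close> shared them, all active slopes would have the same product with
  \<open>x - y\<close> and lie in a hyperplane.\<close>

lemma finite_vertices:
  assumes A: "finite A" "A \<noteq> {}"
  shows "finite (vertices A)"
proof -
  have "inj_on (active A) (vertices A)"
  proof (rule inj_onI, rule ccontr)
    fix x y assume *: "x \<in> vertices A" "active A x = active A y" "x \<noteq> y"
    have "(x - y) \<bullet> s = maxaff A x - maxaff A y" if s: "s \<in> fst ` active A x" for s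
    proof -
      obtain z where z: "z \<in> active A x" "s = fst z" using s by blast
      moreover have "z \<in> active A y" using z(1) *(2) by simp
      ultimately show ?thesis unfolding z(2) inner_commute[of "x - y"] inner_diff_right by (auto simp: active_def)
    qed
    then have "in_hyperplane (fst ` active A x)" unfolding in_hyperplane_def using *(3) by (metis right_minus_eq)
    then show False using *(1) by (simp add: vertices_def)
  qed
  moreover have "finite (active A ` vertices A)"
    by (rule finite_subset[of _ "Pow A"]) (use A active_subset in auto)
  ultimately show ?thesis by (rule finite_imageD[rotated])
qed

lemma negligible_hull_in_hyperplane: "in_hyperplane S \<Longrightarrow> negligible (convex hull S)"
proof -
  assume "in_hyperplane S"
  then obtain a \<beta> where a: "a \<noteq> 0" "\<forall>s\<in>S. a \<bullet> s = \<beta>" by (auto simp: in_hyperplane_def)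
  have "convex hull S \<subseteq> {s. a \<bullet> s = \<beta>}"
    using a(2) by (intro hull_minimal convex_hyperplane) auto
  moreover have "negligible {s. a \<bullet> s = \<beta>}" using a(1) by (intro negligible_hyperplane) auto
  ultimately show ?thesis using negligible_subset by blast
qed

text \<open>Slopes touching outside the vertices lie in hulls of flat subsets of the slopes; there
  are finitely many such hulls and each is a null set. At a point the measure is the volume of its
  cell up to exceptional slopes.\<close>

lemma subdiff_measure_maxaff:
  assumes A: "finite A" "A \<noteq> {}" and U: "open U" and f: "continuous_on U f" "\<And>y. y \<in> U \<Longrightarrow> f y = maxaff A y"
  shows "emeasure (subdiff_measure U f) (- vertices A) = 0"
    and "v \<in> U \<Longrightarrow> emeasure (subdiff_measure U f) {v} = emeasure lebesgue (cell A v)"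
proof -
  have "closed (vertices A)" using finite_vertices[OF A] by (rule finite_imp_closed)
  then have vb: "- vertices A \<in> sets borel" by (intro borel_open) auto
  have "negligible (\<Union>S\<in>{S. S \<subseteq> A \<and> in_hyperplane (fst ` S)}. convex hull (fst ` S))"
    using A negligible_hull_in_hyperplane by (intro negligible_Union) auto
  moreover have "hit U f (- vertices A \<inter> U) \<subseteq> (\<Union>S\<in>{S. S \<subseteq> A \<and> in_hyperplane (fst ` S)}. convex hull (fst ` S))"
  proof
    fix p assume "p \<in> hit U f (- vertices A \<inter> U)"
    then obtain x where x: "x \<in> U" "x \<notin> vertices A" "x \<in> contact U f p" by (auto simp: hit_def)
    then have "p \<in> convex hull (fst ` active A x)" using contact_maxaff[OF A U x(1) f(2)] by (auto simp: cell_def)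
    moreover have "active A x \<subseteq> A" "in_hyperplane (fst ` active A x)" using x(2) active_subset by (auto simp: vertices_def)
    ultimately show "p \<in> (\<Union>S\<in>{S. S \<subseteq> A \<and> in_hyperplane (fst ` S)}. convex hull (fst ` S))" by blast
  qed
  ultimately have "negligible (hit U f (- vertices A \<inter> U) - nonunique U f)"
    by (meson Diff_subset negligible_subset)
  then show "emeasure (subdiff_measure U f) (- vertices A) = 0"
    unfolding emeasure_subdiff_measure[OF U f(1) vb] negligible_iff_null_sets by (rule null_setsD1)
  assume v: "v \<in> U"
  have "emeasure (subdiff_measure U f) {v} = emeasure lebesgue (hit U f ({v} \<inter> U) - nonunique U f)"
    by (rule emeasure_subdiff_measure[OF U f(1)]) simp
  also have "hit U f ({v} \<inter> U) = cell A v" using v contact_maxaff[OF A U v f(2)] by (auto simp: hit_def)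
  also have "emeasure lebesgue (cell A v - nonunique U f) = emeasure lebesgue (cell A v)"
  proof (rule emeasure_Diff_null_set)
    show "nonunique U f \<in> null_sets lebesgue" using nonunique_negligible[OF U f(1)] by (simp add: negligible_iff_null_sets)
    show "cell A v \<in> sets lebesgue" using borel_compact[OF compact_cell[OF A(1)]] by simp
  qed
  finally show "emeasure (subdiff_measure U f) {v} = emeasure lebesgue (cell A v)" .
qed

lemma integral_finite_support:
  fixes \<phi> :: "real^'n \<Rightarrow> complex"
  assumes M: "sets M = sets borel" and V: "finite V" "emeasure M (- V) = 0" and fin: "\<And>v. v \<in> V \<Longrightarrow> emeasure M {v} < \<infinity>"
    and \<phi>: "\<phi> \<in> borel_measurable borel"
  shows "integral\<^sup>L M \<phi> = (\<Sum>v\<in>V. measure M {v} *\<^sub>R \<phi> v)"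
proof -
  have sp: "space M = UNIV" using sets_eq_imp_space_eq[OF M] by simp
  have "closed V" using V(1) by (rule finite_imp_closed)
  then have Vb: "-V \<in> sets M" unfolding M by (intro borel_open) auto
  have i: "integrable M (\<lambda>x. indicator {v} x *\<^sub>R \<phi> v)" if "v \<in> V" for v
    using fin[OF that] M by (intro integrable_scaleR_left integrable_real_indicator) auto
  have "-V \<in> null_sets M" using V(2) Vb by (simp add: null_sets_def)
  then have "AE x in M. x \<notin> - V" by (rule AE_not_in)
  then have "AE x in M. \<phi> x = (\<Sum>v\<in>V. indicator {v} x *\<^sub>R \<phi> v)"
  proof eventually_elim
    case (elim x)
    have "(\<Sum>v\<in>V. indicator {v} x *\<^sub>R \<phi> v) = (\<Sum>v\<in>V. if v = x then \<phi> v else 0)"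
      by (intro sum.cong) (auto simp: indicator_def)
    also have "\<dots> = \<phi> x" using elim V(1) by simp
    finally show ?case by simp
  qed
  then have "integral\<^sup>L M \<phi> = (\<integral>x. (\<Sum>v\<in>V. indicator {v} x *\<^sub>R \<phi> v) \<partial>M)"
    using \<phi> i by (intro integral_cong_AE) (auto simp: measurable_cong_sets[OF M refl])
  also have "\<dots> = (\<Sum>v\<in>V. \<integral>x. indicator {v} x *\<^sub>R \<phi> v \<partial>M)"
    by (rule Bochner_Integration.integral_sum) (rule i)
  also have "\<dots> = (\<Sum>v\<in>V. measure M {v} *\<^sub>R \<phi> v)"
    using M fin sp by (intro sum.cong refl) (simp add: integral_scaleR_left)
  finally show ?thesis .
qed

section \<open>Approximation by maxima of affine functions and by smooth functions\<close>

text \<open>A hyperplane separates the strict epigraph from the graph point over \<open>x\<close>.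
  It cannot be vertical, because the open set \<open>U\<close> contains points beyond
  \<open>x\<close> in the direction \<open>q\<close>; solving for the last coordinate gives the
  subgradient.\<close>

lemma subgradient_exists:
  fixes U :: "(real^'n) set"
  assumes U: "open U" and f: "convex_on U f" and x: "x \<in> U"
  shows "\<exists>p. x \<in> contact U f p"
proof -
  define S where "S = {z::(real^'n) \<times> real. fst z \<in> U \<and> f (fst z) < snd z}"
  have convU: "convex U" using f by (simp add: convex_on_def)
  have "convex S"
  proof (rule convexI)
    fix z w :: "(real^'n) \<times> real" and u v :: real
    assume z: "z \<in> S" "w \<in> S" and uv: "0 \<le> u" "0 \<le> v" "u + v = 1"
    have "f (u *\<^sub>R fst z + v *\<^sub>R fst w) \<le> u * f (fst z) + v * f (fst w)"
      using f z uv by (auto simp: convex_on_def S_def)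
    also have "\<dots> < u * snd z + v * snd w"
    proof (cases "u = 0")
      case True then show ?thesis using z uv by (auto simp: S_def)
    next
      case False
      then have "u * f (fst z) < u * snd z" using z uv by (auto simp: S_def)
      moreover have "v * f (fst w) \<le> v * snd w" using z uv by (auto simp: S_def intro: mult_left_mono)
      ultimately show ?thesis by linarith
    qed
    finally show "u *\<^sub>R z + v *\<^sub>R w \<in> S"
      using convexD[OF convU _ _ uv] z by (auto simp: S_def)
  qed
  moreover have "(x, f x + 1) \<in> S" using x by (simp add: S_def)
  then have "S \<noteq> {}" by blast
  moreover have "S \<inter> {(x, f x)} = {}" by (auto simp: S_def)
  ultimately have "\<exists>a b. a \<noteq> 0 \<and> (\<forall>z\<in>S. a \<bullet> z \<le> b) \<and> (\<forall>z\<in>{(x, f x)}. b \<le> a \<bullet> z)"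
    by (intro separating_hyperplane_sets) auto
  then obtain a b where ab: "a \<noteq> 0" "\<And>z. z \<in> S \<Longrightarrow> a \<bullet> z \<le> b" "b \<le> a \<bullet> (x, f x)"
    by blast
  define q where "q = fst a" define \<tau> where "\<tau> = snd a"
  have ineq: "q \<bullet> y + \<tau> * t \<le> q \<bullet> x + \<tau> * f x" if "y \<in> U" "f y < t" for y t
    using ab(2)[of "(y, t)"] ab(3) that by (auto simp: S_def q_def \<tau>_def inner_prod_def)
  have "\<tau> \<le> 0" using ineq[OF x, of "f x + 1"] by (simp add: distrib_left)
  have "\<tau> \<noteq> 0"
  proof
    assume t0: "\<tau> = 0"
    have "q \<noteq> 0" using ab(1) t0 by (auto simp: q_def \<tau>_def prod_eq_iff)
    obtain e where e: "e > 0" "ball x e \<subseteq> U" using U x openE by blast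
    define y where "y = x + (e / 2 / norm q) *\<^sub>R q"
    have "dist x y < e" using e(1) \<open>q \<noteq> 0\<close> by (simp add: y_def dist_norm)
    then have "y \<in> U" using e(2) by auto
    then have "q \<bullet> y \<le> q \<bullet> x" using ineq[of y "f y + 1"] t0 by simp
    moreover have "q \<bullet> y = q \<bullet> x + (e / 2 / norm q) * (q \<bullet> q)" by (simp add: y_def inner_add_right)
    ultimately have "(e / 2 / norm q) * (q \<bullet> q) \<le> 0" by simp
    moreover have "(e / 2 / norm q) * (q \<bullet> q) > 0" using e(1) \<open>q \<noteq> 0\<close> by simp
    ultimately show False by linarith
  qed
  then have \<tau>: "\<tau> < 0" using \<open>\<tau> \<le> 0\<close> by simp
  have "f x + ((1 / (- \<tau>)) *\<^sub>R q) \<bullet> (y - x) \<le> f y" if y: "y \<in> U" for y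
  proof (rule dense_ge)
    fix t assume "f y < t"
    from ineq[OF y this] have "q \<bullet> (y - x) \<le> (- \<tau>) * (t - f x)" by (simp add: inner_diff_right algebra_simps)
    then have "(1 / (- \<tau>)) * (q \<bullet> (y - x)) \<le> t - f x" using \<tau> by (simp add: field_simps)
    then show "f x + ((1 / (- \<tau>)) *\<^sub>R q) \<bullet> (y - x) \<le> t" by simp
  qed
  then have "x \<in> contact U f ((1 / (- \<tau>)) *\<^sub>R q)" using x by (simp add: contact_def)
  then show ?thesis by blast
qed

text \<open>The supporting affine function at a point is within \<open>e\<close> of \<open>f\<close>
  on a neighbourhood of it, and finitely many such neighbourhoods cover \<open>K\<close>.\<close>

lemma maxaff_approx:
  assumes U: "open U" "U \<noteq> {}" and f: "convex_on U f" and K: "compact K" "K \<subseteq> U" and e: "e > 0"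
  obtains A where "finite A" "A \<noteq> {}" "\<And>x. x \<in> U \<Longrightarrow> maxaff A x \<le> f x" "\<And>x. x \<in> K \<Longrightarrow> f x - e < maxaff A x"
proof -
  have "\<forall>x\<in>U. \<exists>p. x \<in> contact U f p" using subgradient_exists[OF U(1) f] by blast
  then obtain P where P: "\<And>x. x \<in> U \<Longrightarrow> x \<in> contact U f (P x)" by metis
  define T where "T x = (P x, f x - P x \<bullet> x)" for x
  have T: "fst (T x) \<bullet> y + snd (T x) \<le> f y" if "x \<in> U" "y \<in> U" for x y
    using P[OF that(1)] that(2) by (auto simp: T_def contact_def inner_diff_right algebra_simps)
  have fc: "continuous_on U f" by (rule convex_on_continuous[OF U(1) f])
  define W where "W x = {y\<in>U. f y - e < fst (T x) \<bullet> y + snd (T x)}" for x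
  have Wo: "open (W x)" for x
  proof -
    have "W x = U \<inter> (\<lambda>y. fst (T x) \<bullet> y + snd (T x) - f y + e) -` {0<..}" by (auto simp: W_def)
    moreover have "continuous_on U (\<lambda>y. fst (T x) \<bullet> y + snd (T x) - f y + e)" using fc by (intro continuous_intros)
    ultimately show ?thesis using continuous_open_preimage[OF _ U(1) open_greaterThan] by simp
  qed
  have KW: "K \<subseteq> (\<Union>x\<in>K. W x)" using K(2) e by (auto simp: W_def T_def)
  obtain C where C: "C \<subseteq> K" "finite C" "K \<subseteq> (\<Union>c\<in>C. W c)"
    by (rule compactE_image[OF K(1) Wo KW])
  obtain x0 where x0: "x0 \<in> U" using U(2) by blast
  \<comment> \<open>The additional point \<open>x0\<close> keeps \<open>A\<close> nonempty when
    \<open>K\<close> is empty.\<close>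
  define A where "A = T ` insert x0 C"
  have A: "finite A" "A \<noteq> {}" using C by (auto simp: A_def)
  show ?thesis
  proof (rule that[OF A])
    show "maxaff A x \<le> f x" if "x \<in> U" for x
      unfolding maxaff_le_iff[OF A] using T that x0 C(1) K(2) by (auto simp: A_def)
    show "f x - e < maxaff A x" if x: "x \<in> K" for x
    proof -
      obtain c where "c \<in> C" "x \<in> W c" using C(3) x by blast
      then have "f x - e < fst (T c) \<bullet> x + snd (T c)" "T c \<in> A" by (auto simp: W_def A_def)
      then show ?thesis using maxaff_ge[OF A(1), of "T c" x] by linarith
    qed
  qed
qed

text \<open>The log-sum-exp smoothing of \<open>maxaff A\<close>, with \<open>k\<close> as inverse
  temperature.\<close>

definition lse :: "real \<Rightarrow> ((real^'n) \<times> real) set \<Rightarrow> real^'n \<Rightarrow> real" where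
  "lse k A x = ln (\<Sum>p\<in>A. exp (k * (fst p \<bullet> x + snd p))) / k"

lemma lse_bounds:
  assumes A: "finite A" "A \<noteq> {}" and k: "k > 0"
  shows "maxaff A x \<le> lse k A x" "lse k A x \<le> maxaff A x + ln (card A) / k"
proof -
  let ?E = "\<lambda>p. exp (k * (fst p \<bullet> x + snd p))"
  have pos: "0 < (\<Sum>p\<in>A. ?E p)" using A by (intro sum_pos) auto
  obtain p where p: "p \<in> A" "maxaff A x = fst p \<bullet> x + snd p" using maxaff_attained[OF A] by blast
  have "exp (k * maxaff A x) \<le> (\<Sum>p\<in>A. ?E p)"
    unfolding p(2) using A p(1) by (intro member_le_sum) auto
  then have "k * maxaff A x \<le> ln (\<Sum>p\<in>A. ?E p)" using pos by (simp add: ln_ge_iff)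
  then show "maxaff A x \<le> lse k A x" using k by (simp add: lse_def field_simps)
  have "(\<Sum>p\<in>A. ?E p) \<le> (\<Sum>p\<in>A. exp (k * maxaff A x))"
    using maxaff_ge[OF A(1)] k by (intro sum_mono) simp
  then have "(\<Sum>p\<in>A. ?E p) \<le> card A * exp (k * maxaff A x)" by simp
  then have "ln (\<Sum>p\<in>A. ?E p) \<le> ln (card A * exp (k * maxaff A x))" using pos by (subst ln_le_cancel_iff) auto
  also have "\<dots> = ln (card A) + k * maxaff A x" using A by (subst ln_mult) (auto simp: card_gt_0_iff)
  finally show "lse k A x \<le> maxaff A x + ln (card A) / k" using k by (simp add: lse_def field_simps)
qed

text \<open>After division by the sums at \<open>x\<close> and \<open>y\<close>, convexity of
  \<open>exp\<close> holds summand by summand; adding up bounds the normalised sum at the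
  intermediate point by 1, and the logarithm of this is the claim.\<close>

lemma convex_on_lse:
  fixes U :: "(real^'n) set"
  assumes A: "finite A" "A \<noteq> {}" and k: "k > 0" and U: "convex U"
  shows "convex_on U (lse k A)"
proof (rule convex_onI)
  fix t :: real and x y :: "real^'n" assume t: "t > 0" "t < 1"
  let ?L = "\<lambda>p z. k * (fst p \<bullet> z + snd p)"
  let ?S = "\<lambda>z. \<Sum>p\<in>A. exp (?L p z)"
  have pos: "0 < ?S z" for z using A by (intro sum_pos) auto
  define w where "w = (1 - t) *\<^sub>R x + t *\<^sub>R y"
  have "exp (?L p w - ((1 - t) * ln (?S x) + t * ln (?S y))) \<le> (1 - t) * (exp (?L p x) / ?S x) + t * (exp (?L p y) / ?S y)" for p
  proof -
    have "?L p w - ((1 - t) * ln (?S x) + t * ln (?S y)) = (1 - t) * (?L p x - ln (?S x)) + t * (?L p y - ln (?S y))"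
      by (simp add: w_def inner_add_right algebra_simps)
    also have "exp \<dots> \<le> (1 - t) * exp (?L p x - ln (?S x)) + t * exp (?L p y - ln (?S y))"
      using convex_onD[OF exp_convex, of t "?L p x - ln (?S x)" "?L p y - ln (?S y)"] t by simp
    finally show ?thesis using pos by (simp add: exp_diff)
  qed
  then have "(\<Sum>p\<in>A. exp (?L p w - ((1 - t) * ln (?S x) + t * ln (?S y)))) \<le> (\<Sum>p\<in>A. (1 - t) * (exp (?L p x) / ?S x) + t * (exp (?L p y) / ?S y))"
    by (rule sum_mono)
  also have "\<dots> = (1 - t) * ((\<Sum>p\<in>A. exp (?L p x)) / ?S x) + t * ((\<Sum>p\<in>A. exp (?L p y)) / ?S y)"
    by (simp only: sum.distrib sum_distrib_left[symmetric] sum_divide_distrib)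
  also have "\<dots> = 1" unfolding divide_self[OF less_imp_neq[OF pos, THEN not_sym]] by simp
  finally have "?S w / exp ((1 - t) * ln (?S x) + t * ln (?S y)) \<le> 1"
    by (simp add: exp_diff sum_divide_distrib)
  then have "?S w \<le> exp ((1 - t) * ln (?S x) + t * ln (?S y))" by (simp add: divide_le_eq_1)
  then have "ln (?S w) \<le> ln (exp ((1 - t) * ln (?S x) + t * ln (?S y)))"
    by (rule ln_mono) (rule pos)
  then have "ln (?S w) \<le> (1 - t) * ln (?S x) + t * ln (?S y)" by (simp only: ln_exp)
  then have "ln (?S w) / k \<le> ((1 - t) * ln (?S x) + t * ln (?S y)) / k" using k by (simp add: divide_right_mono)
  then show "lse k A ((1 - t) *\<^sub>R x + t *\<^sub>R y) \<le> (1 - t) * lse k A x + t * lse k A y"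
    by (simp add: lse_def w_def add_divide_distrib)
qed fact

lemma C2_hess_lse:
  assumes A: "finite A" "A \<noteq> {}" and k: "k > 0" and U: "convex U"
  shows "\<exists>H. C2_hess U (lse k A :: real^'n \<Rightarrow> real) H"
proof -
  define E where "E p x = exp (k * (fst p \<bullet> x + snd p))" for p and x :: "real^'n"
  define S where "S x = (\<Sum>p\<in>A. E p x)" for x
  define N where "N x = (\<Sum>p\<in>A. E p x *\<^sub>R fst p)" for x
  \<comment> \<open>The quotients \<open>E p x / S x\<close> are probability weights on
    \<open>A\<close>. The gradient is the mean slope \<open>N x / S x\<close>, and the Hessian is
    \<open>k\<close> times the covariance matrix of the slopes.\<close>
  define H :: "real^'n \<Rightarrow> real^'n^'n" where
    "H x = (\<chi> i j. k * ((\<Sum>p\<in>A. E p x * fst p $ i * fst p $ j) * inverse (S x) - N x $ i * N x $ j * (inverse (S x))\<^sup>2))" for x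
  have pos: "0 < S x" for x unfolding S_def E_def using A by (intro sum_pos) auto
  have Ec: "continuous_on U (E p)" for p unfolding E_def by (intro continuous_intros)
  have dE: "(E p has_derivative (\<lambda>h. E p x * (k * (fst p \<bullet> h)))) (at x)" for p x
    unfolding E_def by (auto intro!: derivative_eq_intros)
  have dS: "(S has_derivative (\<lambda>h. k * (N x \<bullet> h))) (at x)" for x
  proof -
    have "(S has_derivative (\<lambda>h. \<Sum>p\<in>A. E p x * (k * (fst p \<bullet> h)))) (at x)"
      unfolding S_def by (intro has_derivative_sum dE)
    moreover have "(\<Sum>p\<in>A. E p x * (k * (fst p \<bullet> h))) = k * (N x \<bullet> h)" for h
      by (simp add: N_def inner_sum_left sum_distrib_left algebra_simps)
    ultimately show ?thesis by simp
  qed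
  have dN: "(N has_derivative (\<lambda>h. \<Sum>p\<in>A. (E p x * (k * (fst p \<bullet> h))) *\<^sub>R fst p)) (at x)" for x
    unfolding N_def by (intro has_derivative_sum has_derivative_scaleR_left dE)
  have 1: "(lse k A has_derivative (\<lambda>h. (inverse (S x) *\<^sub>R N x) \<bullet> h)) (at x)" for x
  proof -
    have "((\<lambda>x. ln (S x) / k) has_derivative (\<lambda>h. (k * (N x \<bullet> h)) * inverse (S x) / k)) (at x)"
      using pos[of x] dS[of x] k by (auto intro!: derivative_eq_intros)
    moreover have "(k * (N x \<bullet> h)) * inverse (S x) / k = (inverse (S x) *\<^sub>R N x) \<bullet> h" for h using k by simp
    moreover have "lse k A = (\<lambda>x. ln (S x) / k)" by (simp add: lse_def S_def E_def fun_eq_iff)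
    ultimately show ?thesis by simp
  qed
  have 2: "((\<lambda>x. inverse (S x) *\<^sub>R N x) has_derivative (\<lambda>h. H x *v h)) (at x)" for x
  proof -
    have "((\<lambda>x. inverse (S x) *\<^sub>R N x) has_derivative (\<lambda>h. inverse (S x) *\<^sub>R (\<Sum>p\<in>A. (E p x * (k * (fst p \<bullet> h))) *\<^sub>R fst p)
         + (- (inverse (S x) * (k * (N x \<bullet> h)) * inverse (S x))) *\<^sub>R N x)) (at x)"
      by (rule has_derivative_scaleR[OF Deriv.has_derivative_inverse[OF _ dS] dN]) (use pos[of x] in simp)
    moreover have "inverse (S x) *\<^sub>R (\<Sum>p\<in>A. (E p x * (k * (fst p \<bullet> h))) *\<^sub>R fst p)
         + (- (inverse (S x) * (k * (N x \<bullet> h)) * inverse (S x))) *\<^sub>R N x = H x *v h" for h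
    proof (rule vec_eq_iff[THEN iffD2], rule allI)
      fix i
      have "(H x *v h) $ i = (\<Sum>j\<in>UNIV. k * ((\<Sum>p\<in>A. E p x * fst p $ i * fst p $ j) * inverse (S x) - N x $ i * N x $ j * (inverse (S x))\<^sup>2) * h $ j)"
        by (simp add: matrix_vector_mult_def H_def)
      also have "\<dots> = k * inverse (S x) * (\<Sum>j\<in>UNIV. (\<Sum>p\<in>A. E p x * fst p $ i * fst p $ j) * h $ j) - k * (inverse (S x))\<^sup>2 * N x $ i * (\<Sum>j\<in>UNIV. N x $ j * h $ j)"
        unfolding sum_distrib_left sum_subtractf[symmetric] by (intro sum.cong refl) (simp add: algebra_simps)
      also have "(\<Sum>j\<in>UNIV. (\<Sum>p\<in>A. E p x * fst p $ i * fst p $ j) * h $ j) = (\<Sum>p\<in>A. E p x * fst p $ i * (fst p \<bullet> h))"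
        unfolding inner_vec_def inner_real_def sum_distrib_left sum_distrib_right
        by (subst sum.swap) (intro sum.cong refl, simp add: mult.assoc)
      also have "(\<Sum>j\<in>UNIV. N x $ j * h $ j) = N x \<bullet> h" by (simp add: inner_vec_def)
      finally show "(inverse (S x) *\<^sub>R (\<Sum>p\<in>A. (E p x * (k * (fst p \<bullet> h))) *\<^sub>R fst p)
         + (- (inverse (S x) * (k * (N x \<bullet> h)) * inverse (S x))) *\<^sub>R N x) $ i = (H x *v h) $ i"
        by (simp add: sum_component sum_distrib_left power2_eq_square algebra_simps)
    qed
    ultimately show ?thesis by simp
  qed
  have Sc: "continuous_on U S" unfolding S_def by (intro continuous_intros Ec)
  have Nc: "continuous_on U N" unfolding N_def by (intro continuous_intros Ec)
  have "continuous_on U H"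
    unfolding H_def using pos by (intro continuous_intros Sc Nc Ec) (auto simp: less_imp_neq[symmetric])
  then have "C2_hess U (lse k A) H"
    unfolding C2_hess_def
    by (intro conjI exI[of _ "\<lambda>x. inverse (S x) *\<^sub>R N x"] ballI convex_on_lse[OF A k U] 1 2)
  then show ?thesis by blast
qed

proposition approx_sequences:
  assumes U: "open U" "U \<noteq> {}" and f: "convex_on U f"
  obtains A :: "nat \<Rightarrow> ((real^'n) \<times> real) set" and fs Hs where "\<And>n. finite (A n)" "\<And>n. A n \<noteq> {}" "conv_lim U (\<lambda>n. maxaff (A n)) f sequentially"
    "\<And>n. C2_hess U (fs n) (Hs n)" "conv_lim U fs f sequentially"
proof -
  obtain C where C: "\<And>n. compact (C n)" "\<And>n. C n \<subseteq> U" "\<And>n. C n \<subseteq> interior (C (Suc n))" "\<Union>(range C) = U" "\<And>K. compact K \<Longrightarrow> K \<subseteq> U \<Longrightarrow> \<exists>N. \<forall>n\<ge>N. K \<subseteq> C n"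
    using open_Union_compact_subsets[OF U(1)] by metis
  have convU: "convex U" using f by (simp add: convex_on_def)
  define e where "e n = inverse (real (Suc n))" for n
  have e: "e n > 0" for n by (simp add: e_def)
  have "\<exists>A. finite A \<and> A \<noteq> {} \<and> (\<forall>x\<in>U. maxaff A x \<le> f x) \<and> (\<forall>x\<in>C n. f x - e n < maxaff A x)" for n
    using maxaff_approx[OF U f C(1,2) e] by metis
  then obtain A where A: "\<And>n. finite (A n)" "\<And>n. A n \<noteq> {}" "\<And>n x. x \<in> U \<Longrightarrow> maxaff (A n) x \<le> f x" "\<And>n x. x \<in> C n \<Longrightarrow> f x - e n < maxaff (A n) x"
    by metis
  \<comment> \<open>Chosen so that the smoothing error \<open>ln (card (A n)) / k n\<close> is at
    most \<open>e n\<close>; the summand 1 keeps \<open>k n\<close> positive when there is a single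
    piece.\<close>
  define k where "k n = real (Suc n) * (ln (card (A n)) + 1)" for n
  have lnc: "0 \<le> ln (real (card (A n)))" for n
    using A(1,2)[of n] by (simp add: Suc_leI card_gt_0_iff)
  have k: "k n > 0" for n unfolding k_def using lnc[of n] by (intro mult_pos_pos) auto
  have kb: "ln (card (A n)) / k n \<le> e n" for n
  proof -
    have "ln (card (A n)) / k n = e n * (ln (card (A n)) / (ln (card (A n)) + 1))"
      by (simp add: k_def e_def field_simps)
    also have "\<dots> \<le> e n * 1" using lnc[of n] e[of n] by (intro mult_left_mono) (auto simp: divide_le_eq_1)
    finally show ?thesis by simp
  qed
  have "\<exists>H. C2_hess U (lse (k n) (A n)) H" for n by (rule C2_hess_lse[OF A(1,2) k convU])
  then obtain Hs where Hs: "\<And>n. C2_hess U (lse (k n) (A n)) (Hs n)" by metis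
  have lim: "conv_lim U g f sequentially" if g: "\<And>n x. x \<in> C n \<Longrightarrow> \<bar>g n x - f x\<bar> \<le> e n" for g
    unfolding conv_lim_def
  proof (intro allI impI)
    fix K :: "(real^'n) set" and r :: real assume K: "compact K \<and> K \<subseteq> U" and r: "r > 0"
    obtain N where N: "\<And>n. n \<ge> N \<Longrightarrow> K \<subseteq> C n" using C(5) K by blast
    have "eventually (\<lambda>n. e n < r) sequentially"
      using LIMSEQ_inverse_real_of_nat r unfolding e_def by (rule order_tendstoD(2))
    then show "eventually (\<lambda>n. \<forall>x\<in>K. \<bar>g n x - f x\<bar> < r) sequentially"
      using eventually_ge_at_top[of N]
    proof eventually_elim
      case (elim n)
      then show ?case using N[of n] g by (meson le_less_trans subsetD)
    qed
  qed
  show ?thesis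
  proof (rule that[of A "\<lambda>n. lse (k n) (A n)" Hs])
    show "conv_lim U (\<lambda>n. maxaff (A n)) f sequentially"
    proof (rule lim)
      fix n x assume x: "x \<in> C n"
      then have "x \<in> U" using C(2) by blast
      then show "\<bar>maxaff (A n) x - f x\<bar> \<le> e n" using A(3)[of x n] A(4)[OF x] by linarith
    qed
    show "conv_lim U (\<lambda>n. lse (k n) (A n)) f sequentially"
    proof (rule lim)
      fix n x assume x: "x \<in> C n"
      then have "x \<in> U" using C(2) by blast
      then show "\<bar>lse (k n) (A n) x - f x\<bar> \<le> e n"
        using A(3)[of x n] A(4)[OF x] lse_bounds[OF A(1)[of n] A(2)[of n] k[of n], of x] kb[of n] by linarith
    qed
  qed (use A Hs in auto)
qed

corollary MA_convex:
  assumes U: "open U" and f: "convex_on U f"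
  shows "MA U f = subdiff_measure U f"
proof (cases "U = {}")
  case True
  have "C2_hess U f (\<lambda>_. 0)" using f True by (simp add: C2_hess_def)
  then show ?thesis using MA_eq_subdiff_measure[OF U f, of "\<lambda>_. f" "\<lambda>_ _. 0"] conv_lim_const by blast
next
  case False
  obtain fs Hs where "\<And>n::nat. C2_hess U (fs n) (Hs n)" "conv_lim U fs f sequentially"
    using approx_sequences[OF U False f] by metis
  then show ?thesis by (rule MA_eq_subdiff_measure[OF U f])
qed

section \<open>Atoms of local valuations on support functions\<close>

lemma restr_in_Conv: "convex_on U g \<Longrightarrow> restr U g \<in> Conv U"
  by (auto simp: Conv_def restr_def convex_on_def convexD)

lemma orth_proj_hyperplane:
  assumes a: "a \<noteq> 0" and q: "a \<bullet> q = 0"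
  shows "q \<bullet> orth_proj {z. a \<bullet> z = 0} y = q \<bullet> y"
proof -
  define E where "E = {z. a \<bullet> z = 0}"
  define p where "p = y - ((a \<bullet> y) / (a \<bullet> a)) *\<^sub>R a"
  have "orth_proj E y = p"
    unfolding orth_proj_def
  proof (rule the_equality)
    show *: "p \<in> E \<and> (\<forall>z\<in>E. (y - p) \<bullet> z = 0)"
      using a by (simp add: E_def p_def inner_diff_right)
    fix p' assume p': "p' \<in> E \<and> (\<forall>z\<in>E. (y - p') \<bullet> z = 0)"
    then have d: "p' - p \<in> E" using * by (simp add: E_def inner_diff_right)
    have "(y - p) \<bullet> (p' - p) = 0" "(y - p') \<bullet> (p' - p) = 0" using d * p' by blast+
    then have "(p' - p) \<bullet> (p' - p) = 0" by (simp add: inner_diff_left)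
    then show "p' = p" by simp
  qed
  moreover have "q \<bullet> p = q \<bullet> y" using q by (simp add: p_def inner_diff_right inner_commute)
  ultimately show ?thesis by (simp add: E_def)
qed

lemma convex_on_supp:
  assumes P: "bounded P" "P \<noteq> {}" and U: "convex U"
  shows "convex_on U (\<lambda>y. supp P (y - x))"
proof (rule convex_onI)
  fix t :: real and y z assume t: "t > 0" "t < 1"
  show "supp P ((1 - t) *\<^sub>R y + t *\<^sub>R z - x) \<le> (1 - t) * supp P (y - x) + t * supp P (z - x)"
  proof (rule supp_least[OF P(2)])
    fix p assume p: "p \<in> P"
    have "p \<bullet> ((1 - t) *\<^sub>R y + t *\<^sub>R z - x) = (1 - t) * (p \<bullet> (y - x)) + t * (p \<bullet> (z - x))"
      by (simp add: inner_diff_right inner_add_right algebra_simps)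
    also have "\<dots> \<le> (1 - t) * supp P (y - x) + t * supp P (z - x)"
      using t supp_upper[OF P(1) p] by (intro add_mono mult_left_mono) auto
    finally show "p \<bullet> ((1 - t) *\<^sub>R y + t *\<^sub>R z - x) \<le> (1 - t) * supp P (y - x) + t * supp P (z - x)" .
  qed
qed fact

lemma supp_translate:
  assumes P: "bounded P" "P \<noteq> {}"
  shows "supp ((+) c ` P) y = c \<bullet> y + supp P y"
proof (rule antisym)
  show "supp ((+) c ` P) y \<le> c \<bullet> y + supp P y"
    using P supp_upper[OF P(1)] by (intro supp_least) (auto simp: inner_add_left)
  have b: "bounded ((+) c ` P)" using P(1) by (rule bounded_translation)
  have "supp P y \<le> supp ((+) c ` P) y - c \<bullet> y"
  proof (rule supp_least[OF P(2)])
    fix p assume "p \<in> P"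
    then have "(c + p) \<bullet> y \<le> supp ((+) c ` P) y" by (intro supp_upper[OF b]) auto
    then show "p \<bullet> y \<le> supp ((+) c ` P) y - c \<bullet> y" by (simp add: inner_add_left)
  qed
  then show "c \<bullet> y + supp P y \<le> supp ((+) c ` P) y" by simp
qed

lemma supp_attained:
  assumes "compact P" "P \<noteq> {}"
  obtains p where "p \<in> P" "supp P y = p \<bullet> y"
proof -
  have "continuous_on P (\<lambda>p. p \<bullet> y)" by (intro continuous_intros)
  then obtain p where p: "p \<in> P" "\<And>q. q \<in> P \<Longrightarrow> q \<bullet> y \<le> p \<bullet> y"
    using continuous_attains_sup[OF assms] by blast
  then have "supp P y = p \<bullet> y"
    using assms by (intro antisym supp_least supp_upper) (auto simp: compact_imp_bounded)
  then show ?thesis using that p(1) by blast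
qed

lemma supp_zero: "P \<noteq> {} \<Longrightarrow> supp P 0 = 0"
  by (simp add: supp_def)

lemma supp_Un:
  assumes P: "bounded P" "P \<noteq> {}" and Q: "bounded Q" "Q \<noteq> {}"
  shows "supp (P \<union> Q) y = max (supp P y) (supp Q y)"
proof (rule antisym)
  have b: "bounded (P \<union> Q)" using P Q by simp
  show "supp (P \<union> Q) y \<le> max (supp P y) (supp Q y)"
  proof (rule supp_least)
    show "p \<bullet> y \<le> max (supp P y) (supp Q y)" if "p \<in> P \<union> Q" for p
      using that supp_upper[OF P(1), of p y] supp_upper[OF Q(1), of p y] by (auto simp: le_max_iff_disj)
  qed (use P in auto)
  show "max (supp P y) (supp Q y) \<le> supp (P \<union> Q) y"
    using P Q supp_upper[OF b] by (auto intro!: supp_least)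
qed

text \<open>A point of \<open>P\<close> on either side of the hyperplane can be joined inside \<open>P\<close>, and a linear
  functional at the crossing point is at least the smaller of its values at the two end points.\<close>
lemma supp_Int_hyperplane:
  assumes P: "compact P" "convex P" and ne: "P \<inter> {p. p \<bullet> k \<le> c} \<noteq> {}" "P \<inter> {p. c \<le> p \<bullet> k} \<noteq> {}"
  shows "P \<inter> {p. p \<bullet> k = c} \<noteq> {}"
    and "supp (P \<inter> {p. p \<bullet> k = c}) y = min (supp (P \<inter> {p. p \<bullet> k \<le> c}) y) (supp (P \<inter> {p. c \<le> p \<bullet> k}) y)"
proof -
  have cr: "\<exists>r\<in>P \<inter> {p. p \<bullet> k = c}. min (p \<bullet> y) (q \<bullet> y) \<le> r \<bullet> y"
    if p: "p \<in> P" "p \<bullet> k \<le> c" and q: "q \<in> P" "c \<le> q \<bullet> k" for p q y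
  proof (cases "p \<bullet> k = c")
    case True then show ?thesis using p by (intro bexI[of _ p]) auto
  next
    case False
    define t where "t = (c - p \<bullet> k) / (q \<bullet> k - p \<bullet> k)"
    have pos: "q \<bullet> k - p \<bullet> k > 0" using False p q by simp
    have t: "0 \<le> t" "t \<le> 1" using p q pos by (auto simp: t_def)
    define r where "r = (1 - t) *\<^sub>R p + t *\<^sub>R q"
    have "r \<in> P" unfolding r_def using P(2) p q t by (simp add: convexD)
    moreover have "r \<bullet> k = p \<bullet> k + t * (q \<bullet> k - p \<bullet> k)" by (simp add: r_def inner_add_left algebra_simps)
    then have "r \<bullet> k = c" using pos by (simp add: t_def)
    moreover have "min (p \<bullet> y) (q \<bullet> y) \<le> r \<bullet> y"
    proof -
      have "(1 - t) * min (p \<bullet> y) (q \<bullet> y) + t * min (p \<bullet> y) (q \<bullet> y) \<le> (1 - t) * (p \<bullet> y) + t * (q \<bullet> y)"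
        using t by (intro add_mono mult_left_mono) auto
      then show ?thesis by (simp add: r_def inner_add_left algebra_simps)
    qed
    ultimately show ?thesis by blast
  qed
  show ne3: "P \<inter> {p. p \<bullet> k = c} \<noteq> {}" using cr ne by blast
  have b: "bounded P" using P(1) by (rule compact_imp_bounded)
  have cl: "closed {p. p \<bullet> k \<le> c}" "closed {p. c \<le> p \<bullet> k}"
    by (intro closed_Collect_le continuous_intros)+
  obtain p where p: "p \<in> P \<inter> {p. p \<bullet> k \<le> c}" "supp (P \<inter> {p. p \<bullet> k \<le> c}) y = p \<bullet> y"
    using supp_attained[OF compact_Int_closed[OF P(1) cl(1)] ne(1)] by blast
  obtain q where q: "q \<in> P \<inter> {p. c \<le> p \<bullet> k}" "supp (P \<inter> {p. c \<le> p \<bullet> k}) y = q \<bullet> y"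
    using supp_attained[OF compact_Int_closed[OF P(1) cl(2)] ne(2)] by blast
  obtain r where r: "r \<in> P \<inter> {p. p \<bullet> k = c}" "min (p \<bullet> y) (q \<bullet> y) \<le> r \<bullet> y" using cr[of p q y] p q by auto
  have bI: "bounded (P \<inter> X)" for X using b by (rule bounded_subset) auto
  show "supp (P \<inter> {p. p \<bullet> k = c}) y = min (supp (P \<inter> {p. p \<bullet> k \<le> c}) y) (supp (P \<inter> {p. c \<le> p \<bullet> k}) y)"
  proof (rule antisym)
    show "min (supp (P \<inter> {p. p \<bullet> k \<le> c}) y) (supp (P \<inter> {p. c \<le> p \<bullet> k}) y) \<le> supp (P \<inter> {p. p \<bullet> k = c}) y"
      using r supp_upper[OF bI r(1), of y] p(2) q(2) by simp
    have le: "supp (P \<inter> {p. p \<bullet> k = c}) y \<le> supp (P \<inter> X) y" if "{p. p \<bullet> k = c} \<subseteq> X" for X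
      using that by (intro supp_least[OF ne3] supp_upper[OF bI]) auto
    show "supp (P \<inter> {p. p \<bullet> k = c}) y \<le> min (supp (P \<inter> {p. p \<bullet> k \<le> c}) y) (supp (P \<inter> {p. c \<le> p \<bullet> k}) y)"
      by (intro min.boundedI le) auto
  qed
qed

section \<open>Local vanishing of complex Radon measures\<close>

lemma cradon_sums_zero:
  assumes m: "cradon U m" and B: "relcpt_borel U (\<Union>i::nat. D i)" and D: "\<And>i. D i \<in> sets borel" "disjoint_family D"
    and z: "\<And>i. m (D i) = 0"
  shows "m (\<Union>i. D i) = 0"
proof -
  obtain M1 M2 M3 M4 where rep: "cradon_rep U m M1 M2 M3 M4" using m by (auto simp: cradon_def)
  have rD: "relcpt_borel U (D i)" for i by (rule relcpt_borel_subset[OF B D(1)]) auto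
  have s: "(\<lambda>i. measure M (D i)) sums measure M (\<Union>i. D i)" if "lfm U M" for M
  proof (rule measure_UNION)
    have sM: "sets M = sets borel" using that by (rule lfm_sets)
    then show "range D \<subseteq> sets M" using D(1) by auto
    have "emeasure M (\<Union>i. D i) \<le> emeasure M (closure (\<Union>i. D i))"
      using sM by (intro emeasure_mono closure_subset) auto
    also have "\<dots> < \<infinity>" using lfm_compact[OF that] B by (auto simp: relcpt_borel_def)
    finally show "emeasure M (\<Union>i. D i) \<noteq> \<infinity>" by simp
  qed fact
  have l: "lfm U M1" "lfm U M2" "lfm U M3" "lfm U M4" and v: "\<And>B. relcpt_borel U B \<Longrightarrow> m B = complex_of_real (measure M1 B - measure M2 B)
                       + \<i> * complex_of_real (measure M3 B - measure M4 B)"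
    using rep by (auto simp: cradon_rep_def)
  have "(\<lambda>i. complex_of_real (measure M1 (D i) - measure M2 (D i)) + \<i> * complex_of_real (measure M3 (D i) - measure M4 (D i)))
     sums (complex_of_real (measure M1 (\<Union>i. D i) - measure M2 (\<Union>i. D i)) + \<i> * complex_of_real (measure M3 (\<Union>i. D i) - measure M4 (\<Union>i. D i)))"
    by (intro sums_add sums_mult sums_of_real sums_diff s l)
  then have "(\<lambda>i. m (D i)) sums m (\<Union>i. D i)" by (simp only: v[OF rD] v[OF B])
  then show ?thesis using z by (simp add: sums_unique2[OF _ sums_zero])
qed

text \<open>By Lindelof's theorem countably many of the neighbourhoods cover \<open>B\<close>. Made
  disjoint, they cut \<open>B\<close> into countably many sets of measure 0, and countable
  additivity is available inside a relatively compact set.\<close>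

lemma cradon_local_zero:
  assumes m: "cradon U m" and B: "relcpt_borel U B"
    and loc: "\<And>x. x \<in> B \<Longrightarrow> \<exists>V. open V \<and> x \<in> V \<and> (\<forall>B'. relcpt_borel U B' \<longrightarrow> m (B' \<inter> V) = 0)"
  shows "m B = 0"
proof (cases "B = {}")
  case True
  have "m ({} :: (real^'a) set) = 0"
    using cradon_sums_zero[OF m, of "\<lambda>_. {}"] m by (auto simp: cradon_def cradon_rep_def)
  then show ?thesis using True by simp
next
  case False
  define \<F> where "\<F> = {V. open V \<and> (\<forall>B'. relcpt_borel U B' \<longrightarrow> m (B' \<inter> V) = 0)}"
  obtain \<F>' where F: "\<F>' \<subseteq> \<F>" "countable \<F>'" "\<Union>\<F>' = \<Union>\<F>"
    using Lindelof[of \<F>] by (auto simp: \<F>_def)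
  have BF: "B \<subseteq> \<Union>\<F>'" unfolding F(3) using loc by (auto simp: \<F>_def)
  then have "\<F>' \<noteq> {}" using False by auto
  define V where "V = from_nat_into \<F>'"
  have ran: "range V = \<F>'" unfolding V_def using F(2) \<open>\<F>' \<noteq> {}\<close> by (simp add: range_from_nat_into)
  then have V: "open (V i)" "\<And>B'. relcpt_borel U B' \<Longrightarrow> m (B' \<inter> V i) = 0" for i
    using F(1) by (auto simp: \<F>_def)
  define D where "D i = B \<inter> disjointed V i" for i
  have Bb: "B \<in> sets borel" using B by (simp add: relcpt_borel_def)
  have dV: "disjointed V i \<in> sets borel" for i
    using V(1) by (simp add: disjointed_def)
  have BD: "(\<Union>i. D i) = B"
  proof -
    have "(\<Union>i. D i) = B \<inter> (\<Union>i. disjointed V i)" by (auto simp: D_def)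
    also have "(\<Union>i. disjointed V i) = \<Union>\<F>'" using ran by (simp add: UN_disjointed_eq)
    finally show ?thesis using BF by auto
  qed
  have "m (\<Union>i. D i) = 0"
  proof (rule cradon_sums_zero[OF m])
    show "relcpt_borel U (\<Union>i. D i)" using BD B by simp
    show Db: "D i \<in> sets borel" for i using Bb dV by (simp add: D_def)
    show "disjoint_family D" using disjoint_family_disjointed[of V] by (auto simp: D_def disjoint_family_on_def)
    show "m (D i) = 0" for i
    proof -
      have "relcpt_borel U (D i)" by (rule relcpt_borel_subset[OF B Db]) (auto simp: D_def)
      from V(2)[OF this, of i] show ?thesis
        using disjointed_subset[of V i] by (simp add: D_def Int_absorb2 inf.absorb1 le_infI2)
    qed
  qed
  then show ?thesis using BD by simp
qed

lemma relcpt_singleton: "v \<in> U \<Longrightarrow> relcpt_borel U {v}"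
  by (simp add: relcpt_borelI_compact)

section \<open>The valuation on cones and on maxima of affine functions\<close>

locale local_valuation =
  fixes U :: "(real^'n) set" and \<Psi> :: "(real^'n \<Rightarrow> real) \<Rightarrow> ((real^'n) set \<Rightarrow> complex)"
  assumes opn: "open U" and cnv: "convex U"
    and radon: "\<And>f. f \<in> Conv U \<Longrightarrow> cradon U (\<Psi> f)"
    and cont: "cont_val U \<Psi>"
    and val: "is_valuation U \<Psi>"
    and inv: "dually_epi_translation_invariant U \<Psi>"
    and simple: "dually_simple U \<Psi>"
    and locl: "locally_determined U \<Psi>"
begin

text \<open>Continuity is assumed for filters on functions; a sequence enters through its image
  filter.\<close>

lemma seq_cont:
  assumes g: "\<And>n::nat. g n \<in> Conv U" and f: "f \<in> Conv U" and lim: "conv_lim U g f sequentially" and \<phi>: "Cc U \<phi>"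
  shows "(\<lambda>n. cr_int U (\<Psi> (g n)) \<phi>) \<longlonglongrightarrow> cr_int U (\<Psi> f) \<phi>"
proof -
  let ?F = "filtermap g sequentially"
  have "eventually (\<lambda>h. h \<in> Conv U) ?F" using g by (simp add: eventually_filtermap)
  moreover have "conv_lim U id f ?F" using lim by (simp add: conv_lim_def eventually_filtermap)
  ultimately have "wstar_lim U \<Psi> (\<Psi> f) ?F" using cont f unfolding cont_val_def by blast
  then show ?thesis using \<phi> by (simp add: wstar_lim_def filterlim_filtermap)
qed

definition maxaff_on :: "((real^'n) \<times> real) set \<Rightarrow> real^'n \<Rightarrow> real" where "maxaff_on A = restr U (maxaff A)"
text \<open>For compact convex \<open>P\<close> and \<open>x\<close> in \<open>U\<close>, the cone
  with apex \<open>x\<close> whose subdifferential at \<open>x\<close> is \<open>P\<close>.\<close>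

definition cone_fun :: "(real^'n) set \<Rightarrow> real^'n \<Rightarrow> real^'n \<Rightarrow> real" where "cone_fun P x = restr U (\<lambda>y. supp P (y - x))"
text \<open>The value 0 at the empty set keeps the atom additive when a cutting hyperplane misses
  \<open>P\<close>.\<close>

definition atom :: "real^'n \<Rightarrow> (real^'n) set \<Rightarrow> complex" where "atom x P = (if P = {} then 0 else \<Psi> (cone_fun P x) {x})"

lemma maxaff_on_Conv: "finite A \<Longrightarrow> A \<noteq> {} \<Longrightarrow> maxaff_on A \<in> Conv U"
  unfolding maxaff_on_def by (intro restr_in_Conv convex_on_maxaff cnv)

lemma cone_fun_Conv: "bounded P \<Longrightarrow> P \<noteq> {} \<Longrightarrow> cone_fun P x \<in> Conv U"
  unfolding cone_fun_def by (intro restr_in_Conv convex_on_supp cnv)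

lemma invar: "f \<in> Conv U \<Longrightarrow> \<Psi> (restr U (\<lambda>x. f x + (c \<bullet> x + b))) = \<Psi> f"
  using inv unfolding dually_epi_translation_invariant_def by blast

lemma Psi_add_const:
  assumes P: "bounded P" "P \<noteq> {}"
  shows "\<Psi> (restr U (\<lambda>y. b + supp P (y - x))) = \<Psi> (cone_fun P x)"
proof -
  have "restr U (\<lambda>y. b + supp P (y - x)) = restr U (\<lambda>y. cone_fun P x y + (0 \<bullet> y + b))"
    by (auto simp: cone_fun_def restr_def fun_eq_iff)
  then show ?thesis by (simp only: invar[OF cone_fun_Conv[OF P]])
qed

lemma Psi_translate:
  assumes P: "bounded P" "P \<noteq> {}"
  shows "\<Psi> (cone_fun ((+) c ` P) x) = \<Psi> (cone_fun P x)"
proof -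
  have "cone_fun ((+) c ` P) x = restr U (\<lambda>y. cone_fun P x y + (c \<bullet> y + (- (c \<bullet> x))))"
    by (auto simp: cone_fun_def restr_def fun_eq_iff supp_translate[OF P] inner_diff_right)
  then show ?thesis by (simp only: invar[OF cone_fun_Conv[OF P]])
qed

lemma atom_translate:
  assumes P: "bounded P"
  shows "atom x ((+) c ` P) = atom x P"
  using Psi_translate[OF P] by (simp add: atom_def)

text \<open>Translating \<open>P\<close> changes the cone by an affine function, so \<open>P\<close>
  may be moved into a linear hyperplane \<open>E\<close>. Its support function then depends only on
  the projection of the argument to \<open>E\<close>, and dual simplicity applies.\<close>

lemma Psi_in_hyperplane:
  assumes P: "bounded P" "P \<noteq> {}" and h: "in_hyperplane P"
  shows "\<Psi> (cone_fun P x) = (\<lambda>B. 0)"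
proof -
  obtain a \<beta> where a: "a \<noteq> 0" "\<And>p. p \<in> P \<Longrightarrow> a \<bullet> p = \<beta>" using h by (auto simp: in_hyperplane_def)
  obtain p0 where p0: "p0 \<in> P" using P by blast
  define Q where "Q = (+) (- p0) ` P"
  have Q: "bounded Q" "Q \<noteq> {}"
    unfolding Q_def using P(2) by (auto intro!: bounded_translation P(1) simp del: add_uminus_conv_diff uminus_add_conv_diff)
  define E where "E = {z. a \<bullet> z = 0}"
  have QE: "a \<bullet> q = 0" if "q \<in> Q" for q using that a(2) p0 by (auto simp: Q_def inner_add_right inner_diff_right)
  have "subspace E" unfolding E_def by (rule subspace_hyperplane)
  moreover have "a \<notin> E" using a(1) by (simp add: E_def)
  moreover have "convex_on E (\<lambda>z. supp Q (z - x))"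
    by (rule convex_on_supp[OF Q subspace_imp_convex]) fact
  ultimately have z: "\<Psi> (restr U (\<lambda>y. supp Q (orth_proj E y - x))) = (\<lambda>B. 0)"
    using simple unfolding dually_simple_def by blast
  have "supp Q (orth_proj E y - x) = supp Q (y - x)" for y
  proof -
    have "q \<bullet> (orth_proj E y - x) = q \<bullet> (y - x)" if "q \<in> Q" for q
      using orth_proj_hyperplane[OF a(1) QE[OF that], of y] by (simp add: E_def inner_diff_right)
    then show ?thesis unfolding supp_def by simp
  qed
  then have "\<Psi> (cone_fun Q x) = (\<lambda>B. 0)" using z by (simp add: cone_fun_def)
  then show ?thesis unfolding Q_def Psi_translate[OF P] .
qed

lemma atom_in_hyperplane: "bounded P \<Longrightarrow> in_hyperplane P \<Longrightarrow> atom x P = 0"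
  using Psi_in_hyperplane by (simp add: atom_def)

lemma locl_open:
  assumes "f \<in> Conv U" "h \<in> Conv U" "open V" "\<And>y. y \<in> V \<inter> U \<Longrightarrow> f y = h y" "relcpt_borel U B"
  shows "\<Psi> f (B \<inter> V) = \<Psi> h (B \<inter> V)"
proof -
  have "open (V \<inter> U) \<and> V \<inter> U \<subseteq> U \<and> (\<forall>x\<in>V \<inter> U. f x = h x)" using assms opn by auto
  then have "\<Psi> f (B \<inter> (V \<inter> U)) = \<Psi> h (B \<inter> (V \<inter> U))"
    using locl assms unfolding locally_determined_def by blast
  moreover have "B \<inter> (V \<inter> U) = B \<inter> V" using assms(5) by (auto simp: relcpt_borel_def)
  ultimately show ?thesis by simp
qed

text \<open>Near \<open>x\<close> the maximum is a constant plus the cone over its cell; local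
  determination and invariance under constants transfer the values of \<open>\<Psi>\<close>.\<close>

lemma maxaff_on_local:
  assumes A: "finite A" "A \<noteq> {}"
  obtains e where "e > 0" "\<And>B. relcpt_borel U B \<Longrightarrow> \<Psi> (maxaff_on A) (B \<inter> ball x e) = \<Psi> (cone_fun (cell A x) x) (B \<inter> ball x e)"
proof -
  obtain e where e: "e > 0" "\<And>y. y \<in> ball x e \<Longrightarrow> maxaff A y = maxaff A x + supp (cell A x) (y - x)"
    using maxaff_local[OF A] by blast
  have P: "bounded (cell A x)" "cell A x \<noteq> {}"
    using compact_cell[OF A(1)] compact_imp_bounded cell_nonempty[OF A] by blast+
  define h where "h = restr U (\<lambda>y. maxaff A x + supp (cell A x) (y - x))"
  have "convex_on U (\<lambda>y. maxaff A x + supp (cell A x) (y - x))"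
    using convex_on_supp[OF P cnv] cnv by (intro convex_on_add) (simp_all add: convex_on_const)
  then have h: "h \<in> Conv U" unfolding h_def by (rule restr_in_Conv)
  show ?thesis
  proof (rule that[OF e(1)])
    fix B assume "relcpt_borel U B"
    then have "\<Psi> (maxaff_on A) (B \<inter> ball x e) = \<Psi> h (B \<inter> ball x e)"
      using e(2) by (intro locl_open maxaff_on_Conv A h) (auto simp: maxaff_on_def h_def restr_def)
    then show "\<Psi> (maxaff_on A) (B \<inter> ball x e) = \<Psi> (cone_fun (cell A x) x) (B \<inter> ball x e)"
      unfolding h_def Psi_add_const[OF P] .
  qed
qed

lemma Psi_maxaff_on_atom:
  assumes A: "finite A" "A \<noteq> {}" and v: "v \<in> U"
  shows "\<Psi> (maxaff_on A) {v} = atom v (cell A v)"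
proof -
  obtain e where e: "e > 0" "\<And>B. relcpt_borel U B \<Longrightarrow> \<Psi> (maxaff_on A) (B \<inter> ball v e) = \<Psi> (cone_fun (cell A v) v) (B \<inter> ball v e)"
    using maxaff_on_local[OF A] by blast
  have "{v} \<inter> ball v e = {v}" using e(1) by auto
  then show ?thesis using e(2)[OF relcpt_singleton[OF v]] cell_nonempty[OF A] by (simp add: atom_def)
qed

lemma in_hyperplane_hull: "in_hyperplane S \<Longrightarrow> in_hyperplane (convex hull S)"
proof -
  assume "in_hyperplane S"
  then obtain a \<beta> where a: "a \<noteq> 0" "\<forall>s\<in>S. a \<bullet> s = \<beta>" by (auto simp: in_hyperplane_def)
  have "convex hull S \<subseteq> {s. a \<bullet> s = \<beta>}" using a(2) by (intro hull_minimal convex_hyperplane) auto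
  then show ?thesis using a(1) unfolding in_hyperplane_def by (intro exI[of _ a] exI[of _ \<beta>]) auto
qed

lemma Psi_add:
  assumes f: "f \<in> Conv U" and B: "relcpt_borel U B" "relcpt_borel U C" "B \<inter> C = {}"
  shows "relcpt_borel U (B \<union> C)" "\<Psi> f (B \<union> C) = \<Psi> f B + \<Psi> f C"
proof -
  show BC: "relcpt_borel U (B \<union> C)" using B by (auto simp: relcpt_borel_def compact_Un)
  obtain M1 M2 M3 M4 where rep: "cradon_rep U (\<Psi> f) M1 M2 M3 M4" using radon[OF f] by (auto simp: cradon_def)
  have a: "measure M (B \<union> C) = measure M B + measure M C" if M: "lfm U M" for M
  proof (rule measure_Union)
    have fin: "emeasure M X \<noteq> \<infinity>" if "relcpt_borel U X" for X
    proof -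
      have "emeasure M X \<le> emeasure M (closure X)"
        using lfm_sets[OF M] by (intro emeasure_mono closure_subset) auto
      also have "\<dots> < \<infinity>" using lfm_compact[OF M] that by (auto simp: relcpt_borel_def)
      finally show ?thesis by simp
    qed
    show "emeasure M B \<noteq> \<infinity>" "emeasure M C \<noteq> \<infinity>" using fin B by auto
    show "B \<in> sets M" "C \<in> sets M" using B lfm_sets[OF M] by (auto simp: relcpt_borel_def)
  qed fact
  show "\<Psi> f (B \<union> C) = \<Psi> f B + \<Psi> f C"
    using rep B(1,2) BC by (simp add: cradon_rep_def a algebra_simps)
qed

lemma Psi_empty:
  assumes f: "f \<in> Conv U" shows "\<Psi> f {} = 0"
  using Psi_add(2)[OF f, of "{}" "{}"] relcpt_borelI_compact[of "{}" U] by simp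

text \<open>A point that is not a vertex has a flat cell, so the measure vanishes near it, and by
  \<open>cradon_local_zero\<close> on the whole complement of the vertices. The finitely many
  vertices are then added one at a time.\<close>

lemma Psi_maxaff_on:
  assumes A: "finite A" "A \<noteq> {}" and B: "relcpt_borel U B"
  shows "\<Psi> (maxaff_on A) B = (\<Sum>v\<in>vertices A \<inter> U. if v \<in> B then atom v (cell A v) else 0)"
proof -
  have fV: "finite (vertices A)" by (rule finite_vertices[OF A])
  have RC: "maxaff_on A \<in> Conv U" by (rule maxaff_on_Conv[OF A])
  have clV: "closed (vertices A)" using fV by (rule finite_imp_closed)
  have Bb: "B \<in> sets borel" using B by (simp add: relcpt_borel_def)
  have off: "\<Psi> (maxaff_on A) (B - vertices A) = 0"
  proof (rule cradon_local_zero[OF radon[OF RC]])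
    show "relcpt_borel U (B - vertices A)"
      using clV Bb by (intro relcpt_borel_subset[OF B]) auto
    fix x assume x: "x \<in> B - vertices A"
    obtain e where e: "e > 0" "\<And>B. relcpt_borel U B \<Longrightarrow> \<Psi> (maxaff_on A) (B \<inter> ball x e) = \<Psi> (cone_fun (cell A x) x) (B \<inter> ball x e)"
      using maxaff_on_local[OF A] by blast
    have "in_hyperplane (cell A x)" using x in_hyperplane_hull by (auto simp: vertices_def cell_def)
    then have "\<Psi> (cone_fun (cell A x) x) = (\<lambda>B. 0)"
      using compact_cell[OF A(1)] compact_imp_bounded cell_nonempty[OF A] by (intro Psi_in_hyperplane) blast+
    then show "\<exists>V. open V \<and> x \<in> V \<and> (\<forall>B'. relcpt_borel U B' \<longrightarrow> \<Psi> (maxaff_on A) (B' \<inter> V) = 0)"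
      using e by (intro exI[of _ "ball x e"]) auto
  qed
  have "relcpt_borel U (B - vertices A \<union> T) \<and> \<Psi> (maxaff_on A) (B - vertices A \<union> T) = (\<Sum>v\<in>T. atom v (cell A v))"
    if "finite T" "T \<subseteq> vertices A \<inter> B" for T
    using that
  proof (induction T rule: finite_induct)
    case empty
    have "relcpt_borel U (B - vertices A)" using clV Bb by (intro relcpt_borel_subset[OF B]) auto
    then show ?case using off by simp
  next
    case (insert v T)
    have v: "v \<in> U" using insert.prems B by (auto simp: relcpt_borel_def)
    have eq: "B - vertices A \<union> insert v T = (B - vertices A \<union> T) \<union> {v}" by auto
    have d: "(B - vertices A \<union> T) \<inter> {v} = {}" using insert by auto
    have IH: "relcpt_borel U (B - vertices A \<union> T)" "\<Psi> (maxaff_on A) (B - vertices A \<union> T) = (\<Sum>v\<in>T. atom v (cell A v))"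
      using insert by auto
    show ?case unfolding eq using Psi_add[OF RC IH(1) relcpt_singleton[OF v] d] IH(2) insert.hyps Psi_maxaff_on_atom[OF A v]
      by simp
  qed
  from this[of "vertices A \<inter> B"] fV
  have "\<Psi> (maxaff_on A) (B - vertices A \<union> vertices A \<inter> B) = (\<Sum>v\<in>vertices A \<inter> B. atom v (cell A v))" by auto
  moreover have "B - vertices A \<union> vertices A \<inter> B = B" by auto
  moreover have "(\<Sum>v\<in>vertices A \<inter> B. atom v (cell A v)) = (\<Sum>v\<in>vertices A \<inter> U. if v \<in> B then atom v (cell A v) else 0)"
    by (rule sum.mono_neutral_cong_left) (use fV B in \<open>auto simp: relcpt_borel_def\<close>)
  ultimately show ?thesis by simp
qed

lemma cr_int_maxaff_on:
  assumes A: "finite A" "A \<noteq> {}" and \<phi>: "Cc U \<phi>"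
  shows "cr_int U (\<Psi> (maxaff_on A)) \<phi> = (\<Sum>v\<in>vertices A \<inter> U. atom v (cell A v) * \<phi> v)"
  using cr_int_finite_support[OF opn radon[OF maxaff_on_Conv[OF A]] _ _ \<phi> Psi_maxaff_on[OF A]] finite_vertices[OF A] by simp

text \<open>The offsets make every piece vanish at \<open>x\<close>, so that all are active
  there.\<close>

definition cone_pieces :: "(real^'n) set \<Rightarrow> real^'n \<Rightarrow> ((real^'n) \<times> real) set" where
  "cone_pieces S x = (\<lambda>s. (s, - (s \<bullet> x))) ` S"

text \<open>At a point \<open>y\<close> other than \<open>x\<close> all active slopes have the same
  product with \<open>y - x\<close>, so \<open>x\<close> is the only candidate for a vertex.\<close>

lemma cone_pieces:
  assumes S: "finite S" "S \<noteq> {}"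
  shows "cone_fun (convex hull S) x = maxaff_on (cone_pieces S x)" "cell (cone_pieces S x) x = convex hull S"
    "vertices (cone_pieces S x) \<subseteq> {x}"
proof -
  have m: "maxaff (cone_pieces S x) y = supp (convex hull S) (y - x)" for y
    unfolding supp_hull[OF S] maxaff_def cone_pieces_def by (simp add: image_image inner_diff_right)
  then have "(\<lambda>y. supp (convex hull S) (y - x)) = maxaff (cone_pieces S x)" by (simp add: fun_eq_iff)
  then show "cone_fun (convex hull S) x = maxaff_on (cone_pieces S x)" by (simp add: cone_fun_def maxaff_on_def)
  have s0: "supp (convex hull S) (x - x) = 0" using S by (simp add: supp_zero)
  have "active (cone_pieces S x) x = cone_pieces S x"
    unfolding active_def m s0 by (auto simp: cone_pieces_def)
  then show "cell (cone_pieces S x) x = convex hull S" by (simp add: cell_def cone_pieces_def image_image)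
  show "vertices (cone_pieces S x) \<subseteq> {x}"
  proof (rule subsetI, rule ccontr)
    fix y assume y: "y \<in> vertices (cone_pieces S x)" "y \<notin> {x}"
    have "(y - x) \<bullet> s = supp (convex hull S) (y - x)" if "s \<in> fst ` active (cone_pieces S x) y" for s
      using that unfolding active_def m by (auto simp: cone_pieces_def inner_diff_left inner_diff_right inner_commute)
    moreover have "y - x \<noteq> 0" using y(2) by simp
    ultimately have "in_hyperplane (fst ` active (cone_pieces S x) y)" unfolding in_hyperplane_def by blast
    then show False using y(1) by (simp add: vertices_def)
  qed
qed

lemma cr_int_cone_fun:
  assumes S: "finite S" "S \<noteq> {}" and x: "x \<in> U" and \<phi>: "Cc U \<phi>"
  shows "cr_int U (\<Psi> (cone_fun (convex hull S) x)) \<phi> = atom x (convex hull S) * \<phi> x"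
proof -
  have A: "finite (cone_pieces S x)" "cone_pieces S x \<noteq> {}" using S by (auto simp: cone_pieces_def)
  have "cr_int U (\<Psi> (cone_fun (convex hull S) x)) \<phi> = (\<Sum>v\<in>vertices (cone_pieces S x) \<inter> U. atom v (cell (cone_pieces S x) v) * \<phi> v)"
    unfolding cone_pieces(1)[OF S] by (rule cr_int_maxaff_on[OF A \<phi>])
  \<comment> \<open>If \<open>x\<close> is not a vertex, the hull is flat and its atom is 0, so the
    single term is correct in either case.\<close>
  also have "\<dots> = (\<Sum>v\<in>{x}. atom v (cell (cone_pieces S x) v) * \<phi> v)"
  proof (rule sum.mono_neutral_left)
    show "vertices (cone_pieces S x) \<inter> U \<subseteq> {x}" using cone_pieces(3)[OF S] by auto
    show "\<forall>v\<in>{x} - vertices (cone_pieces S x) \<inter> U. atom v (cell (cone_pieces S x) v) * \<phi> v = 0"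
    proof
      fix v assume "v \<in> {x} - vertices (cone_pieces S x) \<inter> U"
      then have "in_hyperplane (cell (cone_pieces S x) v)"
        using x in_hyperplane_hull by (auto simp: vertices_def cell_def)
      then show "atom v (cell (cone_pieces S x) v) * \<phi> v = 0"
        using atom_in_hyperplane compact_imp_bounded[OF compact_cell[OF A(1)]] by simp
    qed
  qed simp
  finally show ?thesis using cone_pieces(2)[OF S] by simp
qed

text \<open>Moving the apex changes the cone by at most a constant times the displacement, so the
  measures converge weakly. Each has no mass off its apex, and a test function equal to 1 near
  \<open>x\<close> reads off the atom.\<close>

lemma continuous_atom:
  assumes S: "finite S" "S \<noteq> {}"
  shows "continuous_on U (\<lambda>x. atom x (convex hull S))"
  unfolding continuous_on_sequentially
proof (intro allI ballI impI)
  fix xs x assume x: "x \<in> U" and xs: "(\<forall>n. xs n \<in> U) \<and> xs \<longlonglongrightarrow> x"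
  let ?P = "convex hull S"
  have P: "bounded ?P" "?P \<noteq> {}" using S by (auto simp: bounded_convex_hull finite_imp_bounded)
  obtain B where B: "\<And>p. p \<in> ?P \<Longrightarrow> norm p \<le> B" using P(1) by (auto simp: bounded_iff)
  have "0 \<le> B" using P(2) B norm_ge_zero order_trans by (metis ex_in_conv)
  obtain d where d: "d > 0" "cball x d \<subseteq> U" using opn x open_contains_cball by blast
  obtain \<phi> :: "nat \<Rightarrow> real^'n \<Rightarrow> real" and L where \<phi>:
      "\<And>j. Cc U (\<lambda>x. of_real (\<phi> j x))" "compact L" "L \<subseteq> U" "\<And>j x. 0 \<le> \<phi> j x" "\<And>j x. \<phi> j x \<le> indicator L x"
      "\<And>y. (\<lambda>j. \<phi> j y) \<longlonglongrightarrow> indicator (cball x d) y"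
      "\<And>j y. y \<in> cball x d \<Longrightarrow> \<phi> j y = 1" "\<And>j. continuous_on UNIV (\<phi> j)"
      by (rule Cc_bump[OF compact_cball opn d(2)]) (erule that, assumption+)
  let ?\<phi> = "\<lambda>x. complex_of_real (\<phi> 0 x)"
  have lip: "\<bar>supp ?P (y - z) - supp ?P (y - w)\<bar> \<le> B * dist z w" for y z w
  proof -
    have "supp ?P (y - z) \<le> supp ?P (y - w) + B * dist z w" for z w
    proof (rule supp_least[OF P(2)])
      fix p assume p: "p \<in> ?P"
      have "p \<bullet> (y - z) = p \<bullet> (y - w) + p \<bullet> (w - z)" by (simp add: inner_diff_right)
      also have "p \<bullet> (w - z) \<le> norm p * norm (w - z)" by (rule norm_cauchy_schwarz)
      also have "\<dots> \<le> B * dist z w" using B[OF p] by (simp add: dist_norm norm_minus_commute mult_right_mono)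
      finally show "p \<bullet> (y - z) \<le> supp ?P (y - w) + B * dist z w" using supp_upper[OF P(1) p, of "y - w"] by linarith
    qed
    from this[of z w] this[of w z] show ?thesis by (simp add: dist_commute abs_le_iff)
  qed
  have lim: "conv_lim U (\<lambda>n. cone_fun ?P (xs n)) (cone_fun ?P x) sequentially"
    unfolding conv_lim_def
  proof (intro allI impI)
    fix K :: "(real^'n) set" and r :: real assume "r > 0"
    have "(\<lambda>n. B * dist (xs n) x) \<longlonglongrightarrow> B * dist x x" using xs by (intro tendsto_intros) auto
    then have "eventually (\<lambda>n. B * dist (xs n) x < r) sequentially"
      using \<open>r > 0\<close> order_tendstoD(2)[of _ "B * dist x x" _ r] by simp
    then show "eventually (\<lambda>n. \<forall>y\<in>K. \<bar>cone_fun ?P (xs n) y - cone_fun ?P x y\<bar> < r) sequentially"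
    proof eventually_elim
      case (elim n)
      show ?case
      proof
        fix y
        show "\<bar>cone_fun ?P (xs n) y - cone_fun ?P x y\<bar> < r"
          using le_less_trans[OF lip elim, of y] \<open>r > 0\<close> by (auto simp: cone_fun_def restr_def)
      qed
    qed
  qed
  have c: "(\<lambda>n. cr_int U (\<Psi> (cone_fun ?P (xs n))) ?\<phi>) \<longlonglongrightarrow> cr_int U (\<Psi> (cone_fun ?P x)) ?\<phi>"
    by (rule seq_cont[OF cone_fun_Conv[OF P] cone_fun_Conv[OF P] lim \<phi>(1)])
  have "\<phi> 0 x = 1" using \<phi>(7)[of x 0] d(1) by simp
  then have "cr_int U (\<Psi> (cone_fun ?P x)) ?\<phi> = atom x ?P" using cr_int_cone_fun[OF S x \<phi>(1)] by simp
  moreover have "eventually (\<lambda>n. cr_int U (\<Psi> (cone_fun ?P (xs n))) ?\<phi> = atom (xs n) ?P) sequentially"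
  proof -
    have "eventually (\<lambda>n. dist (xs n) x < d) sequentially" using xs d(1) tendstoD by blast
    then show ?thesis
    proof eventually_elim
      case (elim n)
      then have "\<phi> 0 (xs n) = 1" using \<phi>(7)[of "xs n" 0] by (simp add: dist_commute)
      moreover have "xs n \<in> U" using xs by blast
      ultimately show ?case using cr_int_cone_fun[OF S _ \<phi>(1), of "xs n" 0] by simp
    qed
  qed
  ultimately have "(\<lambda>n. atom (xs n) ?P) \<longlonglongrightarrow> atom x ?P" using c by (simp add: tendsto_cong)
  then show "((\<lambda>x. atom x ?P) \<circ> xs) \<longlonglongrightarrow> atom x ?P" by (simp add: o_def)
qed

text \<open>For the two halves of \<open>P\<close> the maximum of the cones is the cone over
  \<open>P\<close>, and the minimum is the cone over the section by the hyperplane, which is flat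
  and contributes nothing.\<close>

lemma atom_cut:
  assumes P: "compact P" "convex P" and k: "k \<noteq> 0"
  shows "atom x P = atom x (P \<inter> {p. p \<bullet> k \<le> c}) + atom x (P \<inter> {p. c \<le> p \<bullet> k})"
proof -
  let ?P1 = "P \<inter> {p. p \<bullet> k \<le> c}" and ?P2 = "P \<inter> {p. c \<le> p \<bullet> k}" and ?P0 = "P \<inter> {p. p \<bullet> k = c}"
  have un: "?P1 \<union> ?P2 = P" by auto
  show ?thesis
  proof (cases "?P1 = {} \<or> ?P2 = {}")
    case True
    then have "(?P1 = {} \<and> ?P2 = P) \<or> (?P2 = {} \<and> ?P1 = P)" using un by blast
    then show ?thesis
    proof
      assume *: "?P1 = {} \<and> ?P2 = P"
      show ?thesis unfolding conjunct1[OF *] conjunct2[OF *] by (simp add: atom_def)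
    next
      assume *: "?P2 = {} \<and> ?P1 = P"
      show ?thesis unfolding conjunct1[OF *] conjunct2[OF *] by (simp add: atom_def)
    qed
  next
    case False
    then have ne: "?P1 \<noteq> {}" "?P2 \<noteq> {}" by auto
    have b: "bounded P" using P(1) by (rule compact_imp_bounded)
    have bI: "bounded (P \<inter> X)" for X using b by (rule bounded_subset) auto
    note I = supp_Int_hyperplane[OF P ne]
    have Pne: "P \<noteq> {}" using ne by blast
    have s: "sup (cone_fun ?P1 x) (cone_fun ?P2 x) = cone_fun P x"
    proof
      fix y
      have "supp P (y - x) = max (supp ?P1 (y - x)) (supp ?P2 (y - x))"
        using supp_Un[OF bI ne(1) bI ne(2), of "y - x"] unfolding un .
      then show "sup (cone_fun ?P1 x) (cone_fun ?P2 x) y = cone_fun P x y" by (simp add: cone_fun_def restr_def sup_max)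
    qed
    have i: "inf (cone_fun ?P1 x) (cone_fun ?P2 x) = cone_fun ?P0 x"
    proof
      fix y
      show "inf (cone_fun ?P1 x) (cone_fun ?P2 x) y = cone_fun ?P0 x y" by (simp add: cone_fun_def restr_def inf_min I(2))
    qed
    have "(\<lambda>B. \<Psi> (cone_fun ?P1 x) B + \<Psi> (cone_fun ?P2 x) B) = (\<lambda>B. \<Psi> (cone_fun P x) B + \<Psi> (cone_fun ?P0 x) B)"
      using val[unfolded is_valuation_def, rule_format, OF cone_fun_Conv[OF bI ne(1), of x] cone_fun_Conv[OF bI ne(2), of x]]
        cone_fun_Conv[OF b Pne] cone_fun_Conv[OF bI I(1)] unfolding s i by blast
    moreover have "in_hyperplane ?P0" unfolding in_hyperplane_def using k by (auto intro!: exI[of _ k] simp: inner_commute)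
    then have "\<Psi> (cone_fun ?P0 x) = (\<lambda>B. 0)" by (rule Psi_in_hyperplane[OF bI I(1)])
    ultimately have "\<Psi> (cone_fun ?P1 x) {x} + \<Psi> (cone_fun ?P2 x) {x} = \<Psi> (cone_fun P x) {x}" by (simp add: fun_eq_iff)
    then show ?thesis using ne Pne by (simp add: atom_def)
  qed
qed

end

section \<open>Uniform bounds\<close>

text \<open>By Baire's theorem one of the closed sets \<open>G n\<close> contains a ball;
  differences of its points give a bound near the origin, and scaling extends it.\<close>

proposition uniform_boundedness:
  fixes T :: "nat \<Rightarrow> 'a::{real_normed_vector,complete_space} \<Rightarrow> 'b::real_normed_vector"
  assumes T: "\<And>k. bounded_linear (T k)" and pw: "\<And>x. bounded (range (\<lambda>k. T k x))"
  shows "\<exists>C. \<forall>k x. norm (T k x) \<le> C * norm x"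
proof -
  define G where "G n = {x. \<forall>k. norm (T k x) \<le> real n}" for n
  have clG: "closed (G n)" for n
  proof -
    have "closed {x. norm (T k x) \<le> real n}" for k
      using T[of k] by (intro closed_Collect_le continuous_intros linear_continuous_on) auto
    moreover have "G n = (\<Inter>k. {x. norm (T k x) \<le> real n})" by (auto simp: G_def)
    ultimately show ?thesis by (simp add: closed_INT)
  qed
  have "x \<in> \<Union>(range G)" for x
  proof -
    obtain B where B: "\<And>k. norm (T k x) \<le> B" using pw[of x] by (auto simp: bounded_iff)
    obtain n :: nat where "B \<le> real n" using real_arch_simple by blast
    then have "x \<in> G n" using B order_trans by (auto simp: G_def)
    then show ?thesis by blast
  qed
  then have UG: "\<Union>(range G) = UNIV" by blast
  have "\<exists>n. interior (G n) \<noteq> {}"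
  proof (rule ccontr)
    assume "\<not> ?thesis"
    then have i: "\<And>n. interior (G n) = {}" by simp
    have "Met_TC.mtopology interior_of \<Union>(range G) = ({} :: 'a set)"
    proof (rule Met_TC.metric_Baire_category_alt)
      show "Met_TC.mcomplete TYPE('a)" unfolding mcomplete_iff_complete by (rule complete_UNIV)
      show "countable (range G)" by simp
      fix S assume "S \<in> range G"
      then show "closedin Met_TC.mtopology S \<and> Met_TC.mtopology interior_of S = {}"
        using clG i by (auto simp: interior_of_def interior_def)
    qed
    then show False unfolding UG by (auto simp: interior_of_def)
  qed
  then obtain n y where "y \<in> interior (G n)" by blast
  then obtain r where r: "r > 0" "ball y r \<subseteq> G n" by (meson mem_interior)
  have b: "norm (T k x) \<le> (4 * real n / r) * norm x" for k x
  proof (cases "x = 0")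
    case True
    then show ?thesis using linear_0[OF bounded_linear.linear[OF T[of k]]] by simp
  next
    case False
    define z where "z = (r / 2 / norm x) *\<^sub>R x"
    have "norm z = r / 2" using False r(1) by (simp add: z_def)
    then have "y + z \<in> ball y r" "y \<in> ball y r" using r(1) by (auto simp: dist_norm)
    then have "y + z \<in> G n" "y \<in> G n" using r(2) by blast+
    then have "norm (T k (y + z)) \<le> n" "norm (T k y) \<le> n" unfolding G_def by blast+
    moreover have "T k z = T k (y + z) - T k y" using linear_add[OF bounded_linear.linear[OF T[of k]]] by simp
    ultimately have "norm (T k z) \<le> 2 * real n" using norm_triangle_ineq4[of "T k (y + z)" "T k y"] by simp
    moreover have "T k z = (r / 2 / norm x) *\<^sub>R T k x"
      unfolding z_def by (rule linear_scale[OF bounded_linear.linear[OF T[of k]]])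
    ultimately have "(r / 2 / norm x) * norm (T k x) \<le> 2 * real n" using r(1) by simp
    then show ?thesis using False r(1) by (simp add: field_simps)
  qed
  then show ?thesis by blast
qed

context local_valuation begin

text \<open>Affine pieces of size at most \<open>1/(k+1)\<close> give functions converging to \<open>0\<close>, so the measures
  converge weakly and are therefore uniformly bounded.\<close>
lemma atoms_bounded:
  assumes K: "compact K" "K \<subseteq> U"
  shows "\<exists>C \<eta>. \<eta> > 0 \<and> (\<forall>A S. finite A \<longrightarrow> A \<noteq> {} \<longrightarrow> (\<forall>p\<in>A. norm (fst p) \<le> \<eta> \<and> \<bar>snd p\<bar> \<le> \<eta>) \<longrightarrow>
     finite S \<longrightarrow> S \<subseteq> K \<longrightarrow> (\<Sum>v\<in>S. norm (atom v (cell A v))) \<le> C)"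
proof (rule ccontr)
  define Q where "Q C \<eta> \<longleftrightarrow> (\<forall>A S. finite A \<longrightarrow> A \<noteq> {} \<longrightarrow> (\<forall>p\<in>A. norm (fst p) \<le> \<eta> \<and> \<bar>snd p\<bar> \<le> \<eta>) \<longrightarrow>
     finite S \<longrightarrow> S \<subseteq> K \<longrightarrow> (\<Sum>v\<in>S. norm (atom v (cell A v))) \<le> C)" for C \<eta>
  assume *: "\<not> ?thesis"
  \<comment> \<open>One counterexample for every \<open>k\<close>, with bound \<open>k\<close> and
    piece size \<open>1/(k+1)\<close>: the functions tend to 0 while the sums of atoms grow without
    bound.\<close>
  define P where "P k A S \<longleftrightarrow> finite A \<and> A \<noteq> {} \<and> (\<forall>p\<in>A. norm (fst p) \<le> inverse (real (Suc k)) \<and> \<bar>snd p\<bar> \<le> inverse (real (Suc k))) \<and>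
     finite S \<and> S \<subseteq> K \<and> real k < (\<Sum>v\<in>S. norm (atom v (cell A v)))" for k A S
  have "\<exists>A S. P k A S" for k
  proof -
    have "\<not> Q (real k) (inverse (real (Suc k)))"
    proof
      assume "Q (real k) (inverse (real (Suc k)))"
      moreover have "inverse (real (Suc k)) > 0" by simp
      ultimately show False using * unfolding Q_def[symmetric] by blast
    qed
    then show ?thesis
      unfolding P_def Q_def not_all not_imp not_le by blast
  qed
  then obtain A S where P: "\<And>k. P k (A k) (S k)" by metis
  have A: "finite (A k)" "A k \<noteq> {}" for k using P[of k] unfolding P_def by blast+
  have small: "norm (fst p) \<le> inverse (real (Suc k)) \<and> \<bar>snd p\<bar> \<le> inverse (real (Suc k))" if "p \<in> A k" for k p
    using P[of k] that unfolding P_def by blast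
  have S: "finite (S k)" "S k \<subseteq> K" "real k < (\<Sum>v\<in>S k. norm (atom v (cell (A k) v)))" for k
    using P[of k] unfolding P_def by blast+
  define f0 where "f0 = restr U (\<lambda>_. 0)"
  have f0: "f0 \<in> Conv U" unfolding f0_def using cnv by (intro restr_in_Conv) (simp add: convex_on_const)
  have lim: "conv_lim U (\<lambda>k. maxaff_on (A k)) f0 sequentially"
    unfolding conv_lim_def
  proof (intro allI impI)
    fix L :: "(real^'n) set" and r :: real assume L: "compact L \<and> L \<subseteq> U" and r: "r > 0"
    then have "bounded L" by (simp add: compact_imp_bounded)
    then obtain B where B: "\<And>x. x \<in> L \<Longrightarrow> norm x \<le> B" by (auto simp: bounded_iff)
    have l0: "(\<lambda>k. inverse (real (Suc k)) * (\<bar>B\<bar> + 1)) \<longlonglongrightarrow> 0 * (\<bar>B\<bar> + 1)"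
      by (intro tendsto_intros LIMSEQ_inverse_real_of_nat)
    have "eventually (\<lambda>k. inverse (real (Suc k)) * (\<bar>B\<bar> + 1) < r) sequentially"
      by (rule order_tendstoD(2)[OF l0]) (use r in simp)
    then show "eventually (\<lambda>k. \<forall>x\<in>L. \<bar>maxaff_on (A k) x - f0 x\<bar> < r) sequentially"
    proof eventually_elim
      case (elim k)
      show ?case
      proof
        fix x assume x: "x \<in> L"
        obtain p where p: "p \<in> A k" "maxaff (A k) x = fst p \<bullet> x + snd p" using maxaff_attained[OF A] by blast
        have "\<bar>fst p \<bullet> x\<bar> \<le> norm (fst p) * norm x" by (rule Cauchy_Schwarz_ineq2)
        also have "\<dots> \<le> inverse (real (Suc k)) * \<bar>B\<bar>"
          using small[OF p(1)] B[OF x] by (intro mult_mono) auto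
        finally have "\<bar>fst p \<bullet> x + snd p\<bar> \<le> inverse (real (Suc k)) * (\<bar>B\<bar> + 1)"
          using small[OF p(1)] by (simp only: distrib_left) linarith
        then have "\<bar>maxaff (A k) x\<bar> < r" using elim p(2) by linarith
        then show "\<bar>maxaff_on (A k) x - f0 x\<bar> < r" using x L r by (auto simp: maxaff_on_def f0_def restr_def)
      qed
    qed
  qed
  obtain \<kappa> :: "nat \<Rightarrow> real^'n \<Rightarrow> real" and L where \<kappa>:
      "\<And>j. Cc U (\<lambda>x. of_real (\<kappa> j x))" "compact L" "L \<subseteq> U" "\<And>j x. 0 \<le> \<kappa> j x" "\<And>j x. \<kappa> j x \<le> indicator L x"
      "\<And>y. (\<lambda>j. \<kappa> j y) \<longlonglongrightarrow> indicator K y"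
      "\<And>j y. y \<in> K \<Longrightarrow> \<kappa> j y = 1" "\<And>j. continuous_on UNIV (\<kappa> j)"
      by (rule Cc_bump[OF K(1) opn K(2)]) (erule that, assumption+)
  \<comment> \<open>Multiplication by this cutoff turns bounded continuous functions, which form a
    Banach space, into test functions; it equals 1 on \<open>K\<close>, where the sums are
    taken.\<close>
  define c where "c = (\<lambda>x. complex_of_real (\<kappa> 0 x))"
  have c: "Cc U c" unfolding c_def by (rule \<kappa>(1))
  define V where "V k = vertices (A k) \<inter> U" for k
  have fV: "finite (V k)" for k using finite_vertices[OF A] by (simp add: V_def)
  define T :: "nat \<Rightarrow> ((real^'n) \<Rightarrow>\<^sub>C complex) \<Rightarrow> complex" where
    "T k \<phi> = (\<Sum>v\<in>V k. atom v (cell (A k) v) * (c v * apply_bcontfun \<phi> v))" for k \<phi>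
  have Tint: "T k \<phi> = cr_int U (\<Psi> (maxaff_on (A k))) (\<lambda>x. c x * apply_bcontfun \<phi> x)" for k \<phi>
    unfolding T_def V_def by (rule cr_int_maxaff_on[OF A Cc_mult[OF c], symmetric]) simp
  have bl: "bounded_linear (T k)" for k
  proof (rule bounded_linear_intro)
    show "T k (x + y) = T k x + T k y" for x y
      by (simp add: T_def plus_bcontfun.rep_eq sum.distrib distrib_left)
    show "T k (r *\<^sub>R x) = r *\<^sub>R T k x" for r x
      by (simp add: T_def scaleR_bcontfun.rep_eq scaleR_sum_right)
    show "norm (T k x) \<le> norm x * (\<Sum>v\<in>V k. norm (atom v (cell (A k) v) * c v))" for x
    proof -
      have "norm (T k x) \<le> (\<Sum>v\<in>V k. norm (atom v (cell (A k) v) * c v) * norm x)"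
        unfolding T_def
      proof (rule order_trans[OF norm_sum sum_mono])
        fix v
        have "norm (atom v (cell (A k) v) * (c v * apply_bcontfun x v)) = norm (atom v (cell (A k) v) * c v) * norm (apply_bcontfun x v)"
          by (simp add: norm_mult mult.assoc)
        also have "\<dots> \<le> norm (atom v (cell (A k) v) * c v) * norm x" by (intro mult_left_mono norm_bounded) auto
        finally show "norm (atom v (cell (A k) v) * (c v * apply_bcontfun x v)) \<le> norm (atom v (cell (A k) v) * c v) * norm x" .
      qed
      then show ?thesis by (simp add: sum_distrib_right mult.commute[of "norm x"])
    qed
  qed
  have "bounded (range (\<lambda>k. T k \<phi>))" for \<phi>
  proof -
    have "(\<lambda>k. T k \<phi>) \<longlonglongrightarrow> cr_int U (\<Psi> f0) (\<lambda>x. c x * apply_bcontfun \<phi> x)"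
      unfolding Tint by (rule seq_cont[OF maxaff_on_Conv[OF A] f0 lim Cc_mult[OF c]]) simp
    then show ?thesis by (rule convergent_imp_bounded)
  qed
  then have "\<exists>C. \<forall>k \<phi>. norm (T k \<phi>) \<le> C * norm \<phi>" by (rule uniform_boundedness[OF bl])
  then obtain C where C: "\<And>k \<phi>. norm (T k \<phi>) \<le> C * norm \<phi>" by blast
  obtain k :: nat where k: "\<bar>C\<bar> < real k" using reals_Archimedean2 by blast
  define z where "z v = atom v (cell (A k) v)" for v
  \<comment> \<open>Conjugate phases at the points of \<open>S k\<close> and 0 at the other
    vertices. An extension bounded by 1 turns the functional \<open>T k\<close> into the sum of the
    norms of the atoms.\<close>
  define h where "h v = (if v \<in> S k then cnj (sgn (z v)) else 0)" for v
  obtain g where g: "continuous_on UNIV g" "\<And>v. v \<in> V k \<union> S k \<Longrightarrow> g v = h v" "\<And>x. norm (g x) \<le> 1"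
  proof (rule Tietze[of "V k \<union> S k" h UNIV 1])
    show "continuous_on (V k \<union> S k) h" using fV S(1) by (intro continuous_on_finite) auto
    show "closedin (top_of_set UNIV) (V k \<union> S k)" using fV[of k] S(1)[of k] by (auto intro: finite_imp_closed)
    show "norm (h x) \<le> 1" for x by (simp add: h_def norm_sgn)
  qed auto
  have "g \<in> bcontfun" using g(1,3) by (auto simp: bcontfun_def bounded_iff)
  then have ag: "apply_bcontfun (Bcontfun g) = g" by (rule Bcontfun_inverse)
  have "norm (Bcontfun g) \<le> 1" by (rule norm_bound) (simp add: ag g(3))
  then have "C * norm (Bcontfun g) \<le> \<bar>C\<bar> * 1" by (intro mult_mono) auto
  then have "norm (T k (Bcontfun g)) \<le> \<bar>C\<bar>" using C[of k "Bcontfun g"] by linarith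
  moreover have "T k (Bcontfun g) = of_real (\<Sum>v\<in>S k. norm (z v))"
  proof -
    have SU: "S k \<subseteq> U" using S(2) K(2) by blast
    have "T k (Bcontfun g) = (\<Sum>v\<in>V k. z v * (c v * g v))" by (simp add: T_def ag z_def)
    also have "\<dots> = (\<Sum>v\<in>S k. z v * (c v * g v))"
    proof (rule sum.mono_neutral_cong)
      show "z v * (c v * g v) = 0" if "v \<in> V k - S k" for v using that g(2)[of v] by (simp add: h_def)
      \<comment> \<open>A point of \<open>S k\<close> need not be a vertex; its cell is then flat
        and its atom is 0.\<close>
      show "z v * (c v * g v) = 0" if v: "v \<in> S k - V k" for v
      proof -
        have "v \<notin> vertices (A k)" using v SU by (auto simp: V_def)
        then have "in_hyperplane (cell (A k) v)" using in_hyperplane_hull by (auto simp: vertices_def cell_def)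
        then show ?thesis using atom_in_hyperplane compact_imp_bounded[OF compact_cell[OF A(1)]] by (simp add: z_def)
      qed
    qed (use fV S(1) in auto)
    also have "\<dots> = (\<Sum>v\<in>S k. of_real (norm (z v)))"
    proof (rule sum.cong)
      fix v assume v: "v \<in> S k"
      have "c v = 1" using \<kappa>(7)[of v 0] v S(2) by (auto simp: c_def)
      moreover have "g v = cnj (sgn (z v))" using g(2)[of v] v by (simp add: h_def)
      moreover have "z v * cnj (sgn (z v)) = of_real (norm (z v))"
      proof (cases "z v = 0")
        case False
        have "z v * cnj (sgn (z v)) = (z v * cnj (z v)) / of_real (norm (z v))"
          by (simp add: sgn_eq)
        also have "\<dots> = of_real ((norm (z v))\<^sup>2) / of_real (norm (z v))" by (simp only: complex_norm_square[symmetric])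
        finally show ?thesis using False by (simp add: power2_eq_square)
      qed simp
      ultimately show "z v * (c v * g v) = of_real (norm (z v))" by simp
    qed simp
    finally show ?thesis by simp
  qed
  ultimately have "(\<Sum>v\<in>S k. norm (z v)) \<le> \<bar>C\<bar>"
    by (metis norm_of_real abs_le_D1)
  then show False using S(3)[of k] k by (simp add: z_def)
qed

section \<open>Many translates of one polytope along a lattice\<close>

definition lattice_box :: "('n \<Rightarrow> nat) \<Rightarrow> (real^'n) set" where
  "lattice_box m = (\<lambda>f. \<chi> i. real (f i)) ` (\<Pi>\<^sub>E i\<in>UNIV. {..<m i})"

lemma lattice_box:
  "finite (lattice_box m)" "card (lattice_box m) = (\<Prod>i\<in>UNIV. m i)"
  "a \<in> lattice_box m \<Longrightarrow> \<exists>j. a $ i = real j \<and> j < m i"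
proof -
  have fin: "finite (\<Pi>\<^sub>E i\<in>(UNIV :: 'n set). {..<m i})" by (rule finite_PiE) auto
  then show "finite (lattice_box m)" by (simp add: lattice_box_def)
  have "inj_on (\<lambda>f. \<chi> i. real (f i)) (\<Pi>\<^sub>E i\<in>(UNIV :: 'n set). {..<m i})"
    by (rule inj_onI) (auto simp: vec_eq_iff)
  then show "card (lattice_box m) = (\<Prod>i\<in>UNIV. m i)"
    by (simp add: lattice_box_def card_image card_PiE)
  show "a \<in> lattice_box m \<Longrightarrow> \<exists>j. a $ i = real j \<and> j < m i"
    by (auto simp: lattice_box_def PiE_def)
qed

text \<open>Pieces of the function that is the maximum, over the lattice points \<open>a\<close>, of
  \<open>supp (convex hull S) (y - x - d a)\<close> plus the tangent at \<open>x + d a\<close> to the quadratic form with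
  coefficients \<open>3 r\<^sub>i / (2 d)\<close>. The quadratic gap between different tangents exceeds the support
  functions, so that every lattice point carries a translate of \<open>convex hull S\<close>.\<close>
definition lattice_pieces :: "(real^'n) \<Rightarrow> real \<Rightarrow> real^'n \<Rightarrow> (real^'n) set \<Rightarrow> (real^'n) set \<Rightarrow> ((real^'n) \<times> real) set" where
  "lattice_pieces x d r S L = (\<lambda>(s, a). (s + (\<chi> i. 3 * r $ i * a $ i),
      - ((s + (\<chi> i. 3 * r $ i * a $ i)) \<bullet> x) - d * (s \<bullet> a + (\<Sum>i\<in>UNIV. 3 / 2 * r $ i * (a $ i)\<^sup>2)))) ` (S \<times> L)"

text \<open>At \<open>x + d *\<^sub>R a\<close> a piece of another lattice point \<open>b\<close>
  loses \<open>d\<close> times the difference between the sum of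
  \<open>3/2 r_i (a_i - b_i)^2\<close> and \<open>s \<bullet> (a - b)\<close>. This is positive,
  since an integer is at most its square in absolute value and the coordinates of \<open>s\<close>
  are at most \<open>r_i\<close>.\<close>

lemma cell_lattice_pieces:
  assumes S: "finite S" "S \<noteq> {}" "\<And>s i. s \<in> S \<Longrightarrow> \<bar>s $ i\<bar> \<le> r $ i" and r: "\<And>i. 0 < r $ i" and d: "d > 0"
    and a: "a \<in> lattice_box m"
  shows "cell (lattice_pieces x d r S (lattice_box m)) (x + d *\<^sub>R a) = (+) (\<chi> i. 3 * r $ i * a $ i) ` (convex hull S)"
proof -
  let ?A = "lattice_pieces x d r S (lattice_box m)"
  define q where "q = (\<Sum>i\<in>UNIV. 3 / 2 * r $ i * (a $ i)\<^sup>2)"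
  define pc where "pc s b = (s + (\<chi> i. 3 * r $ i * b $ i),
      - ((s + (\<chi> i. 3 * r $ i * b $ i)) \<bullet> x) - d * (s \<bullet> b + (\<Sum>i\<in>UNIV. 3 / 2 * r $ i * (b $ i)\<^sup>2)))" for s b
  have A_eq: "?A = (\<lambda>(s, b). pc s b) ` (S \<times> lattice_box m)" by (simp add: lattice_pieces_def pc_def)
  have fA: "finite ?A" unfolding A_eq using S(1) lattice_box(1) by (intro finite_imageI finite_cartesian_product)
  let ?v = "x + d *\<^sub>R a"
  \<comment> \<open>Completing the square isolates the loss of the pieces of \<open>b\<close>
    against those of \<open>a\<close>.\<close>
  have pval: "fst (pc s b) \<bullet> ?v + snd (pc s b) = d * (q + (s \<bullet> (a - b) - (\<Sum>i\<in>UNIV. 3 / 2 * r $ i * (a $ i - b $ i)\<^sup>2)))" for s b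
  proof -
    have "fst (pc s b) \<bullet> ?v + snd (pc s b) = d * ((s + (\<chi> i. 3 * r $ i * b $ i)) \<bullet> a - (s \<bullet> b + (\<Sum>i\<in>UNIV. 3 / 2 * r $ i * (b $ i)\<^sup>2)))"
      by (simp add: pc_def inner_add_right algebra_simps)
    also have "(s + (\<chi> i. 3 * r $ i * b $ i)) \<bullet> a - (s \<bullet> b + (\<Sum>i\<in>UNIV. 3 / 2 * r $ i * (b $ i)\<^sup>2))
       = s \<bullet> (a - b) + (\<Sum>i\<in>UNIV. 3 * r $ i * b $ i * a $ i - 3 / 2 * r $ i * (b $ i)\<^sup>2)"
      by (simp add: inner_add_left inner_diff_right sum_subtractf inner_vec_def[of "vec_lambda _"])
    also have "(\<Sum>i\<in>UNIV. 3 * r $ i * b $ i * a $ i - 3 / 2 * r $ i * (b $ i)\<^sup>2) = q - (\<Sum>i\<in>UNIV. 3 / 2 * r $ i * (a $ i - b $ i)\<^sup>2)"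
      unfolding q_def sum_subtractf[symmetric] by (intro sum.cong) (auto simp: power2_eq_square algebra_simps)
    finally show ?thesis by (simp add: algebra_simps)
  qed
  have less: "s \<bullet> (a - b) - (\<Sum>i\<in>UNIV. 3 / 2 * r $ i * (a $ i - b $ i)\<^sup>2) < 0"
    if s: "s \<in> S" and b: "b \<in> lattice_box m" "b \<noteq> a" for s b
  proof -
    have sq: "\<bar>a $ i - b $ i\<bar> \<le> (a $ i - b $ i)\<^sup>2" for i
    proof -
      obtain j j' where j: "a $ i = real j" "b $ i = real j'" using lattice_box(3)[OF a] lattice_box(3)[OF b(1)] by blast
      define u where "u = int j - int j'"
      have "\<bar>u\<bar> \<le> u\<^sup>2"
      proof (cases "u = 0")
        case False
        then have "\<bar>u\<bar> * 1 \<le> \<bar>u\<bar> * \<bar>u\<bar>" by (intro mult_left_mono) auto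
        then show ?thesis by (simp add: power2_eq_square abs_mult[symmetric])
      qed simp
      then have "real_of_int \<bar>u\<bar> \<le> real_of_int (u\<^sup>2)" by (simp only: of_int_le_iff)
      then show ?thesis using j by (simp add: u_def)
    qed
    have "\<exists>i. a $ i \<noteq> b $ i" using b(2) by (metis vec_eq_iff)
    then obtain i0 where i0: "a $ i0 \<noteq> b $ i0" by blast
    have "s \<bullet> (a - b) = (\<Sum>i\<in>UNIV. s $ i * (a $ i - b $ i))" by (simp add: inner_vec_def)
    also have "\<dots> < (\<Sum>i\<in>UNIV. 3 / 2 * r $ i * (a $ i - b $ i)\<^sup>2)"
    proof (rule sum_strict_mono_ex1)
      have le: "s $ i * (a $ i - b $ i) \<le> r $ i * (a $ i - b $ i)\<^sup>2" for i
      proof -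
        have "s $ i * (a $ i - b $ i) \<le> \<bar>s $ i\<bar> * \<bar>a $ i - b $ i\<bar>" by (metis abs_ge_self abs_mult)
        also have "\<dots> \<le> r $ i * (a $ i - b $ i)\<^sup>2"
          using S(3)[OF s] sq[of i] r[of i] by (intro mult_mono) auto
        finally show ?thesis .
      qed
      have le2: "r $ i * (a $ i - b $ i)\<^sup>2 \<le> 3 / 2 * r $ i * (a $ i - b $ i)\<^sup>2" for i
        using r[of i] by (intro mult_right_mono) auto
      show "\<forall>i\<in>UNIV. s $ i * (a $ i - b $ i) \<le> 3 / 2 * r $ i * (a $ i - b $ i)\<^sup>2"
        using le le2 order_trans by blast
      have "r $ i0 * (a $ i0 - b $ i0)\<^sup>2 < 3 / 2 * r $ i0 * (a $ i0 - b $ i0)\<^sup>2"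
        using r[of i0] i0 by (intro mult_strict_right_mono) auto
      then show "\<exists>i\<in>UNIV. s $ i * (a $ i - b $ i) < 3 / 2 * r $ i * (a $ i - b $ i)\<^sup>2"
        using le[of i0] by (intro bexI[of _ i0]) auto
    qed simp
    finally show ?thesis by simp
  qed
  have va: "fst (pc s a) \<bullet> ?v + snd (pc s a) = d * q" for s by (simp add: pval)
  have vb: "fst (pc s b) \<bullet> ?v + snd (pc s b) < d * q" if "s \<in> S" "b \<in> lattice_box m" "b \<noteq> a" for s b
    unfolding pval using less[OF that] d by simp
  obtain s0 where s0: "s0 \<in> S" using S(2) by blast
  have ne: "?A \<noteq> {}" unfolding A_eq using s0 a by blast
  have max: "maxaff ?A ?v = d * q"
  proof (rule antisym)
    show "maxaff ?A ?v \<le> d * q"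
      unfolding maxaff_le_iff[OF fA ne]
    proof
      fix p assume "p \<in> ?A"
      then obtain s b where p: "p = pc s b" "s \<in> S" "b \<in> lattice_box m" unfolding A_eq by auto
      show "fst p \<bullet> ?v + snd p \<le> d * q"
        using va[of s] vb[OF p(2,3)] unfolding p(1) by (cases "b = a") (auto intro: less_imp_le)
    qed
    have "pc s0 a \<in> ?A" unfolding A_eq using s0 a by blast
    from maxaff_ge[OF fA this, of ?v] show "d * q \<le> maxaff ?A ?v" unfolding va .
  qed
  have "active ?A ?v = (\<lambda>s. pc s a) ` S"
  proof (intro set_eqI iffI)
    fix p assume p: "p \<in> active ?A ?v"
    then obtain s b where sb: "p = pc s b" "s \<in> S" "b \<in> lattice_box m" unfolding active_def A_eq by auto
    have "fst p \<bullet> ?v + snd p = d * q" using p unfolding active_def max by simp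
    then have "b = a" using vb[OF sb(2,3)] unfolding sb(1) by auto
    then show "p \<in> (\<lambda>s. pc s a) ` S" using sb by blast
  next
    fix p assume "p \<in> (\<lambda>s. pc s a) ` S"
    then obtain s where "p = pc s a" "s \<in> S" by blast
    then show "p \<in> active ?A ?v" unfolding active_def max using va a by (auto simp: A_eq)
  qed
  then have "fst ` active ?A ?v = (+) (\<chi> i. 3 * r $ i * a $ i) ` S"
    by (simp add: image_image pc_def add.commute)
  then show ?thesis unfolding cell_def by (simp add: convex_hull_translation)
qed

text \<open>Translates of one polytope sit at all lattice points, and \<open>atoms_bounded\<close>
  controls the sum of their atoms. As the spacing tends to 0, all of them tend to the atom at
  \<open>x\<close>, by continuity, and the number of lattice points is at least a constant over the
  product of the \<open>r_i\<close>.\<close>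

proposition atom_box_bound:
  assumes x: "x \<in> U"
  shows "\<exists>C \<delta>. \<delta> > 0 \<and> 0 \<le> C \<and> (\<forall>r S. (\<forall>i. 0 < r $ i \<and> r $ i \<le> \<delta>) \<longrightarrow> finite S \<longrightarrow> S \<noteq> {} \<longrightarrow> (\<forall>s\<in>S. \<forall>i. \<bar>s $ i\<bar> \<le> r $ i) \<longrightarrow>
      norm (atom x (convex hull S)) \<le> C * (\<Prod>i\<in>UNIV. r $ i))"
proof -
  obtain \<rho> where \<rho>: "\<rho> > 0" "cball x \<rho> \<subseteq> U" using opn x open_contains_cball by blast
  have "\<exists>C \<eta>. \<eta> > 0 \<and> (\<forall>A S. finite A \<longrightarrow> A \<noteq> {} \<longrightarrow> (\<forall>p\<in>A. norm (fst p) \<le> \<eta> \<and> \<bar>snd p\<bar> \<le> \<eta>) \<longrightarrow>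
     finite S \<longrightarrow> S \<subseteq> cball x \<rho> \<longrightarrow> (\<Sum>v\<in>S. norm (atom v (cell A v))) \<le> C)"
    by (rule atoms_bounded[OF compact_cball \<rho>(2)])
  then obtain C \<eta> where \<eta>: "\<eta> > 0" and C': "\<forall>A S. finite A \<longrightarrow> A \<noteq> {} \<longrightarrow> (\<forall>p\<in>A. norm (fst p) \<le> \<eta> \<and> \<bar>snd p\<bar> \<le> \<eta>) \<longrightarrow>
     finite S \<longrightarrow> S \<subseteq> cball x \<rho> \<longrightarrow> (\<Sum>v\<in>S. norm (atom v (cell A v))) \<le> C"
    by (elim exE conjE)
  have C: "(\<Sum>v\<in>S. norm (atom v (cell A v))) \<le> C" if "finite A" "A \<noteq> {}" "\<And>p. p \<in> A \<Longrightarrow> norm (fst p) \<le> \<eta> \<and> \<bar>snd p\<bar> \<le> \<eta>"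
     "finite S" "S \<subseteq> cball x \<rho>" for A S
    using C'[THEN spec[of _ A], THEN spec[of _ S]] that by blast
  \<comment> \<open>The slopes of the pieces will have coordinates at most
    \<open>4 * \<theta>\<close>. This choice bounds their norm times \<open>norm x + 1\<close> by
    half of \<open>\<eta>\<close> and leaves the other half for the remaining part of the
    offsets.\<close>
  define \<theta> where "\<theta> = \<eta> / (8 * real CARD('n) * (norm x + 1))"
  have nx: "norm x + 1 > 0" by (simp add: add_nonneg_pos)
  have \<theta>: "\<theta> > 0" using \<eta> nx by (simp add: \<theta>_def)
  have \<theta>\<eta>: "real CARD('n) * (4 * \<theta>) * (norm x + 1) = \<eta> / 2"
  proof -
    have "real CARD('n) * (4 * (\<eta> / (8 * real CARD('n) * w))) * w = \<eta> / 2" if "w > 0" for w :: real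
      using that by simp
    from this[OF nx] show ?thesis by (simp only: \<theta>_def)
  qed
  have "norm (atom x (convex hull S)) \<le> (\<bar>C\<bar> * (2 / \<theta>) ^ CARD('n)) * (\<Prod>i\<in>UNIV. r $ i)"
    if r: "\<And>i. 0 < r $ i" "\<And>i. r $ i \<le> \<theta> / 2" and S: "finite S" "S \<noteq> {}" "\<And>s i. s \<in> S \<Longrightarrow> \<bar>s $ i\<bar> \<le> r $ i" for r :: "real^'n" and S
  proof -
    \<comment> \<open>The largest number of steps of length \<open>r $ i\<close> within
      \<open>\<theta>\<close>. As \<open>r $ i\<close> is at most half of \<open>\<theta>\<close>,
      rounding down loses at most a factor 2.\<close>
    define m where "m i = nat \<lfloor>\<theta> / r $ i\<rfloor>" for i
    have m: "real (m i) * r $ i \<le> \<theta>" "\<theta> / (2 * r $ i) \<le> real (m i)" for i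
    proof -
      have ge2: "\<theta> / r $ i \<ge> 2" using r[of i] by (simp add: field_simps)
      then have mi: "real (m i) = of_int \<lfloor>\<theta> / r $ i\<rfloor>" by (simp add: m_def)
      have "real (m i) \<le> \<theta> / r $ i" unfolding mi by linarith
      then show "real (m i) * r $ i \<le> \<theta>" using r[of i] by (simp add: field_simps)
      have "\<theta> / r $ i - 1 \<le> real (m i)" unfolding mi by linarith
      moreover have "\<theta> / (2 * r $ i) = \<theta> / r $ i / 2" by simp
      ultimately show "\<theta> / (2 * r $ i) \<le> real (m i)" using ge2 by linarith
    qed
    let ?L = "lattice_box m"
    have mpos: "0 < real (m i)" for i
    proof -
      have "0 < \<theta> / (2 * r $ i)" using \<theta> r(1)[of i] by simp
      then show ?thesis using m(2)[of i] by linarith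
    qed
    have Lne: "?L \<noteq> {}"
    proof -
      have "card ?L \<noteq> 0" unfolding lattice_box(2) using mpos by simp
      then show ?thesis by auto
    qed
    define D where "D = Max ((\<lambda>(s, a). \<bar>s \<bullet> a + (\<Sum>i\<in>UNIV. 3 / 2 * r $ i * (a $ i)\<^sup>2)\<bar>) ` (S \<times> ?L))"
    have D: "\<bar>s \<bullet> a + (\<Sum>i\<in>UNIV. 3 / 2 * r $ i * (a $ i)\<^sup>2)\<bar> \<le> D" if "s \<in> S" "a \<in> ?L" for s a
      unfolding D_def using that S(1) lattice_box(1) by (intro Max_ge) auto
    obtain s0 a0 where sa0: "s0 \<in> S" "a0 \<in> ?L" using S(2) Lne by blast
    have D0: "0 \<le> D" using D[OF sa0] by (rule order_trans[OF abs_ge_zero])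
    define M where "M = Max (norm ` ?L)"
    have M: "norm a \<le> M" if "a \<in> ?L" for a unfolding M_def using that lattice_box(1) by (intro Max_ge) auto
    have M0: "0 \<le> M" using M[OF sa0(2)] norm_ge_zero order_trans by blast
    \<comment> \<open>Below this spacing the part of the offsets proportional to \<open>d\<close> is
      at most half of \<open>\<eta>\<close>, and the lattice stays in the ball of radius
      \<open>\<rho>\<close>.\<close>
    define d0 where "d0 = min ((\<eta> / 2) / (D + 1)) (\<rho> / (M + 1))"
    have d0: "d0 > 0" using \<eta> \<rho>(1) D0 M0 by (simp add: d0_def)
    have canc: "u / w * w = u" if "w \<noteq> 0" for u w :: real using that by simp
    have bound: "(\<Sum>a\<in>?L. norm (atom (x + d *\<^sub>R a) (convex hull S))) \<le> C" if d: "0 < d" "d \<le> d0" for d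
    proof -
      let ?A = "lattice_pieces x d r S ?L"
      have dD: "d * D \<le> \<eta> / 2"
      proof -
        have "d \<le> (\<eta> / 2) / (D + 1)" using d by (simp add: d0_def)
        then have "d * D \<le> (\<eta> / 2) / (D + 1) * (D + 1)" using d D0 \<eta> by (intro mult_mono) auto
        also have "\<dots> = \<eta> / 2" by (rule canc) (use D0 in linarith)
        finally show ?thesis .
      qed
      have dM: "d * M \<le> \<rho>"
      proof -
        have "d \<le> \<rho> / (M + 1)" using d by (simp add: d0_def)
        then have "d * M \<le> \<rho> / (M + 1) * (M + 1)" using d M0 \<rho>(1) by (intro mult_mono) auto
        also have "\<dots> = \<rho>" by (rule canc) (use M0 in linarith)
        finally show ?thesis .
      qed
      have "(\<Sum>v\<in>(\<lambda>a. x + d *\<^sub>R a) ` ?L. norm (atom v (cell ?A v))) \<le> C"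
      proof (rule C)
        show "finite ?A" unfolding lattice_pieces_def using S(1) lattice_box(1) by (intro finite_imageI finite_cartesian_product)
        show "?A \<noteq> {}" unfolding lattice_pieces_def using sa0 by blast
        show "finite ((\<lambda>a. x + d *\<^sub>R a) ` ?L)" using lattice_box(1) by blast
        show "(\<lambda>a. x + d *\<^sub>R a) ` ?L \<subseteq> cball x \<rho>"
        proof clarify
          fix a assume "a \<in> ?L"
          then have "d * norm a \<le> d * M" using M d by (intro mult_left_mono) auto
          then have "d * norm a \<le> \<rho>" using dM by (rule order_trans)
          then show "x + d *\<^sub>R a \<in> cball x \<rho>" using d by (simp add: dist_norm)
        qed
        fix p assume "p \<in> ?A"
        then obtain s a where sa: "s \<in> S" "a \<in> ?L" and p: "p = (s + (\<chi> i. 3 * r $ i * a $ i),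
          - ((s + (\<chi> i. 3 * r $ i * a $ i)) \<bullet> x) - d * (s \<bullet> a + (\<Sum>i\<in>UNIV. 3 / 2 * r $ i * (a $ i)\<^sup>2)))"
          unfolding lattice_pieces_def by auto
        define w where "w = s + (\<chi> i. 3 * r $ i * a $ i)"
        have wi: "\<bar>w $ i\<bar> \<le> 4 * \<theta>" for i
        proof -
          obtain j where j: "a $ i = real j" "j < m i" using lattice_box(3)[OF sa(2)] by blast
          have nn: "0 \<le> r $ i * a $ i" using r(1)[of i] j by simp
          have w: "w $ i = s $ i + 3 * (r $ i * a $ i)" by (simp add: w_def)
          have "\<bar>w $ i\<bar> \<le> \<bar>s $ i\<bar> + 3 * (r $ i * a $ i)" unfolding w using nn by linarith
          moreover have "r $ i * a $ i \<le> r $ i * real (m i)" using r(1)[of i] j by (intro mult_left_mono) auto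
          then have "r $ i * a $ i \<le> real (m i) * r $ i" by (simp only: mult.commute)
          ultimately have "\<bar>w $ i\<bar> \<le> r $ i + 3 * (real (m i) * r $ i)"
            using S(3)[OF sa(1), of i] by linarith
          also have "\<dots> \<le> \<theta> + 3 * \<theta>" using m(1)[of i] r(2)[of i] \<theta> by linarith
          finally show ?thesis by simp
        qed
        have "norm w \<le> (\<Sum>i\<in>UNIV. \<bar>w $ i\<bar>)" by (rule norm_le_l1_cart)
        also have "\<dots> \<le> (\<Sum>i\<in>(UNIV::'n set). 4 * \<theta>)" by (intro sum_mono wi)
        finally have nw: "norm w \<le> real CARD('n) * (4 * \<theta>)" by simp
        have "norm w * (norm x + 1) \<le> \<eta> / 2"
          unfolding \<theta>\<eta>[symmetric] using nw nx by (intro mult_right_mono) auto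
        then have nw2: "norm w + norm w * norm x \<le> \<eta> / 2" by (simp add: algebra_simps)
        have "norm w * norm x \<ge> 0" by simp
        then have f: "norm (fst p) \<le> \<eta>" using nw2 \<eta> unfolding p w_def[symmetric] fst_conv by linarith
        have "\<bar>w \<bullet> x\<bar> \<le> norm w * norm x" by (rule Cauchy_Schwarz_ineq2)
        moreover have "\<bar>d * (s \<bullet> a + (\<Sum>i\<in>UNIV. 3 / 2 * r $ i * (a $ i)\<^sup>2))\<bar> \<le> d * D"
          unfolding abs_mult using D[OF sa] d by (intro mult_mono) auto
        ultimately have "\<bar>snd p\<bar> \<le> \<eta>"
          using nw2 dD norm_ge_zero[of w] unfolding p w_def[symmetric] snd_conv by linarith
        then show "norm (fst p) \<le> \<eta> \<and> \<bar>snd p\<bar> \<le> \<eta>" using f by blast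
      qed
      also have "inj_on (\<lambda>a. x + d *\<^sub>R a) ?L" using d by (auto simp: inj_on_def)
      then have "(\<Sum>v\<in>(\<lambda>a. x + d *\<^sub>R a) ` ?L. norm (atom v (cell ?A v))) = (\<Sum>a\<in>?L. norm (atom (x + d *\<^sub>R a) (cell ?A (x + d *\<^sub>R a))))"
        by (simp add: sum.reindex)
      also have "\<dots> = (\<Sum>a\<in>?L. norm (atom (x + d *\<^sub>R a) (convex hull S)))"
      proof (rule sum.cong)
        fix a assume a: "a \<in> ?L"
        have "bounded (convex hull S)" using S(1) by (simp add: bounded_convex_hull finite_imp_bounded)
        moreover have "cell ?A (x + d *\<^sub>R a) = (+) (\<chi> i. 3 * r $ i * a $ i) ` (convex hull S)"
          by (rule cell_lattice_pieces[OF S(1,2) _ r(1) d(1) a]) (rule S(3))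
        ultimately show "norm (atom (x + d *\<^sub>R a) (cell ?A (x + d *\<^sub>R a))) = norm (atom (x + d *\<^sub>R a) (convex hull S))"
          by (simp only: atom_translate)
      qed simp
      finally show ?thesis .
    qed
    \<comment> \<open>Neither the number of lattice points nor the slopes depend on the spacing, so
      it may tend to 0 with \<open>r\<close> and \<open>m\<close> fixed.\<close>
    define dn where "dn n = min d0 (inverse (real (Suc n)))" for n
    have dn: "0 < dn n" "dn n \<le> d0" for n using d0 by (auto simp: dn_def)
    have dn0: "dn \<longlonglongrightarrow> 0"
    proof (rule tendsto_sandwich[of "\<lambda>_. 0" _ _ "\<lambda>n. inverse (real (Suc n))"])
      show "eventually (\<lambda>n. 0 \<le> dn n) sequentially" using dn(1) by (intro always_eventually allI less_imp_le)
      show "eventually (\<lambda>n. dn n \<le> inverse (real (Suc n))) sequentially"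
        by (intro always_eventually allI) (simp add: dn_def)
    qed (rule tendsto_const LIMSEQ_inverse_real_of_nat)+
    have "(\<lambda>n. atom (x + dn n *\<^sub>R a) (convex hull S)) \<longlonglongrightarrow> atom x (convex hull S)" for a
    proof -
      have "isCont (\<lambda>x. atom x (convex hull S)) x"
        using continuous_atom[OF S(1,2)] opn x continuous_on_eq_continuous_at by blast
      moreover have "(\<lambda>n. x + dn n *\<^sub>R a) \<longlonglongrightarrow> x + 0 *\<^sub>R a" by (intro tendsto_intros dn0)
      then have "(\<lambda>n. x + dn n *\<^sub>R a) \<longlonglongrightarrow> x" by simp
      ultimately show ?thesis by (rule isCont_tendsto_compose)
    qed
    then have "(\<lambda>n. \<Sum>a\<in>?L. norm (atom (x + dn n *\<^sub>R a) (convex hull S))) \<longlonglongrightarrow> (\<Sum>a\<in>?L. norm (atom x (convex hull S)))"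
      by (intro tendsto_sum tendsto_norm)
    then have "(\<Sum>a\<in>?L. norm (atom x (convex hull S))) \<le> C"
      by (rule LIMSEQ_le_const2) (use bound[OF dn] in blast)
    then have "real (card ?L) * norm (atom x (convex hull S)) \<le> C" by simp
    then have 1: "(\<Prod>i\<in>UNIV. real (m i)) * norm (atom x (convex hull S)) \<le> C" by (simp add: lattice_box(2))
    have "(\<Prod>i\<in>UNIV. \<theta> / (2 * r $ i)) \<le> (\<Prod>i\<in>UNIV. real (m i))"
      using m(2) \<theta> r(1) by (intro prod_mono) (auto simp: less_imp_le)
    then have "(\<Prod>i\<in>UNIV. \<theta> / (2 * r $ i)) * norm (atom x (convex hull S)) \<le> (\<Prod>i\<in>UNIV. real (m i)) * norm (atom x (convex hull S))"
      by (rule mult_right_mono) simp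
    then have 2: "(\<Prod>i\<in>UNIV. \<theta> / (2 * r $ i)) * norm (atom x (convex hull S)) \<le> \<bar>C\<bar>" using 1 by linarith
    have pr: "(\<Prod>i\<in>UNIV. \<theta> / (2 * r $ i)) * ((2 / \<theta>) ^ CARD('n) * (\<Prod>i\<in>UNIV. r $ i)) = 1"
    proof -
      have "(2 / \<theta>) ^ CARD('n) * (\<Prod>i\<in>UNIV. r $ i) = (\<Prod>i\<in>UNIV. (2 / \<theta>) * r $ i)"
        by (simp only: prod.distrib prod_constant)
      then have "(\<Prod>i\<in>UNIV. \<theta> / (2 * r $ i)) * ((2 / \<theta>) ^ CARD('n) * (\<Prod>i\<in>UNIV. r $ i)) = (\<Prod>i\<in>UNIV. \<theta> / (2 * r $ i) * ((2 / \<theta>) * r $ i))"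
        by (simp only: prod.distrib)
      also have "\<dots> = 1"
      proof (rule prod.neutral, rule ballI)
        fix i show "\<theta> / (2 * r $ i) * ((2 / \<theta>) * r $ i) = 1" using \<theta> r(1)[of i] by simp
      qed
      finally show ?thesis .
    qed
    have nn: "0 \<le> (2 / \<theta>) ^ CARD('n) * (\<Prod>i\<in>UNIV. r $ i)" using \<theta> r(1) by (intro mult_nonneg_nonneg prod_nonneg zero_le_power) (auto simp: less_imp_le)
    have "norm (atom x (convex hull S)) = ((\<Prod>i\<in>UNIV. \<theta> / (2 * r $ i)) * norm (atom x (convex hull S))) * ((2 / \<theta>) ^ CARD('n) * (\<Prod>i\<in>UNIV. r $ i))"
      using pr by (simp add: mult.commute mult.left_commute)
    also have "\<dots> \<le> \<bar>C\<bar> * ((2 / \<theta>) ^ CARD('n) * (\<Prod>i\<in>UNIV. r $ i))" by (rule mult_right_mono[OF 2 nn])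
    finally show ?thesis by (simp add: mult.assoc)
  qed
  moreover have "\<theta> / 2 > 0" "0 \<le> \<bar>C\<bar> * (2 / \<theta>) ^ CARD('n)" using \<theta> by auto
  ultimately show ?thesis by blast
qed

end

section \<open>The atoms are proportional to volume\<close>

text \<open>The two hypotheses are those of an \<open>operative\<close> set function, so additivity
  under a single cut gives additivity over every division into boxes.\<close>

lemma additive_tagged_division:
  fixes g :: "'a::euclidean_space set \<Rightarrow> 'b::comm_monoid_add"
  assumes "\<And>a b. box a b = {} \<Longrightarrow> g (cbox a b) = 0"
    and "\<And>a b c k. k \<in> Basis \<Longrightarrow> g (cbox a b) = g (cbox a b \<inter> {x. x \<bullet> k \<le> c}) + g (cbox a b \<inter> {x. c \<le> x \<bullet> k})"
    and p: "p tagged_division_of cbox a b"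
  shows "(\<Sum>(x, K)\<in>p. g K) = g (cbox a b)"
proof -
  interpret operative plus 0 g by standard (fact assms)+
  show ?thesis using tagged_division[OF p] by (simp add: sum_def)
qed

lemma box_empty_in_hyperplane:
  fixes a b :: "real^'n"
  assumes "box a b = {}" "P \<inter> cbox a b \<noteq> {}"
  shows "in_hyperplane (P \<inter> cbox a b)"
proof -
  obtain i where i: "b $ i \<le> a $ i" using assms(1) by (auto simp: interval_eq_empty_cart) 
  have "axis i 1 \<bullet> y = a $ i" if "y \<in> cbox a b" for y
    using that i by (auto simp: mem_box_cart inner_axis' intro: antisym order_trans)
  then show ?thesis unfolding in_hyperplane_def by (intro exI[of _ "axis i 1"] exI[of _ "a $ i"]) (auto simp: axis_eq_0_iff)
qed

lemma measure_Int_box_split: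
  fixes G :: "'a::euclidean_space set"
  assumes G: "G \<in> sets lebesgue" and k: "k \<in> Basis"
  shows "measure lebesgue (G \<inter> cbox a b) = measure lebesgue (G \<inter> (cbox a b \<inter> {x. x \<bullet> k \<le> c})) + measure lebesgue (G \<inter> (cbox a b \<inter> {x. c \<le> x \<bullet> k}))"
proof -
  have cl: "closed {x. x \<bullet> k \<le> c}" "closed {x. c \<le> x \<bullet> k}"
    by (intro closed_Collect_le continuous_intros)+
  have m: "G \<inter> (cbox a b \<inter> H) \<in> lmeasurable" if "closed H" for H
    using that G by (intro bounded_set_imp_lmeasurable) (auto intro: bounded_subset[of "cbox a b"] borel_closed)
  let ?S = "G \<inter> (cbox a b \<inter> {x. x \<bullet> k \<le> c})" and ?T = "G \<inter> (cbox a b \<inter> {x. c \<le> x \<bullet> k})"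
  have "negligible {x. k \<bullet> x = c}" using k by (intro negligible_hyperplane) auto
  moreover have "?S \<inter> ?T \<subseteq> {x. k \<bullet> x = c}" by (auto simp: inner_commute)
  ultimately have "negligible (?S \<inter> ?T)" by (rule negligible_subset)
  moreover have "?S \<union> ?T \<union> {} = G \<inter> cbox a b" by auto
  ultimately show ?thesis using measure_Un3_negligible[OF m[OF cl(1)] m[OF cl(2)], of "{}"] by simp
qed

lemma measure_tagged_division:
  fixes G :: "'a::euclidean_space set"
  assumes G: "G \<in> sets lebesgue" and p: "p tagged_division_of cbox a b"
  shows "(\<Sum>(x, K)\<in>p. measure lebesgue (G \<inter> K)) = measure lebesgue (G \<inter> cbox a b)"
proof (rule additive_tagged_division[OF _ measure_Int_box_split[OF G] p])
  fix a b :: 'a assume "box a b = {}"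
  then have "negligible (cbox a b)" by (simp add: negligible_interval)
  then have "negligible (G \<inter> cbox a b)" by (rule negligible_subset) auto
  then show "measure lebesgue (G \<inter> cbox a b) = 0" by (rule negligible_imp_measure0)
qed

text \<open>Cauchy's equation. The deviation \<open>k\<close> from the linear function is additive,
  zero at natural numbers and bounded on \<open>{0..1}\<close>. Hence \<open>n\<close> times
  \<open>k t\<close> is the value of \<open>k\<close> at the fractional part of
  \<open>n * t\<close>, which stays bounded, and \<open>k t\<close> must be 0.\<close>

lemma additive_bounded_linear:
  fixes h :: "real \<Rightarrow> complex"
  assumes add: "\<And>s t. 0 \<le> s \<Longrightarrow> 0 \<le> t \<Longrightarrow> h (s + t) = h s + h t" and bd: "\<And>t. 0 \<le> t \<Longrightarrow> norm (h t) \<le> B * t"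
    and t: "0 \<le> t"
  shows "h t = of_real t * h 1"
proof -
  define k where "k t = h t - of_real t * h 1" for t
  have kadd: "k (s + t) = k s + k t" if "0 \<le> s" "0 \<le> t" for s t
    using add[OF that] by (simp add: k_def algebra_simps)
  have k0: "k 0 = 0" using kadd[of 0 0] by simp
  have kn: "k (real n * t) = of_nat n * k t" if "0 \<le> t" for n t
  proof (induction n)
    case (Suc n)
    have "real (Suc n) * t = real n * t + t" by (simp add: algebra_simps)
    then show ?case using kadd[of "real n * t" t] that Suc by (simp add: algebra_simps)
  qed (simp add: k0)
  have kint: "k (real n) = 0" for n using kn[of 1 n] by (simp add: k_def)
  define C where "C = \<bar>B\<bar> + norm (h 1)"
  have kb: "norm (k t) \<le> C" if "0 \<le> t" "t \<le> 1" for t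
  proof -
    have "norm (k t) \<le> norm (h t) + norm (of_real t * h 1)" unfolding k_def by (rule norm_triangle_ineq4)
    also have "norm (of_real t * h 1) \<le> 1 * norm (h 1)" unfolding norm_mult using that by (intro mult_right_mono) auto
    also have "norm (h t) \<le> B * t" by (rule bd[OF that(1)])
    also have "B * t \<le> \<bar>B\<bar> * 1" using that by (intro mult_mono) auto
    finally show ?thesis by (simp add: C_def)
  qed
  have le: "real n * norm (k t) \<le> C" for n
  proof -
    define m where "m = nat \<lfloor>real n * t\<rfloor>"
    have nt: "0 \<le> real n * t" using t by simp
    then have m: "real m \<le> real n * t" "real n * t - real m \<le> 1" unfolding m_def by linarith+
    have "k (real n * t) = k (real m + (real n * t - real m))" by simp
    also have "\<dots> = k (real m) + k (real n * t - real m)" using m by (intro kadd) auto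
    finally have "of_nat n * k t = k (real n * t - real m)" using kn[OF t, of n] kint by simp
    then have "norm (of_nat n * k t) \<le> C" using kb[of "real n * t - real m"] m by simp
    then show ?thesis by (simp add: norm_mult)
  qed
  have "norm (k t) = 0"
  proof (rule ccontr)
    assume "norm (k t) \<noteq> 0"
    then have pos: "norm (k t) > 0" by simp
    obtain n :: nat where "C / norm (k t) < real n" using reals_Archimedean2 by blast
    then have "C < real n * norm (k t)" using pos by (simp add: field_simps)
    then show False using le[of n] by simp
  qed
  then show ?thesis by (simp add: k_def)
qed

section \<open>From the box bound to proportionality\<close>

context local_valuation begin

lemma atom_operative_empty:
  assumes "bounded P" "box a b = {}" shows "atom x (P \<inter> cbox a b) = 0"
proof (cases "P \<inter> cbox a b = {}")
  case False
  have "bounded (P \<inter> cbox a b)" using assms(1) by (rule bounded_subset) auto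
  then show ?thesis using box_empty_in_hyperplane[OF assms(2) False] by (rule atom_in_hyperplane)
qed (simp add: atom_def)

lemma atom_operative_split:
  assumes P: "compact P" "convex P" and k: "k \<in> Basis"
  shows "atom x (P \<inter> cbox a b) = atom x (P \<inter> (cbox a b \<inter> {y. y \<bullet> k \<le> c})) + atom x (P \<inter> (cbox a b \<inter> {y. c \<le> y \<bullet> k}))"
proof -
  have "compact (P \<inter> cbox a b)" "convex (P \<inter> cbox a b)" "k \<noteq> 0"
    using P k by (auto intro: compact_Int convex_Int)
  from atom_cut[OF this, of x c] show ?thesis by (simp only: Int_assoc)
qed

text \<open>Moving the centre of the box to the origin, with half its sides as \<open>r\<close>,
  reduces the claim to \<open>atom_box_bound\<close>; the part of \<open>P\<close> in the box is
  again a hull of finitely many points.\<close>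

lemma atom_small_box:
  assumes x: "x \<in> U"
  shows "\<exists>C \<delta>. \<delta> > 0 \<and> 0 \<le> C \<and> (\<forall>P a b. polytope P \<longrightarrow> (\<forall>i. b $ i - a $ i \<le> 2 * \<delta>) \<longrightarrow>
      norm (atom x (P \<inter> cbox a b)) \<le> C * measure lebesgue (cbox a b))"
proof -
  obtain C \<delta> where d: "\<delta> > 0" "0 \<le> C" and C: "\<And>r S. (\<forall>i. 0 < r $ i \<and> r $ i \<le> \<delta>) \<Longrightarrow> finite S \<Longrightarrow> S \<noteq> {} \<Longrightarrow> (\<forall>s\<in>S. \<forall>i. \<bar>s $ i\<bar> \<le> r $ i) \<Longrightarrow>
      norm (atom x (convex hull S)) \<le> C * (\<Prod>i\<in>UNIV. r $ i)"
    using atom_box_bound[OF x] by blast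
  show ?thesis
  proof (intro exI conjI allI impI)
    show "\<delta> > 0" "0 \<le> C" by (rule d)+
    fix P :: "(real^'n) set" and a b :: "real^'n"
    assume P: "polytope P" and ab': "\<forall>i. b $ i - a $ i \<le> 2 * \<delta>"
    have ab: "b $ i - a $ i \<le> 2 * \<delta>" for i using ab' by blast
    show "norm (atom x (P \<inter> cbox a b)) \<le> C * measure lebesgue (cbox a b)"
    proof (cases "box a b = {} \<or> P \<inter> cbox a b = {}")
      case True
      then have "atom x (P \<inter> cbox a b) = 0"
      proof
        assume "box a b = {}"
        then show ?thesis by (rule atom_operative_empty[OF polytope_imp_bounded[OF P]])
      qed (simp add: atom_def)
      then show ?thesis using d(2) by simp
    next
      case False
      then have lt: "a $ i < b $ i" for i by (auto simp: interval_eq_empty_cart not_le)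
      define c where "c = (1/2) *\<^sub>R (a + b)"
      define r where "r = (1/2) *\<^sub>R (b - a)"
      let ?Q = "P \<inter> cbox a b"
      have pQ: "polytope ?Q" using P polytope_interval by (rule polytope_Int)
      have "polytope ((+) (- c) ` ?Q)" using pQ by (simp only: polytope_translation_eq)
      then obtain S where S: "finite S" "(+) (- c) ` ?Q = convex hull S" by (auto simp: polytope_def)
      have ne: "S \<noteq> {}" using S(2) False by auto
      have Sr: "\<bar>s $ i\<bar> \<le> r $ i" if "s \<in> S" for s i
      proof -
        have "s \<in> (+) (- c) ` ?Q" unfolding S(2) using that by (rule hull_inc)
        then obtain y where "y \<in> cbox a b" "s = - c + y" by blast
        then have "a $ i \<le> y $ i" "y $ i \<le> b $ i" "s $ i = y $ i - (a $ i + b $ i) / 2"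
          by (auto simp: mem_box_cart c_def)
        then show ?thesis by (simp add: r_def abs_le_iff) (simp add: field_simps)
      qed
      have "norm (atom x (convex hull S)) \<le> C * (\<Prod>i\<in>UNIV. r $ i)"
      proof (rule C)
        show "\<forall>i. 0 < r $ i \<and> r $ i \<le> \<delta>"
        proof
          fix i show "0 < r $ i \<and> r $ i \<le> \<delta>" using lt[of i] ab[of i] by (simp add: r_def)
        qed
      qed (use S ne Sr in auto)
      moreover have "atom x (convex hull S) = atom x ?Q"
        unfolding S(2)[symmetric] by (rule atom_translate[OF polytope_imp_bounded[OF pQ]])
      moreover have "(\<Prod>i\<in>UNIV. r $ i) \<le> (\<Prod>i\<in>UNIV. b $ i - a $ i)"
      proof (rule prod_mono, rule conjI)
        fix i show "0 \<le> r $ i" "r $ i \<le> b $ i - a $ i" using lt[of i] by (auto simp: r_def)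
      qed
      moreover have "cbox a b \<noteq> {}" using False box_subset_cbox by blast
      then have "measure lebesgue (cbox a b) = (\<Prod>i\<in>UNIV. b $ i - a $ i)" using content_cbox_cart[of a b] by simp
      ultimately show ?thesis using d(2) mult_left_mono[of _ _ C] by (metis order_trans)
    qed
  qed
qed

text \<open>A fine division cuts the box into boxes small enough for \<open>atom_small_box\<close>;
  atoms and volumes both add up.\<close>

lemma atom_box:
  assumes x: "x \<in> U"
  shows "\<exists>C. 0 \<le> C \<and> (\<forall>P a b. polytope P \<longrightarrow> norm (atom x (P \<inter> cbox a b)) \<le> C * measure lebesgue (cbox a b))"
proof -
  obtain C \<delta> where d: "\<delta> > 0" "0 \<le> C" and C': "\<forall>P a b. polytope P \<longrightarrow> (\<forall>i. b $ i - a $ i \<le> 2 * \<delta>) \<longrightarrow>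
      norm (atom x (P \<inter> cbox a b)) \<le> C * measure lebesgue (cbox a b)"
    using atom_small_box[OF x] by (elim exE conjE)
  show ?thesis
  proof (intro exI conjI allI impI)
    show "0 \<le> C" by (rule d)
    fix P :: "(real^'n) set" and a b :: "real^'n"
    assume P: "polytope P"
    have cc: "compact P" "convex P" "bounded P" using P polytope_imp_compact polytope_imp_convex polytope_imp_bounded by auto
    obtain p where p: "p tagged_division_of cbox a b" "(\<lambda>x. ball x \<delta>) fine p"
      using fine_division_exists[OF gauge_ball[OF d(1)]] by blast
    have fp: "finite p" using p(1) by blast
    have "atom x (P \<inter> cbox a b) = (\<Sum>(y, K)\<in>p. atom x (P \<inter> K))"
      using additive_tagged_division[of "\<lambda>K. atom x (P \<inter> K)", OF atom_operative_empty[OF cc(3)] atom_operative_split[OF cc(1,2)] p(1)] by simp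
    also have "norm \<dots> \<le> (\<Sum>(y, K)\<in>p. C * measure lebesgue (UNIV \<inter> K))"
    proof (rule order_trans[OF norm_sum], rule sum_mono)
      fix z assume z: "z \<in> p"
      obtain y K where yK: "z = (y, K)" by (cases z)
      have "(y, K) \<in> p" using z yK by simp
      then obtain c d where K: "K = cbox c d" using p(1) by blast
      have "K \<subseteq> ball y \<delta>" using fineD[OF p(2) \<open>(y, K) \<in> p\<close>] .
      have "d $ i - c $ i \<le> 2 * \<delta>" if "cbox c d \<noteq> {}" for i
      proof -
        have "c \<in> cbox c d" "d \<in> cbox c d" using that by (auto simp: mem_box_cart interval_ne_empty_cart)
        then have "dist y c < \<delta>" "dist y d < \<delta>" using \<open>K \<subseteq> ball y \<delta>\<close> K by auto
        then have "dist c d < 2 * \<delta>" using dist_triangle3[of c d y] by linarith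
        moreover have "\<bar>(d - c) $ i\<bar> \<le> norm (d - c)" by (rule component_le_norm_cart)
        ultimately show ?thesis by (simp add: dist_norm norm_minus_commute abs_le_iff)
      qed
      then have "norm (atom x (P \<inter> cbox c d)) \<le> C * measure lebesgue (cbox c d)"
      proof (cases "cbox c d = {}")
        case True then show ?thesis by (simp add: atom_def)
      next
        case False
        then show ?thesis using C' P \<open>\<And>i. cbox c d \<noteq> {} \<Longrightarrow> d $ i - c $ i \<le> 2 * \<delta>\<close> by blast
      qed
      then show "norm (case z of (y, K) \<Rightarrow> atom x (P \<inter> K)) \<le> (case z of (y, K) \<Rightarrow> C * measure lebesgue (UNIV \<inter> K))"
        unfolding yK K by simp
    qed
    also have "\<dots> = C * (\<Sum>(y, K)\<in>p. measure lebesgue (UNIV \<inter> K))"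
      by (simp add: sum_distrib_left case_prod_unfold)
    also have "\<dots> = C * measure lebesgue (cbox a b)"
      using measure_tagged_division[of UNIV p a b] p(1) by simp
    finally show "norm (atom x (P \<inter> cbox a b)) \<le> C * measure lebesgue (cbox a b)" .
  qed
qed

text \<open>A cut orthogonal to the \<open>i\<close>-th axis and translation invariance give
  Cauchy's equation in the \<open>i\<close>-th side, and the volume bound makes its solution
  linear.\<close>

lemma atom_cbox_coordinate:
  assumes x: "x \<in> U" and l: "\<And>j. 0 \<le> l $ j"
  shows "atom x (cbox 0 l) = of_real (l $ i) * atom x (cbox 0 (\<chi> j. if j = i then 1 else l $ j))"
proof -
  obtain C where C: "0 \<le> C" "\<And>P a b. polytope P \<Longrightarrow> norm (atom x (P \<inter> cbox a b)) \<le> C * measure lebesgue (cbox a b)"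
    using atom_box[OF x] by blast
  define v where "v t = (\<chi> j. if j = i then t else l $ j)" for t
  define h where "h t = atom x (cbox 0 (v t))" for t
  have "h (l $ i) = of_real (l $ i) * h 1"
  proof (rule additive_bounded_linear)
    fix s t :: real assume st: "0 \<le> s" "0 \<le> t"
    let ?P = "cbox 0 (v (s + t))"
    have "atom x ?P = atom x (?P \<inter> {p. p \<bullet> axis i 1 \<le> s}) + atom x (?P \<inter> {p. s \<le> p \<bullet> axis i 1})"
      by (intro atom_cut) (auto simp: axis_eq_0_iff)
    also have "?P \<inter> {p. p \<bullet> axis i 1 \<le> s} = cbox 0 (v s)"
      using st by (auto simp: mem_box_cart inner_axis v_def split: if_splits) (metis add_increasing2 order_trans)+
    also have "?P \<inter> {p. s \<le> p \<bullet> axis i 1} = (+) (axis i s) ` cbox 0 (v t)"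
    proof (intro set_eqI iffI)
      fix p assume p: "p \<in> ?P \<inter> {p. s \<le> p \<bullet> axis i 1}"
      have "p - axis i s \<in> cbox 0 (v t)"
        unfolding mem_box_cart
      proof
        fix j
        have "0 \<le> p $ j" "p $ j \<le> v (s + t) $ j" "s \<le> p $ i" using p by (auto simp: mem_box_cart inner_axis)
        then show "0 $ j \<le> (p - axis i s) $ j \<and> (p - axis i s) $ j \<le> v t $ j"
          by (cases "j = i") (auto simp: v_def axis_def)
      qed
      then show "p \<in> (+) (axis i s) ` cbox 0 (v t)" by (intro image_eqI[of _ _ "p - axis i s"]) auto
    next
      fix p assume "p \<in> (+) (axis i s) ` cbox 0 (v t)"
      then obtain q where q: "p = axis i s + q" "\<And>j. 0 \<le> q $ j" "\<And>j. q $ j \<le> v t $ j" by (auto simp: mem_box_cart)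
      have "0 \<le> p $ j \<and> p $ j \<le> v (s + t) $ j" for j
        using q(2)[of j] q(3)[of j] st by (cases "j = i") (auto simp: q(1) v_def axis_def)
      moreover have "s \<le> p $ i" using q(2)[of i] by (simp add: q(1))
      ultimately show "p \<in> ?P \<inter> {p. s \<le> p \<bullet> axis i 1}" by (auto simp: mem_box_cart inner_axis)
    qed
    also have "atom x ((+) (axis i s) ` cbox 0 (v t)) = atom x (cbox 0 (v t))" by (rule atom_translate) simp
    finally show "h (s + t) = h s + h t" by (simp add: h_def)
  next
    fix t :: real assume t: "0 \<le> t"
    have ne: "cbox 0 (v t) \<noteq> {}" using t l by (auto simp: interval_ne_empty_cart v_def)
    have "norm (h t) \<le> C * measure lebesgue (cbox 0 (v t))"
      unfolding h_def using C(2)[OF polytope_interval, of 0 "v t" 0 "v t"] by simp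
    also have "measure lebesgue (cbox 0 (v t)) = (\<Prod>j\<in>UNIV. v t $ j)" using content_cbox_cart[OF ne] by simp
    also have "\<dots> = v t $ i * (\<Prod>j\<in>UNIV - {i}. v t $ j)" by (rule prod.remove) auto
    also have "\<dots> = t * (\<Prod>j\<in>UNIV - {i}. l $ j)" by (simp add: v_def)
    finally show "norm (h t) \<le> (C * (\<Prod>j\<in>UNIV - {i}. l $ j)) * t" by (simp add: ac_simps)
  qed (use l in auto)
  moreover have "v (l $ i) = l" by (simp add: v_def vec_eq_iff)
  ultimately show ?thesis by (simp add: h_def v_def)
qed

lemma atom_cbox:
  assumes x: "x \<in> U"
  shows "atom x (cbox a b) = of_real (measure lebesgue (cbox a b)) * atom x (cbox 0 1)"
proof (cases "box a b = {}")
  case True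
  then have "negligible (cbox a b)" by (simp add: negligible_interval)
  then have "measure lebesgue (cbox a b) = 0" by (rule negligible_imp_measure0)
  moreover have "atom x (cbox a b) = 0" using atom_operative_empty[of "cbox a b" a b x] True by simp
  ultimately show ?thesis by simp
next
  case False
  then have lt: "a $ i < b $ i" for i by (auto simp: interval_eq_empty_cart not_le)
  define l where "l = b - a"
  have l: "0 \<le> l $ i" for i using lt[of i] by (simp add: l_def)
  \<comment> \<open>The sides are replaced by 1 one coordinate at a time.\<close>
  have ind: "atom x (cbox 0 l) = of_real (\<Prod>i\<in>J. l $ i) * atom x (cbox 0 (\<chi> j. if j \<in> J then 1 else l $ j))" if "finite J" for J
    using that
  proof (induction J rule: finite_induct)
    case (insert i J)
    define l' where "l' = (\<chi> j. if j \<in> J then 1 else l $ j)"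
    have "atom x (cbox 0 l') = of_real (l' $ i) * atom x (cbox 0 (\<chi> j. if j = i then 1 else l' $ j))"
      by (rule atom_cbox_coordinate[OF x]) (simp add: l'_def l)
    moreover have "l' $ i = l $ i" using insert by (simp add: l'_def)
    moreover have "(\<chi> j. if j = i then 1 else l' $ j) = (\<chi> j. if j \<in> insert i J then 1 else l $ j)"
      by (auto simp: vec_eq_iff l'_def)
    ultimately show ?case using insert by (simp add: l'_def mult_ac)
  qed (simp add: vec_eq_iff)
  have "cbox a b = (+) a ` cbox 0 l" using cbox_translation[of a 0 l] by (simp add: l_def)
  then have "atom x (cbox a b) = atom x (cbox 0 l)" using atom_translate[of "cbox 0 l" x a] by simp
  also have "\<dots> = of_real (\<Prod>i\<in>UNIV. l $ i) * atom x (cbox 0 1)"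
    using ind[of UNIV] by (simp add: one_vec_def)
  also have "(\<Prod>i\<in>UNIV. l $ i) = measure lebesgue (cbox a b)"
  proof -
    have "cbox a b \<noteq> {}" using False box_subset_cbox[of a b] by blast
    then show ?thesis using content_cbox_cart[of a b] by (simp add: l_def)
  qed
  finally show ?thesis .
qed

text \<open>The defect \<open>D\<close> from proportionality is additive over divisions, vanishes on
  boxes that miss the frontier of \<open>P\<close>, and is at most a constant times the volume on
  the others. The frontier of a convex set is negligible, so the total defect is arbitrarily
  small.\<close>

theorem atom_eq_volume:
  assumes x: "x \<in> U" and P: "polytope P"
  shows "atom x P = of_real (measure lebesgue P) * atom x (cbox 0 1)"
proof -
  obtain C where C: "0 \<le> C" "\<And>P a b. polytope P \<Longrightarrow> norm (atom x (P \<inter> cbox a b)) \<le> C * measure lebesgue (cbox a b)"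
    using atom_box[OF x] by blast
  have cc: "compact P" "convex P" "bounded P" using P polytope_imp_compact polytope_imp_convex polytope_imp_bounded by auto
  have Pm: "P \<in> sets lebesgue" using borel_compact[OF cc(1)] by simp
  define c where "c = atom x (cbox 0 1)"
  define D where "D K = atom x (P \<inter> K) - of_real (measure lebesgue (P \<inter> K)) * c" for K
  obtain a b where ab: "P \<subseteq> cbox a b" using bounded_subset_cbox_symmetric[OF cc(3)] by blast
  have bd: "norm (D (cbox s t)) \<le> (C + norm c) * measure lebesgue (cbox s t)" for s t
  proof -
    have "norm (D (cbox s t)) \<le> norm (atom x (P \<inter> cbox s t)) + norm (of_real (measure lebesgue (P \<inter> cbox s t)) * c)"
      unfolding D_def by (rule norm_triangle_ineq4)
    also have "norm (of_real (measure lebesgue (P \<inter> cbox s t)) * c) \<le> measure lebesgue (cbox s t) * norm c"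
    proof -
      have "measure lebesgue (P \<inter> cbox s t) \<le> measure lebesgue (cbox s t)"
        by (rule measure_mono_fmeasurable) (use Pm in auto)
      then show ?thesis by (simp add: norm_mult mult_right_mono)
    qed
    finally show ?thesis using C(2)[OF P, of s t] by (simp add: algebra_simps)
  qed
  \<comment> \<open>A box is connected: if it misses the frontier, it lies inside \<open>P\<close>,
    where \<open>atom_cbox\<close> applies, or outside.\<close>
  have D0: "D (cbox s t) = 0" if "cbox s t \<inter> frontier P = {}" for s t
  proof -
    have "connected (cbox s t)" by (simp add: convex_connected)
    then have "cbox s t \<inter> P = {} \<or> cbox s t - P = {}" using connected_Int_frontier that by blast
    then show ?thesis
    proof
      assume "cbox s t \<inter> P = {}"
      then have "P \<inter> cbox s t = {}" by blast
      then show ?thesis by (simp add: D_def atom_def)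
    next
      assume "cbox s t - P = {}"
      then have "P \<inter> cbox s t = cbox s t" by blast
      then show ?thesis using atom_cbox[OF x, of s t] by (simp add: D_def c_def)
    qed
  qed
  have small: "norm (D (cbox a b)) \<le> (C + norm c) * e" if e: "e > 0" for e
  proof -
    have nf: "negligible (frontier P)" using cc(2) by (rule negligible_convex_frontier)
    then have nP: "frontier P \<in> null_sets lebesgue" by (simp add: negligible_iff_null_sets)
    obtain G where G: "open G" "frontier P \<subseteq> G" "emeasure lebesgue (G - frontier P) < ennreal e"
      by (rule sets_lebesgue_outer_open[OF null_setsD2[OF nP] e])
    have Gs: "G \<in> sets lebesgue" using G(1) by simp
    have Ge: "emeasure lebesgue G < ennreal e" using G(3) emeasure_Diff_null_set[OF nP Gs] by simp
    then have Gl: "G \<in> lmeasurable" using Gs by (intro fmeasurableI) (auto intro: less_trans)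
    then have Gm: "measure lebesgue G < e" using Ge e by (simp add: emeasure_eq_measure2 ennreal_less_iff)
    \<comment> \<open>Boxes tagged at a frontier point stay inside \<open>G\<close>, whose volume is
      below \<open>e\<close>; all other boxes miss the frontier.\<close>
    define \<gamma> where "\<gamma> y = (if y \<in> frontier P then G else - frontier P)" for y
    have "gauge \<gamma>" unfolding gauge_def \<gamma>_def using G(1,2) by (auto intro: open_Compl)
    then obtain p where p: "p tagged_division_of cbox a b" "\<gamma> fine p" using fine_division_exists by blast
    have "D (cbox a b) = (\<Sum>(y, K)\<in>p. D K)"
    proof (rule additive_tagged_division[OF _ _ p(1), symmetric])
      fix s t :: "real^'n" assume e: "box s t = {}"
      then have "negligible (cbox s t)" by (simp add: negligible_interval)
      then have "negligible (P \<inter> cbox s t)" by (rule negligible_subset) auto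
      then have "measure lebesgue (P \<inter> cbox s t) = 0" by (rule negligible_imp_measure0)
      then show "D (cbox s t) = 0" using atom_operative_empty[OF cc(3) e] by (simp add: D_def)
    next
      fix s t k :: "real^'n" and q assume k: "k \<in> Basis"
      show "D (cbox s t) = D (cbox s t \<inter> {x. x \<bullet> k \<le> q}) + D (cbox s t \<inter> {x. q \<le> x \<bullet> k})"
        unfolding D_def atom_operative_split[OF cc(1,2) k, of x s t q] measure_Int_box_split[OF Pm k, of s t q]
        by (simp add: algebra_simps)
    qed
    also have "norm \<dots> \<le> (\<Sum>(y, K)\<in>p. (C + norm c) * measure lebesgue (G \<inter> K))"
    proof (rule order_trans[OF norm_sum], rule sum_mono)
      fix z assume z: "z \<in> p"
      obtain y K where yK: "z = (y, K)" by (cases z)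
      then obtain s t where K: "K = cbox s t" using p(1) z by blast
      have sub: "K \<subseteq> \<gamma> y" using p(2) z yK by blast
      have "norm (D K) \<le> (C + norm c) * measure lebesgue (G \<inter> K)"
      proof (cases "y \<in> frontier P")
        case True
        then have "G \<inter> K = K" using sub by (auto simp: \<gamma>_def)
        then show ?thesis using bd[of s t] K by simp
      next
        case False
        then have "cbox s t \<inter> frontier P = {}" using sub K by (auto simp: \<gamma>_def)
        then have "D K = 0" using D0 K by simp
        then show ?thesis using C(1) by simp
      qed
      then show "norm (case z of (y, K) \<Rightarrow> D K) \<le> (case z of (y, K) \<Rightarrow> (C + norm c) * measure lebesgue (G \<inter> K))"
        unfolding yK by simp
    qed
    also have "\<dots> = (C + norm c) * (\<Sum>(y, K)\<in>p. measure lebesgue (G \<inter> K))"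
      by (simp add: sum_distrib_left case_prod_unfold)
    also have "\<dots> = (C + norm c) * measure lebesgue (G \<inter> cbox a b)"
      using measure_tagged_division[OF Gs p(1)] by simp
    also have "\<dots> \<le> (C + norm c) * e"
    proof (rule mult_left_mono)
      have "measure lebesgue (G \<inter> cbox a b) \<le> measure lebesgue G"
        using Gl Gs by (intro measure_mono_fmeasurable) auto
      then show "measure lebesgue (G \<inter> cbox a b) \<le> e" using Gm by linarith
      show "0 \<le> C + norm c" using C(1) by simp
    qed
    finally show ?thesis .
  qed
  have "norm (D (cbox a b)) \<le> 0"
  proof (rule field_le_epsilon)
    fix e :: real assume e: "0 < e"
    have pos: "C + norm c + 1 > 0" using C(1) by (simp add: add_nonneg_pos)
    have "norm (D (cbox a b)) \<le> (C + norm c) * (e / (C + norm c + 1))" using small[of "e / (C + norm c + 1)"] e pos by simp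
    also have "\<dots> \<le> (C + norm c + 1) * (e / (C + norm c + 1))" using e pos by (intro mult_right_mono) auto
    also have "\<dots> = e" using pos by simp
    finally show "norm (D (cbox a b)) \<le> 0 + e" by simp
  qed
  moreover have "P \<inter> cbox a b = P" using ab by blast
  ultimately show ?thesis by (simp add: D_def c_def)
qed

end

section \<open>The integral representation\<close>

context local_valuation begin

text \<open>The unit cube has volume 1, so its atom is the factor of proportionality at
  \<open>x\<close>.\<close>

definition ma_density :: "real^'n \<Rightarrow> complex" where "ma_density x = atom x (cbox 0 1)"

lemma continuous_ma_density: "continuous_on U ma_density"
proof -
  obtain S :: "(real^'n) set" where S: "finite S" "cbox 0 1 = convex hull S"
    using polytope_interval[of 0 "1 :: real^'n"] by (auto simp: polytope_def)
  have "(0 :: real^'n) \<in> cbox 0 1" by (simp add: mem_box_cart)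
  then have "S \<noteq> {}" using S(2) by auto
  from continuous_atom[OF S(1) this] show ?thesis unfolding ma_density_def S(2) .
qed

text \<open>Both sides are sums over the vertices: the subdifferential measure of a vertex is the
  volume of its cell, and the atom is this volume times the density.\<close>

lemma cr_int_maxaff_on_eq_integral:
  assumes A: "finite A" "A \<noteq> {}" and \<phi>: "Cc U \<phi>"
  shows "cr_int U (\<Psi> (maxaff_on A)) \<phi> = (\<integral>x. \<phi> x * ma_density x \<partial>subdiff_measure U (maxaff_on A))"
proof -
  have f: "convex_on U (maxaff_on A)" using maxaff_on_Conv[OF A] by (simp add: Conv_def)
  have fc: "continuous_on U (maxaff_on A)" by (rule convex_on_continuous[OF opn f])
  have RA: "maxaff_on A y = maxaff A y" if "y \<in> U" for y using that by (simp add: maxaff_on_def restr_def)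
  let ?M = "subdiff_measure U (maxaff_on A)"
  have M: "lfm U ?M" by (rule lfm_subdiff_measure[OF opn fc])
  have fV: "finite (vertices A \<inter> U)" using finite_vertices[OF A] by simp
  have nV: "emeasure ?M (- (vertices A \<inter> U)) = 0"
  proof -
    have sb: "sets ?M = sets borel" by (rule lfm_sets[OF M])
    have "closed (vertices A)" using finite_vertices[OF A] by (rule finite_imp_closed)
    then have b: "- vertices A \<in> sets ?M" "- U \<in> sets ?M" unfolding sb using opn by (auto intro: borel_open)
    have "emeasure ?M (- (vertices A \<inter> U)) = emeasure ?M (- vertices A \<union> - U)" by (simp add: Compl_Int)
    also have "\<dots> \<le> emeasure ?M (- vertices A) + emeasure ?M (- U)" by (rule emeasure_subadditive[OF b])
    also have "\<dots> = 0" using subdiff_measure_maxaff(1)[OF A opn fc RA] M by (simp add: lfm_def)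
    finally show ?thesis by simp
  qed
  have at: "emeasure ?M {v} = emeasure lebesgue (cell A v)" if "v \<in> U" for v
    by (rule subdiff_measure_maxaff(2)[OF A opn fc RA that])
  have pc: "polytope (cell A v)" for v
    unfolding cell_def using A(1) active_subset by (intro polytope_convex_hull finite_imageI) (rule finite_subset)
  have "(\<integral>x. \<phi> x * ma_density x \<partial>?M) = (\<Sum>v\<in>vertices A \<inter> U. measure ?M {v} *\<^sub>R (\<phi> v * ma_density v))"
  proof (rule integral_finite_support[OF lfm_sets[OF M] fV nV])
    show "emeasure ?M {v} < \<infinity>" if "v \<in> vertices A \<inter> U" for v
      using lfm_compact[OF M, of "{v}"] that by simp
    show "(\<lambda>x. \<phi> x * ma_density x) \<in> borel_measurable borel" by (rule Cc_borel[OF Cc_mult[OF \<phi> continuous_ma_density]])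
  qed
  also have "\<dots> = (\<Sum>v\<in>vertices A \<inter> U. atom v (cell A v) * \<phi> v)"
  proof (rule sum.cong)
    fix v assume "v \<in> vertices A \<inter> U"
    then have v: "v \<in> U" by simp
    have "measure ?M {v} = measure lebesgue (cell A v)" using at[OF v] by (simp add: measure_def)
    then show "measure ?M {v} *\<^sub>R (\<phi> v * ma_density v) = atom v (cell A v) * \<phi> v"
      using atom_eq_volume[OF v pc, of v] by (simp add: ma_density_def scaleR_conv_of_real)
  qed simp
  finally show ?thesis unfolding cr_int_maxaff_on[OF A \<phi>] ..
qed

text \<open>By continuity of \<open>ma_density\<close>, its product with \<open>\<phi>\<close> is
  again a test function, so both sides pass to the limit along maxima of affine functions.\<close>

lemma cr_int_eq_integral:
  assumes ne: "U \<noteq> {}" and f: "f \<in> Conv U" and \<phi>: "Cc U \<phi>"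
  shows "cr_int U (\<Psi> f) \<phi> = (\<integral>x. \<phi> x * ma_density x \<partial>subdiff_measure U f)"
proof -
  have cf: "convex_on U f" using f by (simp add: Conv_def)
  obtain A :: "nat \<Rightarrow> ((real^'n) \<times> real) set" where A: "\<And>n. finite (A n)" "\<And>n. A n \<noteq> {}" and l: "conv_lim U (\<lambda>n. maxaff (A n)) f sequentially"
    by (rule approx_sequences[OF opn ne cf]) (erule that, assumption+)
  have lim: "conv_lim U (\<lambda>n. maxaff_on (A n)) f sequentially"
    unfolding conv_lim_def
  proof (intro allI impI)
    fix K :: "(real^'n) set" and e :: real assume K: "compact K \<and> K \<subseteq> U" and e: "e > 0"
    then have "eventually (\<lambda>n. \<forall>x\<in>K. \<bar>maxaff (A n) x - f x\<bar> < e) sequentially" using conv_limD[OF l] by blast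
    then show "eventually (\<lambda>n. \<forall>x\<in>K. \<bar>maxaff_on (A n) x - f x\<bar> < e) sequentially"
      by eventually_elim (use K in \<open>auto simp: maxaff_on_def restr_def\<close>)
  qed
  have cR: "convex_on U (maxaff_on (A n))" for n using maxaff_on_Conv[OF A] by (simp add: Conv_def)
  have "(\<lambda>n. cr_int U (\<Psi> (maxaff_on (A n))) \<phi>) \<longlonglongrightarrow> cr_int U (\<Psi> f) \<phi>"
    by (rule seq_cont[OF maxaff_on_Conv[OF A] f lim \<phi>])
  moreover have "(\<lambda>n. cr_int U (\<Psi> (maxaff_on (A n))) \<phi>) \<longlonglongrightarrow> (\<integral>x. \<phi> x * ma_density x \<partial>subdiff_measure U f)"
    unfolding cr_int_maxaff_on_eq_integral[OF A \<phi>]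
    by (rule subdiff_measure_weak_continuous[OF opn cf cR lim Cc_mult[OF \<phi> continuous_ma_density]])
  ultimately show ?thesis by (rule LIMSEQ_unique)
qed

text \<open>Agreement on test functions passes to relatively compact Borel sets through one
  vanishing combination of five measures: the four presenting \<open>\<Psi> f\<close>, and the
  Monge-Ampere measure with weight \<open>- ma_density\<close>.\<close>

lemma representation:
  assumes f: "f \<in> Conv U" and B: "relcpt_borel U B"
  shows "\<Psi> f B = set_lebesgue_integral (MA U f) B ma_density"
proof (cases "U = {}")
  case True
  then have "B = {}" using B by (auto simp: relcpt_borel_def)
  then show ?thesis using Psi_empty[OF f] by (simp add: set_lebesgue_integral_def)
next
  case False
  have cf: "convex_on U f" using f by (simp add: Conv_def)
  have fc: "continuous_on U f" by (rule convex_on_continuous[OF opn cf])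
  let ?\<mu> = "subdiff_measure U f"
  have \<mu>: "lfm U ?\<mu>" by (rule lfm_subdiff_measure[OF opn fc])
  obtain M1 M2 M3 M4 where rep: "cradon_rep U (\<Psi> f) M1 M2 M3 M4" using radon[OF f] by (auto simp: cradon_def)
  have lM: "lfm U M1" "lfm U M2" "lfm U M3" "lfm U M4" using rep by (auto simp: cradon_rep_def)
  define M where "M i = [M1, M2, M3, M4, ?\<mu>] ! i" for i
  define c :: "nat \<Rightarrow> real^'n \<Rightarrow> complex" where "c i = [\<lambda>_. 1, \<lambda>_. -1, \<lambda>_. \<i>, \<lambda>_. -\<i>, \<lambda>x. - ma_density x] ! i" for i
  have S: "(\<Sum>i<5. G i) = G 0 + G 1 + G 2 + G 3 + G 4" for G :: "nat \<Rightarrow> complex"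
    by (simp add: numeral_eq_Suc)
  have "(\<Sum>i<5. set_lebesgue_integral (M i) B (c i)) = 0"
  proof (rule vanish_on_relcpt_if_vanish_on_Cc[OF opn _ _ _ _ B])
    fix i :: nat assume "i \<in> {..<5}"
    then have i: "i = 0 \<or> i = 1 \<or> i = 2 \<or> i = 3 \<or> i = 4" by auto
    show "lfm U (M i)" using i lM \<mu> by (auto simp: M_def)
    show "continuous_on U (c i)" using i continuous_ma_density by (auto simp: c_def intro: continuous_on_minus)
  next
    fix \<phi> assume \<phi>: "Cc U \<phi>"
    show "(\<Sum>i<5. \<integral>x. \<phi> x * c i x \<partial>M i) = 0"
      using cr_int_eq_integral[OF False f \<phi>] unfolding S cr_int_eq[OF rep \<phi>]
      by (simp add: M_def c_def algebra_simps)
  qed simp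
  moreover have m: "set_lebesgue_integral N B (\<lambda>_. z) = of_real (measure N B) * z" if N: "lfm U N" for N and z :: complex
  proof -
    have BK: "B \<subseteq> closure B" "compact (closure B)" "closure B \<subseteq> U" "B \<in> sets borel"
      using B closure_subset by (auto simp: relcpt_borel_def)
    have "emeasure N B \<le> emeasure N (closure B)"
      using lfm_sets[OF N] BK by (intro emeasure_mono) auto
    also have "\<dots> < \<infinity>" by (rule lfm_compact[OF N BK(2,3)])
    finally have "emeasure N B < \<infinity>" .
    moreover have "B \<in> sets N" using BK lfm_sets[OF N] by simp
    ultimately show ?thesis
      unfolding set_lebesgue_integral_def by (simp add: lfm_space[OF N] scaleR_conv_of_real)
  qed
  have minus: "set_lebesgue_integral ?\<mu> B (\<lambda>x. - ma_density x) = - set_lebesgue_integral ?\<mu> B ma_density"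
    by (simp add: set_lebesgue_integral_def)
  ultimately have "of_real (measure M1 B) - of_real (measure M2 B) + \<i> * (of_real (measure M3 B) - of_real (measure M4 B)) = set_lebesgue_integral ?\<mu> B ma_density"
    unfolding S using m[OF lM(1), of 1] m[OF lM(2), of "-1"] m[OF lM(3), of \<i>] m[OF lM(4), of "-\<i>"]
    by (simp add: M_def c_def minus algebra_simps)
  moreover have "\<Psi> f B = of_real (measure M1 B) - of_real (measure M2 B) + \<i> * (of_real (measure M3 B) - of_real (measure M4 B))"
    using rep B by (simp add: cradon_rep_def)
  ultimately show ?thesis by (simp add: MA_convex[OF opn cf])
qed

text \<open>The cone over the unit cube with apex \<open>x\<close> has Monge-Ampere mass 1 at
  \<open>x\<close>. Integrals over \<open>{x}\<close> thus evaluate a density at \<open>x\<close>,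
  which yields uniqueness point by point.\<close>

lemma MA_cube_atom:
  assumes x: "x \<in> U"
  shows "set_lebesgue_integral (MA U (cone_fun (cbox 0 1) x)) {x} g = (g x :: complex)"
proof -
  let ?I = "cbox 0 1 :: (real^'n) set"
  obtain S :: "(real^'n) set" where S: "finite S" "?I = convex hull S"
    using polytope_interval[of 0 "1 :: real^'n"] by (auto simp: polytope_def)
  have "(0 :: real^'n) \<in> ?I" by (simp add: mem_box_cart)
  then have ne: "S \<noteq> {}" using S(2) by auto
  let ?A = "cone_pieces S x"
  have A: "finite ?A" "?A \<noteq> {}" using S ne by (auto simp: cone_pieces_def)
  have Req: "cone_fun ?I x = maxaff_on ?A" unfolding S(2) by (rule cone_pieces(1)[OF S(1) ne])
  have cf: "convex_on U (maxaff_on ?A)" using maxaff_on_Conv[OF A] by (simp add: Conv_def)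
  have fc: "continuous_on U (maxaff_on ?A)" by (rule convex_on_continuous[OF opn cf])
  have RA: "maxaff_on ?A y = maxaff ?A y" if "y \<in> U" for y using that by (simp add: maxaff_on_def restr_def)
  have MA: "MA U (cone_fun ?I x) = subdiff_measure U (maxaff_on ?A)" unfolding Req by (rule MA_convex[OF opn cf])
  have M: "lfm U (subdiff_measure U (maxaff_on ?A))" by (rule lfm_subdiff_measure[OF opn fc])
  have "cell ?A x = ?I" unfolding S(2) by (rule cone_pieces(2)[OF S(1) ne])
  then have e: "emeasure (subdiff_measure U (maxaff_on ?A)) {x} = emeasure lebesgue ?I"
    using subdiff_measure_maxaff(2)[OF A opn fc RA x] by simp
  have "?I \<noteq> {}" using \<open>0 \<in> ?I\<close> by blast
  then have "measure lebesgue ?I = 1" using content_cbox_cart[of 0 "1 :: real^'n"] by simp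
  then have m1: "measure (subdiff_measure U (maxaff_on ?A)) {x} = 1" using e by (simp add: measure_def)
  have xs: "{x} \<in> sets (subdiff_measure U (maxaff_on ?A))" using lfm_sets[OF M] by simp
  have "set_lebesgue_integral (subdiff_measure U (maxaff_on ?A)) {x} g = (\<integral>y. indicat_real {x} y *\<^sub>R g x \<partial>subdiff_measure U (maxaff_on ?A))"
    unfolding set_lebesgue_integral_def by (intro Bochner_Integration.integral_cong) (auto simp: indicator_def)
  also have "\<dots> = g x"
    using m1 xs lfm_compact[OF M, of "{x}"] x by (simp add: lfm_space[OF M])
  finally show ?thesis unfolding MA .
qed

end

theorem theorem1p1:
  fixes U :: "(real^'n) set"
    and \<Psi> :: "(real^'n \<Rightarrow> real) \<Rightarrow> ((real^'n) set \<Rightarrow> complex)"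
  assumes "open U" and "convex U"
    and "\<forall>f\<in>Conv U. cradon U (\<Psi> f)"
    and "cont_val U \<Psi>"
    and "is_valuation U \<Psi>"
    and "dually_epi_translation_invariant U \<Psi>"
    and "dually_simple U \<Psi>"
    and "locally_determined U \<Psi>"
  shows "\<exists>\<psi>::real^'n \<Rightarrow> complex. continuous_on U \<psi> \<and>
           (\<forall>f\<in>Conv U. \<forall>B. relcpt_borel U B \<longrightarrow>
              \<Psi> f B = set_lebesgue_integral (MA U f) B \<psi>) \<and>
           (\<forall>\<psi>'::real^'n \<Rightarrow> complex. continuous_on U \<psi>' \<and>
              (\<forall>f\<in>Conv U. \<forall>B. relcpt_borel U B \<longrightarrow>
                 \<Psi> f B = set_lebesgue_integral (MA U f) B \<psi>')
              \<longrightarrow> (\<forall>x\<in>U. \<psi>' x = \<psi> x))"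
proof -
  interpret local_valuation U \<Psi>
  proof (rule local_valuation.intro)
    show "cradon U (\<Psi> f)" if "f \<in> Conv U" for f using assms(3) that by blast
  qed (fact assms)+
  show ?thesis
  proof (intro exI[of _ ma_density] conjI allI impI ballI)
    show "continuous_on U ma_density" by (rule continuous_ma_density)
    show "\<Psi> f B = set_lebesgue_integral (MA U f) B ma_density" if "f \<in> Conv U" "relcpt_borel U B" for f B
      using that by (rule representation)
    fix \<psi>' x
    assume u: "continuous_on U \<psi>' \<and> (\<forall>f\<in>Conv U. \<forall>B. relcpt_borel U B \<longrightarrow> \<Psi> f B = set_lebesgue_integral (MA U f) B \<psi>')"
      and x: "x \<in> U"
    have "(0 :: real^'n) \<in> cbox 0 1" by (simp add: mem_box_cart)
    then have cone_fun: "cone_fun (cbox 0 1) x \<in> Conv U" by (intro cone_fun_Conv) auto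
    have "set_lebesgue_integral (MA U (cone_fun (cbox 0 1) x)) {x} \<psi>' = set_lebesgue_integral (MA U (cone_fun (cbox 0 1) x)) {x} ma_density"
      using u representation[OF cone_fun relcpt_singleton[OF x]] cone_fun relcpt_singleton[OF x] by metis
    then show "\<psi>' x = ma_density x" unfolding MA_cube_atom[OF x] .
  qed
qed

end
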